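(* The space of initial conditions $S$ of the system $\frac{dq}{dt}=\frac{\partial I}{\partial p}$, $\frac{dp}{dt}=-\frac{\partial I}{\partial q}$ (with $I$, $\tilde S$ and $(-K_{\tilde S})_{red}$ as in the context) is obtained by gluing eight copies of $\mathbb{C}^2$: $$S=\tilde S-(-K_{\tilde S})_{red}=\mathbb{C}^2\cup\bigcup_{j=0}^{6}U_j,\qquad \mathbb{C}^2\ni(q,p),\quad U_j\cong\mathbb{C}^2\ni(x_j,y_j)\quad(j=0,1,\dots,6),$$ via the birational and symplectic transformations $$\begin{aligned} r_0&: x_0=1/q,\ y_0=-(qp+\alpha_0)q,\\ r_1&: x_1=-(pq-(\alpha_1+\alpha_2))p,\ y_1=1/p,\\ r_2&: x_2=-(pq-\alpha_2)p,\ y_2=1/p,\\ r_3&: x_3=-(p(q-1)-(\alpha_3+\alpha_4))p,\ y_3=1/p,\\ r_4&: x_4=-(p(q-1)-\alpha_4)p,\ y_4=1/p,\\ r_5&: x_5=-(x_0y_0-\alpha_5)y_0,\ y_5=1/y_0,\\ r_6&: x_6=-(x_0y_0-(\alpha_5+\alpha_6))y_0,\ y_6=1/y_0. \end{aligned}$$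
   Context: The constant parameters $\alpha_0,\dots,\alpha_6$ satisfy $3\alpha_0+\alpha_1+2\alpha_2+\alpha_3+2\alpha_4+2\alpha_5+\alpha_6=0$. The Hamiltonian is $$\begin{aligned} I={}&(q-1)^2q^2p^3-q(q-1)\{(\alpha_1+2\alpha_2+\alpha_3+2\alpha_4)q-\alpha_1-2\alpha_2\}p^2\\ &+\big[\{-3\alpha_0^2-2\alpha_0(\alpha_1+2\alpha_2+\alpha_3+2\alpha_4)-3\alpha_0\alpha_5-\alpha_5(\alpha_1+2\alpha_2+\alpha_3+2\alpha_4+\alpha_5)\}q^2\\ &\quad+\{3\alpha_0^2-\alpha_2^2+2\alpha_0(\alpha_1+2\alpha_2+\alpha_3+2\alpha_4)+3\alpha_0\alpha_5+2\alpha_2\alpha_5+\alpha_1(\alpha_5-\alpha_2)\\ &\quad\quad+(\alpha_4+\alpha_5)(\alpha_3+\alpha_4+\alpha_5)\}q+\alpha_2(\alpha_1+\alpha_2)\big]p\\ &+\alpha_0(\alpha_0+\alpha_5)(\alpha_0+\alpha_5+\alpha_6)q . \end{aligned}$$ Construction of $\tilde S$. The Hirzebruch surface $\Sigma_2$ is obtained by gluing four copies of $\mathbb{C}^2$ with coordinates $(z_j,w_j)$, $j=0,1,2,3$, via $z_0=q$, $w_0=p$; $z_1=1/q$, $w_1=-(qp+\alpha_0)q$; $z_2=z_0$, $w_2=1/w_0$; $z_3=z_1$, $w_3=1/w_1$. Let $D^{(0)}=\{w_2=0\}\cup\{w_3=0\}\subset\Sigma_2$. Blow up $\Sigma_2$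 at $a_\nu^{(0)}=\{(z_2,w_2)=(\nu,0)\}$ ($\nu=0,1$) and $a_\infty^{(0)}=\{(z_3,w_3)=(0,0)\}$, with exceptional curves $D_\nu^{(1)}$; near them use $(u_\nu,v_\nu)=\left(\frac{z_2-\nu}{w_2},w_2\right)$ ($\nu=0,1$), $(u_\infty,v_\infty)=\left(\frac{z_3}{w_3},w_3\right)$. Next blow up the six points $(u_0,v_0)=(\alpha_1+\alpha_2,0),(\alpha_2,0)$ on $D_0^{(1)}$; $(u_1,v_1)=(\alpha_3+\alpha_4,0),(\alpha_4,0)$ on $D_1^{(1)}$; $(u_\infty,v_\infty)=(\alpha_5,0),(\alpha_5+\alpha_6,0)$ on $D_\infty^{(1)}$. Finally blow down the strict transform of $D^{(0)}$ (a $(-1)$-curve) to a nonsingular point. The result is $\tilde S$; its anticanonical divisor is $-K_{\tilde S}=D_0^{(1)}+D_1^{(1)}+D_\infty^{(1)}$ (images of strict transforms), and $(-K_{\tilde S})_{red}$ denotes the corresponding reduced divisor. "Obtained by gluing via the $r_j$" means that $S$ is covered by the affine planes with coordinates $(q,p)$ and $(x_j,y_j)$, identified with each other by the birational maps $r_j$ ($r_5,r_6$ being taken relative to $(x_0,y_0)$). *)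

theory Defs
  imports "HOL-Analysis.Analysis" "HOL-Computational_Algebra.Polynomial"
begin

section \<open>Holomorphic, birational and symplectic maps of the complex plane of dimension two\<close>

type_synonym c2 = "complex \<times> complex"

definition complex_linear :: "(c2 \<Rightarrow> c2) \<Rightarrow> bool" where
  "complex_linear L \<longleftrightarrow> linear L \<and>
     (\<forall>c a b. L (c * a, c * b) = (c * fst (L (a, b)), c * snd (L (a, b))))"

text \<open>Only used for open sets.\<close>
definition holo_on :: "(c2 \<Rightarrow> c2) \<Rightarrow> c2 set \<Rightarrow> bool" where
  "holo_on f N \<longleftrightarrow> (\<forall>z\<in>N. \<exists>L. (f has_derivative L) (at z) \<and> complex_linear L)"

definition biholomorphic :: "(c2 \<Rightarrow> c2) \<Rightarrow> c2 set \<Rightarrow> c2 set \<Rightarrow> bool" where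
  "biholomorphic h N M \<longleftrightarrow> open N \<and> open M \<and> bij_betw h N M \<and>
     holo_on h N \<and> holo_on (the_inv_into N h) M"

definition poly2 :: "complex poly poly \<Rightarrow> c2 \<Rightarrow> complex" where
  "poly2 P = (\<lambda>(x, y). poly (poly P [:y:]) x)"

text \<open>Rational maps are represented by total functions; nothing is said about the values on the
  zero set of the (common) denominator, where division by zero may occur.\<close>
definition rational_map :: "(c2 \<Rightarrow> c2) \<Rightarrow> bool" where
  "rational_map f \<longleftrightarrow> (\<exists>P Q R. R \<noteq> 0 \<and>
     (\<forall>z. poly2 R z \<noteq> 0 \<longrightarrow> f z = (poly2 P z / poly2 R z, poly2 Q z / poly2 R z)))"

definition birational :: "(c2 \<Rightarrow> c2) \<Rightarrow> bool" where
  "birational f \<longleftrightarrow> rational_map f \<and> (\<exists>g. rational_map g \<and>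
     (\<exists>H. H \<noteq> 0 \<and> (\<forall>z. poly2 H z \<noteq> 0 \<longrightarrow> g (f z) = z \<and> f (g z) = z)))"

definition area_form :: "c2 \<Rightarrow> c2 \<Rightarrow> complex" where
  "area_form u v = fst u * snd v - snd u * fst v"

definition symplectic :: "(c2 \<Rightarrow> c2) \<Rightarrow> bool" where
  "symplectic f \<longleftrightarrow> (\<exists>G. open G \<and> closure G = UNIV \<and>
     (\<forall>z\<in>G. \<exists>L. (f has_derivative L) (at z) \<and> complex_linear L \<and>
        (\<forall>u v. area_form (L u) (L v) = area_form u v)))"


section \<open>Complex surfaces given by charts\<close>

type_synonym 'a chart = "'a set \<times> ('a \<Rightarrow> c2)"

record 'a surface =
  points :: "'a set"
  atlas :: "'a chart set"

definition surface_topology :: "'a surface \<Rightarrow> 'a topology" where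
  "surface_topology X = topology_generated_by {U \<inter> \<phi> -` N | U \<phi> N. (U, \<phi>) \<in> atlas X \<and> open N}"

definition holo_map :: "'a surface \<Rightarrow> 'a set \<Rightarrow> ('a \<Rightarrow> c2) \<Rightarrow> bool" where
  "holo_map X W g \<longleftrightarrow> (\<forall>(U, \<phi>) \<in> atlas X.
     open (\<phi> ` (U \<inter> W)) \<and> holo_on (g \<circ> the_inv_into U \<phi>) (\<phi> ` (U \<inter> W)))"

text \<open>Charts of the maximal atlas, i.e. holomorphic coordinates on an open subset.\<close>
definition compatible_chart :: "'a surface \<Rightarrow> 'a chart \<Rightarrow> bool" where
  "compatible_chart X = (\<lambda>(V, \<psi>). V \<subseteq> points X \<and> inj_on \<psi> V \<and> open (\<psi> ` V) \<and> holo_map X V \<psi> \<and>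
     (\<forall>(U, \<phi>) \<in> atlas X.
        open (\<psi> ` (U \<inter> V)) \<and> holo_on (\<phi> \<circ> the_inv_into V \<psi>) (\<psi> ` (U \<inter> V))))"

definition surface_diff :: "'a surface \<Rightarrow> 'a set \<Rightarrow> 'a surface" where
  "surface_diff X C =
     \<lparr>points = points X - C, atlas = {(U - C, \<phi>) | U \<phi>. (U, \<phi>) \<in> atlas X}\<rparr>"


section \<open>Gluing planes along birational maps\<close>

text \<open>A family \<open>f\<close> of birational maps expresses the coordinates of the \<open>i\<close>-th plane through the
  coordinates \<open>(q, p)\<close> of one reference plane. The point \<open>a\<close> of plane \<open>i\<close> is identified with the
  point \<open>b\<close> of plane \<open>j\<close> iff the birational map \<open>f j \<circ> (f i)\<^sup>-\<^sup>1\<close> is biregular at \<open>a\<close> with value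
  \<open>b\<close>: it extends to a biholomorphic germ \<open>h\<close>. The dense open set \<open>G\<close> discards the points at which
  the formulas for \<open>f i\<close>, \<open>f j\<close> divide by zero. Note that \<open>a\<close> need not lie in the range of \<open>f i\<close>.\<close>
definition glue_rel :: "('i \<Rightarrow> c2 \<Rightarrow> c2) \<Rightarrow> 'i \<Rightarrow> c2 \<Rightarrow> 'i \<Rightarrow> c2 \<Rightarrow> bool" where
  "glue_rel f i a j b \<longleftrightarrow> (\<exists>N M h G.
     a \<in> N \<and> b \<in> M \<and> biholomorphic h N M \<and> h a = b \<and> open G \<and> closure G = UNIV \<and>
     (\<forall>z\<in>G. f i z \<in> N \<longrightarrow> f j z = h (f i z)))"

definition glue_point :: "'i set \<Rightarrow> ('i \<Rightarrow> c2 \<Rightarrow> c2) \<Rightarrow> 'i \<Rightarrow> c2 \<Rightarrow> ('i \<times> c2) set" where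
  "glue_point J f i a = {(j, b). j \<in> J \<and> glue_rel f i a j b}"

definition glue_chart :: "'i set \<Rightarrow> ('i \<Rightarrow> c2 \<Rightarrow> c2) \<Rightarrow> 'i \<Rightarrow> ('i \<times> c2) set chart" where
  "glue_chart J f i = (range (glue_point J f i), \<lambda>x. THE a. (i, a) \<in> x)"

definition glue :: "'i set \<Rightarrow> ('i \<Rightarrow> c2 \<Rightarrow> c2) \<Rightarrow> ('i \<times> c2) set surface" where
  "glue J f = \<lparr>points = (\<Union>i\<in>J. range (glue_point J f i)), atlas = glue_chart J f ` J\<rparr>"

text \<open>The surface \<open>X\<close> is covered by planes \<open>U i\<close> with coordinates \<open>\<phi> i\<close>, identified with each other
  by the birational maps \<open>f j \<circ> (f i)\<^sup>-\<^sup>1\<close>.\<close>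
definition glued_from_planes ::
    "'a surface \<Rightarrow> 'i set \<Rightarrow> ('i \<Rightarrow> c2 \<Rightarrow> c2) \<Rightarrow> ('i \<Rightarrow> 'a set) \<Rightarrow> ('i \<Rightarrow> 'a \<Rightarrow> c2) \<Rightarrow> bool" where
  "glued_from_planes X J f U \<phi> \<longleftrightarrow>
     (\<forall>i\<in>J. compatible_chart X (U i, \<phi> i) \<and> \<phi> i ` U i = UNIV) \<and>
     points X = (\<Union>i\<in>J. U i) \<and>
     (\<forall>i\<in>J. \<forall>j\<in>J. \<forall>x\<in>U i. \<forall>y\<in>U j. x = y \<longleftrightarrow> glue_rel f i (\<phi> i x) j (\<phi> j y))"


section \<open>Blowing up points and blowing down a curve\<close>

text \<open>\<open>Exc c s\<close> is the point of the exceptional curve over the centre \<open>c\<close> with tangent direction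
  \<open>z / w = s\<close>, in a chosen chart with coordinates \<open>(z, w)\<close> vanishing at \<open>c\<close>; \<open>None\<close> is the
  direction \<open>w = 0\<close>.\<close>
datatype 'a blown = Off 'a | Exc 'a "complex option"

fun blow_proj :: "'a blown \<Rightarrow> 'a" where
  "blow_proj (Off x) = x"
| "blow_proj (Exc c s) = c"

text \<open>The two charts \<open>(z / w, w)\<close> and \<open>(z, w / z)\<close> of the blow-up near the exceptional curve over
  \<open>c\<close>, where \<open>(z, w) = \<phi> - \<phi> c\<close>. The set \<open>P\<close> contains all centres.\<close>
definition blow_chart1 :: "'a set \<Rightarrow> 'a \<Rightarrow> 'a chart \<Rightarrow> 'a blown chart" where
  "blow_chart1 P c = (\<lambda>(U, \<phi>).
     (Off ` {x \<in> U - P. snd (\<phi> x - \<phi> c) \<noteq> 0} \<union> {Exc c (Some s) | s. True},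
      \<lambda>y. case y of
            Off x \<Rightarrow> (fst (\<phi> x - \<phi> c) / snd (\<phi> x - \<phi> c), snd (\<phi> x - \<phi> c))
          | Exc _ None \<Rightarrow> undefined
          | Exc _ (Some s) \<Rightarrow> (s, 0)))"

definition blow_chart2 :: "'a set \<Rightarrow> 'a \<Rightarrow> 'a chart \<Rightarrow> 'a blown chart" where
  "blow_chart2 P c = (\<lambda>(U, \<phi>).
     (Off ` {x \<in> U - P. fst (\<phi> x - \<phi> c) \<noteq> 0} \<union> {Exc c s | s. s \<noteq> Some 0},
      \<lambda>y. case y of
            Off x \<Rightarrow> (fst (\<phi> x - \<phi> c), snd (\<phi> x - \<phi> c) / fst (\<phi> x - \<phi> c))
          | Exc _ None \<Rightarrow> (0, 0)
          | Exc _ (Some s) \<Rightarrow> (0, 1 / s)))"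

text \<open>\<open>B\<close> consists of the centres, each together with one chart around it. The result depends on
  the choice of these charts only up to a unique isomorphism over \<open>X\<close>.\<close>
definition blow_up :: "'a surface \<Rightarrow> ('a \<times> 'a chart) set \<Rightarrow> 'a blown surface" where
  "blow_up X B =
     \<lparr>points = Off ` (points X - fst ` B) \<union> {Exc c s | c s. c \<in> fst ` B},
      atlas = {(Off ` (U - fst ` B), \<phi> \<circ> blow_proj) | U \<phi>. (U, \<phi>) \<in> atlas X}
        \<union> {blow_chart1 (fst ` B) c k | c k. (c, k) \<in> B}
        \<union> {blow_chart2 (fst ` B) c k | c k. (c, k) \<in> B}\<rparr>"

definition exceptional :: "'a \<Rightarrow> 'a blown set" where
  "exceptional c = range (Exc c)"

definition strict_transform :: "'a surface \<Rightarrow> ('a \<times> 'a chart) set \<Rightarrow> 'a set \<Rightarrow> 'a blown set" where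
  "strict_transform X B C = surface_topology (blow_up X B) closure_of (Off ` (C - fst ` B))"

definition contraction :: "'a set \<Rightarrow> 'a \<Rightarrow> 'a option" where
  "contraction E x = (if x \<in> E then None else Some x)"

text \<open>The blow-down of \<open>E\<close> to the point \<open>None\<close>. The charts at \<open>None\<close> are those in which the
  contraction is holomorphic, and biholomorphic away from \<open>E\<close>.\<close>
definition blow_down :: "'a surface \<Rightarrow> 'a set \<Rightarrow> 'a option surface" where
  "blow_down X E =
     \<lparr>points = contraction E ` points X,
      atlas = {(Some ` (U - E), \<phi> \<circ> the) | U \<phi>. (U, \<phi>) \<in> atlas X}
        \<union> {(V, \<psi>). None \<in> V \<and> V \<subseteq> contraction E ` points X \<and> inj_on \<psi> V \<and> open (\<psi> ` V) \<and>
             holo_map X {x \<in> points X. contraction E x \<in> V} (\<psi> \<circ> contraction E) \<and>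
             compatible_chart X ({x \<in> points X. contraction E x \<in> V} - E, \<psi> \<circ> Some)}\<rparr>"


section \<open>The surface\<close>

text \<open>The coordinates \<open>(z\<^sub>j, w\<^sub>j)\<close> of the Hirzebruch surface in terms of \<open>(q, p)\<close>.\<close>
definition hirz_coords :: "complex \<Rightarrow> nat \<Rightarrow> c2 \<Rightarrow> c2" where
  "hirz_coords a0 j = (\<lambda>(q, p).
     if j = 0 then (q, p)
     else if j = 1 then (1 / q, - (q * p + a0) * q)
     else if j = 2 then (q, 1 / p)
     else (1 / q, 1 / (- (q * p + a0) * q)))"

type_synonym hirz_point = "(nat \<times> c2) set"

definition hirz :: "complex \<Rightarrow> hirz_point surface" where
  "hirz a0 = glue {0..3} (hirz_coords a0)"

definition hirz_pt :: "complex \<Rightarrow> nat \<Rightarrow> c2 \<Rightarrow> hirz_point" where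
  "hirz_pt a0 = glue_point {0..3} (hirz_coords a0)"

definition hirz_chart :: "complex \<Rightarrow> nat \<Rightarrow> hirz_point chart" where
  "hirz_chart a0 = glue_chart {0..3} (hirz_coords a0)"

definition D_section :: "complex \<Rightarrow> hirz_point set" where
  "D_section a0 = {hirz_pt a0 2 (z, 0) | z. True} \<union> {hirz_pt a0 3 (z, 0) | z. True}"

text \<open>Indices of the centres: \<open>Some \<nu>\<close> for \<open>\<nu> \<in> {0, 1}\<close> and \<open>None\<close> for infinity.\<close>
definition first_centre :: "complex \<Rightarrow> complex option \<Rightarrow> hirz_point" where
  "first_centre a0 \<nu> = (case \<nu> of Some c \<Rightarrow> hirz_pt a0 2 (c, 0) | None \<Rightarrow> hirz_pt a0 3 (0, 0))"

definition first_chart :: "complex \<Rightarrow> complex option \<Rightarrow> hirz_point chart" where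
  "first_chart a0 \<nu> = (case \<nu> of Some c \<Rightarrow> hirz_chart a0 2 | None \<Rightarrow> hirz_chart a0 3)"

definition first_centres :: "complex \<Rightarrow> (hirz_point \<times> hirz_point chart) set" where
  "first_centres a0 = (\<lambda>\<nu>. (first_centre a0 \<nu>, first_chart a0 \<nu>)) ` {Some 0, Some 1, None}"

definition X1 :: "complex \<Rightarrow> hirz_point blown surface" where
  "X1 a0 = blow_up (hirz a0) (first_centres a0)"

text \<open>The coordinates \<open>(u\<^sub>\<nu>, v\<^sub>\<nu>)\<close>.\<close>
definition uv_chart :: "complex \<Rightarrow> complex option \<Rightarrow> hirz_point blown chart" where
  "uv_chart a0 \<nu> =
     blow_chart1 (fst ` first_centres a0) (first_centre a0 \<nu>) (first_chart a0 \<nu>)"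

text \<open>The point \<open>(u\<^sub>\<nu>, v\<^sub>\<nu>) = (c, 0)\<close>.\<close>
definition uv_pt :: "complex \<Rightarrow> complex option \<Rightarrow> complex \<Rightarrow> hirz_point blown" where
  "uv_pt a0 \<nu> c = Exc (first_centre a0 \<nu>) (Some c)"

definition second_centres ::
    "(nat \<Rightarrow> complex) \<Rightarrow> (hirz_point blown \<times> hirz_point blown chart) set" where
  "second_centres \<alpha> = (\<lambda>(\<nu>, c). (uv_pt (\<alpha> 0) \<nu> c, uv_chart (\<alpha> 0) \<nu>)) `
     {(Some 0, \<alpha> 1 + \<alpha> 2), (Some 0, \<alpha> 2),
      (Some 1, \<alpha> 3 + \<alpha> 4), (Some 1, \<alpha> 4),
      (None, \<alpha> 5), (None, \<alpha> 5 + \<alpha> 6)}"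

definition X2 :: "(nat \<Rightarrow> complex) \<Rightarrow> hirz_point blown blown surface" where
  "X2 \<alpha> = blow_up (X1 (\<alpha> 0)) (second_centres \<alpha>)"

definition D_section_strict :: "(nat \<Rightarrow> complex) \<Rightarrow> hirz_point blown blown set" where
  "D_section_strict \<alpha> = strict_transform (X1 (\<alpha> 0)) (second_centres \<alpha>)
     (strict_transform (hirz (\<alpha> 0)) (first_centres (\<alpha> 0)) (D_section (\<alpha> 0)))"

definition D_exc_strict ::
    "(nat \<Rightarrow> complex) \<Rightarrow> complex option \<Rightarrow> hirz_point blown blown set" where
  "D_exc_strict \<alpha> \<nu> =
     strict_transform (X1 (\<alpha> 0)) (second_centres \<alpha>) (exceptional (first_centre (\<alpha> 0) \<nu>))"

type_synonym stilde_point = "hirz_point blown blown option"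

definition Stilde :: "(nat \<Rightarrow> complex) \<Rightarrow> stilde_point surface" where
  "Stilde \<alpha> = blow_down (X2 \<alpha>) (D_section_strict \<alpha>)"

text \<open>The support of the anticanonical divisor \<open>D\<^sub>0 + D\<^sub>1 + D\<^sub>\<infinity>\<close>.\<close>
definition anticanonical_red :: "(nat \<Rightarrow> complex) \<Rightarrow> stilde_point set" where
  "anticanonical_red \<alpha> =
     (\<Union>\<nu>\<in>{Some 0, Some 1, None}. contraction (D_section_strict \<alpha>) ` D_exc_strict \<alpha> \<nu>)"

definition space_of_initial_conditions :: "(nat \<Rightarrow> complex) \<Rightarrow> stilde_point surface" where
  "space_of_initial_conditions \<alpha> = surface_diff (Stilde \<alpha>) (anticanonical_red \<alpha>)"

text \<open>The point with coordinates \<open>(q, p)\<close>.\<close>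
definition qp_pt :: "(nat \<Rightarrow> complex) \<Rightarrow> c2 \<Rightarrow> stilde_point" where
  "qp_pt \<alpha> a = Some (Off (Off (hirz_pt (\<alpha> 0) 0 a)))"


section \<open>The Hamiltonian system\<close>

definition ham_I :: "(nat \<Rightarrow> complex) \<Rightarrow> complex \<Rightarrow> complex \<Rightarrow> complex" where
  "ham_I \<alpha> q p =
     (q - 1)^2 * q^2 * p^3
     - q * (q - 1) * ((\<alpha> 1 + 2 * \<alpha> 2 + \<alpha> 3 + 2 * \<alpha> 4) * q - \<alpha> 1 - 2 * \<alpha> 2) * p^2
     + ((- 3 * (\<alpha> 0)^2 - 2 * \<alpha> 0 * (\<alpha> 1 + 2 * \<alpha> 2 + \<alpha> 3 + 2 * \<alpha> 4) - 3 * \<alpha> 0 * \<alpha> 5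
           - \<alpha> 5 * (\<alpha> 1 + 2 * \<alpha> 2 + \<alpha> 3 + 2 * \<alpha> 4 + \<alpha> 5)) * q^2
        + (3 * (\<alpha> 0)^2 - (\<alpha> 2)^2 + 2 * \<alpha> 0 * (\<alpha> 1 + 2 * \<alpha> 2 + \<alpha> 3 + 2 * \<alpha> 4) + 3 * \<alpha> 0 * \<alpha> 5
           + 2 * \<alpha> 2 * \<alpha> 5 + \<alpha> 1 * (\<alpha> 5 - \<alpha> 2)
           + (\<alpha> 4 + \<alpha> 5) * (\<alpha> 3 + \<alpha> 4 + \<alpha> 5)) * q
        + \<alpha> 2 * (\<alpha> 1 + \<alpha> 2)) * p
     + \<alpha> 0 * (\<alpha> 0 + \<alpha> 5) * (\<alpha> 0 + \<alpha> 5 + \<alpha> 6) * q"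

definition hamiltonian_field :: "(complex \<Rightarrow> complex \<Rightarrow> complex) \<Rightarrow> c2 \<Rightarrow> c2" where
  "hamiltonian_field H = (\<lambda>(q, p). (deriv (\<lambda>p'. H q p') p, - deriv (\<lambda>q'. H q' p) q))"

text \<open>The vector field \<open>v\<close> on the plane embedded by \<open>e\<close> extends holomorphically to the set \<open>U\<close>
  with coordinates \<open>\<phi>\<close>; \<open>w\<close> is the extended field in these coordinates.\<close>
definition field_extends ::
    "(c2 \<Rightarrow> c2) \<Rightarrow> (c2 \<Rightarrow> 'a) \<Rightarrow> 'a set \<Rightarrow> ('a \<Rightarrow> c2) \<Rightarrow> bool" where
  "field_extends v e U \<phi> \<longleftrightarrow> (\<exists>w. holo_on w (\<phi> ` U) \<and>
     (\<forall>a. e a \<in> U \<longrightarrow> (\<exists>L. ((\<lambda>z. \<phi> (e z)) has_derivative L) (at a) \<and> L (v a) = w (\<phi> (e a)))))"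


section \<open>The coordinate changes\<close>

text \<open>For \<open>j \<le> 4\<close> the argument is \<open>(q, p)\<close>, for \<open>j = 5, 6\<close> it is \<open>(x\<^sub>0, y\<^sub>0)\<close>.\<close>
definition r_map :: "(nat \<Rightarrow> complex) \<Rightarrow> nat \<Rightarrow> c2 \<Rightarrow> c2" where
  "r_map \<alpha> j = (\<lambda>(q, p).
     if j = 0 then (1 / q, - (q * p + \<alpha> 0) * q)
     else if j = 1 then (- (p * q - (\<alpha> 1 + \<alpha> 2)) * p, 1 / p)
     else if j = 2 then (- (p * q - \<alpha> 2) * p, 1 / p)
     else if j = 3 then (- (p * (q - 1) - (\<alpha> 3 + \<alpha> 4)) * p, 1 / p)
     else if j = 4 then (- (p * (q - 1) - \<alpha> 4) * p, 1 / p)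
     else if j = 5 then (- (q * p - \<alpha> 5) * p, 1 / p)
     else (- (q * p - (\<alpha> 5 + \<alpha> 6)) * p, 1 / p))"

text \<open>The coordinates of the eight planes in terms of \<open>(q, p)\<close>; the index \<open>None\<close> is the plane of
  \<open>(q, p)\<close> itself.\<close>
definition plane_index :: "nat option set" where
  "plane_index = insert None (Some ` {0..6})"

definition plane_coords :: "(nat \<Rightarrow> complex) \<Rightarrow> nat option \<Rightarrow> c2 \<Rightarrow> c2" where
  "plane_coords \<alpha> i = (case i of None \<Rightarrow> id
     | Some j \<Rightarrow> if j = 5 \<or> j = 6 then r_map \<alpha> j \<circ> r_map \<alpha> 0 else r_map \<alpha> j)"

end

theory Submission
  imports Defs
begin

text \<open>Up to a sign, the planes \<open>U\<^sub>j\<close> with \<open>j \<ge> 1\<close> are the charts \<open>(z / w, w)\<close> of the second blow-up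
  around its centres; together with the planes of \<open>(q, p)\<close> and \<open>(x\<^sub>0, y\<^sub>0)\<close> they are disjoint from
  the removed curves, and every other point is a limit of points on one of these curves. Blowing
  up preserves the local compatibility of all charts, so the eight planes are compatible with
  the charts of the surface. That points identified by the gluing relation coincide is a Hausdorff
  property: on a dense set the coordinates of two planes satisfy polynomial identities, these pass
  to the limit, and they force the two limit points to be equal.

  In coordinates \<open>(r, p)\<close> centred at \<open>q = 0\<close>, \<open>1\<close> or \<open>\<infinity>\<close> the Hamiltonian is
  \<open>c p (r p - b) (r p - b') + A (r p) + r B (r p)\<close> with polynomials \<open>A\<close>, \<open>B\<close>, where \<open>b\<close>, \<open>b'\<close> are
  the two centres on the exceptional curve; at infinity this is where the relation between the
  parameters enters. The substitution \<open>r p = b - x y\<close>, \<open>p = 1 / y\<close> then yields a polynomial, and the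
  coordinate changes, being symplectic, map Hamiltonian fields to Hamiltonian fields.\<close>

text \<open>The relation \<open>glue_rel\<close> accepts any biholomorphic germ that agrees with the
  coordinate functions on a dense set. To decide which points it identifies, an independent
  description of the points is needed. The locale \<open>plane_model\<close> provides one: injective
  maps \<open>pt i\<close> into a set whose equality can be computed, such that the gluing relation
  is their kernel. For the Hirzebruch surface this set consists of normal forms, for the eight
  planes it consists of points of the blown-up surface \<open>X2 \<alpha>\<close>.

  The blow-down is the other obstacle, because its charts at the new point are characterised rather
  than constructed. However, the contracted curve meets the exceptional curve over 0, so the new
  point lies on the removed curves. What is left of such a chart is by definition compatible with
  \<open>X2 \<alpha>\<close>.\<close>

lemma complex_linear_compose:
  "complex_linear L \<Longrightarrow> complex_linear M \<Longrightarrow> complex_linear (M \<circ> L)"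
  unfolding complex_linear_def by (metis comp_apply linear_compose prod.collapse)

lemma holo_on_subset: "holo_on f N \<Longrightarrow> M \<subseteq> N \<Longrightarrow> holo_on f M"
  unfolding holo_on_def by blast

lemma holo_on_compose:
  assumes "holo_on f N" "holo_on g M" "f ` N \<subseteq> M"
  shows "holo_on (g \<circ> f) N"
  unfolding holo_on_def
proof
  fix z assume z: "z \<in> N"
  then obtain L where L: "(f has_derivative L) (at z)" "complex_linear L"
    using assms(1) unfolding holo_on_def by blast
  obtain M' where M': "(g has_derivative M') (at (f z))" "complex_linear M'"
    using assms(2,3) z unfolding holo_on_def by blast
  show "\<exists>L. (g \<circ> f has_derivative L) (at z) \<and> complex_linear L"
    using diff_chain_at[OF L(1) M'(1)] complex_linear_compose[OF L(2) M'(2)] by blast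
qed

lemma holo_on_cong:
  assumes "open N" "holo_on f N" "\<And>z. z \<in> N \<Longrightarrow> g z = f z"
  shows "holo_on g N"
  unfolding holo_on_def
proof
  fix z assume z: "z \<in> N"
  then obtain L where L: "(f has_derivative L) (at z)" "complex_linear L"
    using assms(2) unfolding holo_on_def by blast
  have "(g has_derivative L) (at z)"
    using has_derivative_transform_within_open[OF L(1) assms(1) z] assms(3) by metis
  then show "\<exists>L. (g has_derivative L) (at z) \<and> complex_linear L" using L by blast
qed

lemma holo_on_imp_continuous_on: "holo_on f N \<Longrightarrow> continuous_on N f"
  unfolding holo_on_def
  by (meson continuous_at_imp_continuous_on has_derivative_continuous)

lemma holo_on_openI:
  assumes "\<And>z. z \<in> N \<Longrightarrow> \<exists>M. open M \<and> z \<in> M \<and> (\<exists>g. holo_on g M \<and> (\<forall>x\<in>M. f x = g x))"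
  shows "holo_on f N"
  unfolding holo_on_def
proof
  fix z assume "z \<in> N"
  then obtain M g where M: "open M" "z \<in> M" "holo_on g M" "\<forall>x\<in>M. f x = g x"
    using assms by meson
  then have "holo_on f M" using holo_on_cong by metis
  then show "\<exists>L. (f has_derivative L) (at z) \<and> complex_linear L"
    using M(2) unfolding holo_on_def by blast
qed

lemma biholomorphicI:
  assumes "open N" "open M" "holo_on h N" "holo_on k M"
    and "\<And>z. z \<in> N \<Longrightarrow> h z \<in> M \<and> k (h z) = z"
    and "\<And>z. z \<in> M \<Longrightarrow> k z \<in> N \<and> h (k z) = z"
  shows "biholomorphic h N M"
proof -
  have bij: "bij_betw h N M"
    by (rule bij_betwI[where g = k]) (use assms in auto)
  have "the_inv_into N h z = k z" if "z \<in> M" for z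
    using assms(5,6) bij that by (metis bij_betw_def the_inv_into_f_f)
  then have "holo_on (the_inv_into N h) M"
    using holo_on_cong[OF assms(2,4)] by metis
  then show ?thesis
    unfolding biholomorphic_def using assms bij by blast
qed

text \<open>A derivative in this explicit form is complex linear by construction, and the form is
  stable under arithmetic. The introduction rules below thus reduce holomorphy of an explicit
  formula to nonvanishing of its denominators.\<close>

definition cdiff :: "(c2 \<Rightarrow> complex) \<Rightarrow> c2 \<Rightarrow> bool" where
  "cdiff F z \<longleftrightarrow> (\<exists>a b. (F has_derivative (\<lambda>u. a * fst u + b * snd u)) (at z))"

lemma cdiff_const [intro!]: "cdiff (\<lambda>z. c) z"
  unfolding cdiff_def by (rule exI[of _ 0], rule exI[of _ 0]) simp

lemma cdiff_fst [intro!]: "cdiff fst z"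
  unfolding cdiff_def
  by (rule exI[of _ 1], rule exI[of _ 0]) (auto intro!: derivative_eq_intros)

lemma cdiff_snd [intro!]: "cdiff snd z"
  unfolding cdiff_def
  by (rule exI[of _ 0], rule exI[of _ 1]) (auto intro!: derivative_eq_intros)

lemma cdiff_add [intro!]:
  assumes "cdiff F z" "cdiff G z" shows "cdiff (\<lambda>z. F z + G z) z"
proof -
  obtain a b c d where "(F has_derivative (\<lambda>u. a * fst u + b * snd u)) (at z)"
    "(G has_derivative (\<lambda>u. c * fst u + d * snd u)) (at z)"
    using assms unfolding cdiff_def by blast
  then have "((\<lambda>z. F z + G z) has_derivative (\<lambda>u. (a + c) * fst u + (b + d) * snd u)) (at z)"
    by (auto intro!: derivative_eq_intros simp: algebra_simps)
  then show ?thesis unfolding cdiff_def by blast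
qed

lemma cdiff_minus [intro!]:
  assumes "cdiff F z" shows "cdiff (\<lambda>z. - F z) z"
proof -
  obtain a b where "(F has_derivative (\<lambda>u. a * fst u + b * snd u)) (at z)"
    using assms unfolding cdiff_def by blast
  then have "((\<lambda>z. - F z) has_derivative (\<lambda>u. (- a) * fst u + (- b) * snd u)) (at z)"
    by (auto intro!: derivative_eq_intros simp: algebra_simps)
  then show ?thesis unfolding cdiff_def by blast
qed

lemma cdiff_diff [intro!]:
  "cdiff F z \<Longrightarrow> cdiff G z \<Longrightarrow> cdiff (\<lambda>z. F z - G z) z"
  using cdiff_add[OF _ cdiff_minus, of F z G] by simp

lemma cdiff_mult [intro!]:
  assumes "cdiff F z" "cdiff G z" shows "cdiff (\<lambda>z. F z * G z) z"
proof -
  obtain a b c d where "(F has_derivative (\<lambda>u. a * fst u + b * snd u)) (at z)"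
    "(G has_derivative (\<lambda>u. c * fst u + d * snd u)) (at z)"
    using assms unfolding cdiff_def by blast
  then have "((\<lambda>z. F z * G z) has_derivative
      (\<lambda>u. (a * G z + F z * c) * fst u + (b * G z + F z * d) * snd u)) (at z)"
    by (auto intro!: derivative_eq_intros simp: algebra_simps)
  then show ?thesis unfolding cdiff_def by blast
qed

lemma cdiff_inverse:
  assumes "cdiff F z" "F z \<noteq> 0" shows "cdiff (\<lambda>z. inverse (F z)) z"
proof -
  obtain a b where "(F has_derivative (\<lambda>u. a * fst u + b * snd u)) (at z)"
    using assms unfolding cdiff_def by blast
  then have "((\<lambda>z. inverse (F z)) has_derivative
     (\<lambda>u. (- inverse (F z) * a * inverse (F z)) * fst u
        + (- inverse (F z) * b * inverse (F z)) * snd u)) (at z)"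
    using assms(2) by (auto intro!: derivative_eq_intros simp: algebra_simps)
  then show ?thesis unfolding cdiff_def by blast
qed

lemma cdiff_divide [intro!]:
  "cdiff F z \<Longrightarrow> cdiff G z \<Longrightarrow> G z \<noteq> 0 \<Longrightarrow> cdiff (\<lambda>z. F z / G z) z"
  unfolding divide_inverse by (intro cdiff_mult cdiff_inverse)

lemma complex_linear_Pair:
  "complex_linear (\<lambda>u. (a * fst u + b * snd u, c * fst u + d * snd u))"
  unfolding complex_linear_def
  by (auto intro!: linearI simp: algebra_simps scaleR_prod_def)

lemma holo_on_PairI:
  assumes "\<And>z. z \<in> N \<Longrightarrow> cdiff F z" "\<And>z. z \<in> N \<Longrightarrow> cdiff G z"
  shows "holo_on (\<lambda>z. (F z, G z)) N"
  unfolding holo_on_def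
proof
  fix z assume "z \<in> N"
  then obtain a b c d where "(F has_derivative (\<lambda>u. a * fst u + b * snd u)) (at z)"
    "(G has_derivative (\<lambda>u. c * fst u + d * snd u)) (at z)"
    using assms unfolding cdiff_def by blast
  then have "((\<lambda>z. (F z, G z)) has_derivative
      (\<lambda>u. (a * fst u + b * snd u, c * fst u + d * snd u))) (at z)"
    by (rule has_derivative_Pair)
  then show "\<exists>L. ((\<lambda>z. (F z, G z)) has_derivative L) (at z) \<and> complex_linear L"
    using complex_linear_Pair by blast
qed

lemma holo_on_id: "holo_on (\<lambda>z. z) N"
  using holo_on_PairI[of N fst snd] by auto


section \<open>Dense sets, and the gluing relation as a limit condition\<close>

lemma closure_eq_UNIV_iff:
  "closure (G :: 'a::metric_space set) = UNIV \<longleftrightarrow> (\<forall>N. open N \<longrightarrow> N \<noteq> {} \<longrightarrow> N \<inter> G \<noteq> {})"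
proof
  assume "closure G = UNIV"
  then show "\<forall>N. open N \<longrightarrow> N \<noteq> {} \<longrightarrow> N \<inter> G \<noteq> {}"
    using open_Int_closure_eq_empty[of _ G] by auto
next
  assume "\<forall>N. open N \<longrightarrow> N \<noteq> {} \<longrightarrow> N \<inter> G \<noteq> {}"
  moreover have "open (- closure G)" "- closure G \<inter> G = {}" using closure_subset[of G] by auto
  ultimately have "- closure G = {}" by metis
  then show "closure G = UNIV" by blast
qed

text \<open>The exceptional sets below consist of finitely many vertical lines and of finitely many
  points on each other vertical line. An open box is infinite in both directions, so a point outside
  is found by choosing \<open>x'\<close> before \<open>y'\<close>.\<close>

lemma dense_fibrewise:
  assumes "finite F" "\<And>x. finite (D x)"
  shows "closure {z :: c2. fst z \<notin> F \<and> snd z \<notin> D (fst z)} = UNIV"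
  unfolding closure_eq_UNIV_iff
proof (intro allI impI)
  fix N :: "c2 set" assume N: "open N" "N \<noteq> {}"
  then obtain x y where "(x, y) \<in> N" by auto
  then obtain A B where AB: "open A" "open B" "x \<in> A" "y \<in> B" "A \<times> B \<subseteq> N"
    using N(1) open_prod_elim[of N "(x, y)"] by (metis mem_Sigma_iff)
  have inf: "infinite A" "infinite B"
    using AB finite_imp_not_open by auto
  obtain x' where "x' \<in> A" "x' \<notin> F"
    using inf(1) assms(1) by (meson finite_subset subsetI)
  moreover obtain y' where "y' \<in> B" "y' \<notin> D x'"
    using inf(2) assms(2) by (meson finite_subset subsetI)
  ultimately show "N \<inter> {z. fst z \<notin> F \<and> snd z \<notin> D (fst z)} \<noteq> {}"
    using AB(5) by (auto intro!: exI[of _ "(x', y')"] simp: disjoint_iff)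
qed

text \<open>For \<open>unblow_map\<close> the exceptional set is controlled on horizontal instead of
  vertical lines; swapping the coordinates reduces this case to
  \<open>dense_fibrewise\<close>.\<close>

lemma dense_fibrewise':
  assumes "finite F" "\<And>x. finite (D x)"
  shows "closure {z :: c2. snd z \<notin> F \<and> fst z \<notin> D (snd z)} = UNIV"
  unfolding closure_eq_UNIV_iff
proof (intro allI impI)
  fix N :: "c2 set" assume N: "open N" "N \<noteq> {}"
  obtain z where "z \<in> N" using N(2) by blast
  then have "prod.swap z \<in> prod.swap -` N" by simp
  then have ne: "prod.swap -` N \<noteq> {}" by (rule ex_in_conv[THEN iffD1, OF exI])
  have o: "open (prod.swap -` N)" using N(1) by (intro open_vimage continuous_on_swap)
  have "prod.swap -` N \<inter> {z. fst z \<notin> F \<and> snd z \<notin> D (fst z)} \<noteq> {}"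
    using iffD1[OF closure_eq_UNIV_iff dense_fibrewise[OF assms], rule_format, OF o ne] .
  then obtain p where "p \<in> prod.swap -` N" "fst p \<notin> F" "snd p \<notin> D (fst p)" by blast
  then have "prod.swap p \<in> N \<inter> {z. snd z \<notin> F \<and> fst z \<notin> D (snd z)}" by simp
  then show "N \<inter> {z. snd z \<notin> F \<and> fst z \<notin> D (snd z)} \<noteq> {}" by blast
qed

text \<open>The identity \<open>f j z = h (f i z)\<close> is known on the dense set \<open>G\<close>
  only. By continuity of \<open>h\<close> the points near \<open>a\<close> with image near
  \<open>b\<close> form an open set; its preimage in \<open>D\<close> is open and, by density of the
  image of \<open>f i\<close>, nonempty, so it meets \<open>G\<close>. The resulting limit of
  coordinate pairs is the form in which the gluing relation enters the separation argument.\<close>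

lemma glue_rel_imp_closure:
  assumes "glue_rel f i a j b" "open D" "continuous_on D (f i)" "closure (f i ` D) = UNIV"
  shows "(a, b) \<in> closure ((\<lambda>z. (f i z, f j z)) ` D)"
  unfolding closure_approachable
proof (intro allI impI)
  fix e :: real assume "e > 0"
  obtain N M h G where h: "a \<in> N" "b \<in> M" "biholomorphic h N M" "h a = b" "open G"
    "closure G = UNIV" "\<forall>z\<in>G. f i z \<in> N \<longrightarrow> f j z = h (f i z)"
    using assms(1) unfolding glue_rel_def by blast
  have N: "open N" "continuous_on N h"
    using h(3) holo_on_imp_continuous_on unfolding biholomorphic_def by auto
  define N' where "N' = ball a (e/2) \<inter> (N \<inter> h -` ball b (e/2))"
  have "open N'"
    unfolding N'_def using continuous_open_preimage[OF N(2,1)] by blast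
  moreover have "a \<in> N'" using h \<open>e > 0\<close> by (auto simp: N'_def)
  ultimately have "N' \<inter> f i ` D \<noteq> {}"
    using assms(4) unfolding closure_eq_UNIV_iff by blast
  then have "D \<inter> f i -` N' \<noteq> {}" by auto
  moreover have "open (D \<inter> f i -` N')"
    using continuous_open_preimage[OF assms(3,2) \<open>open N'\<close>] .
  ultimately obtain z where z: "z \<in> G" "z \<in> D" "f i z \<in> N'"
    using h(6) unfolding closure_eq_UNIV_iff by blast
  have "f j z = h (f i z)" using h(7) z by (auto simp: N'_def)
  then have "dist (f i z) a < e/2" "dist (f j z) b < e/2"
    using z(3) by (auto simp: N'_def dist_commute)
  then have "dist (f i z, f j z) (a, b) < e"
    using sqrt_sum_squares_le_sum_abs[of "dist (f i z) a" "dist (f j z) b"]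
    by (simp add: dist_prod_def)
  then show "\<exists>y\<in>(\<lambda>z. (f i z, f j z)) ` D. dist y (a, b) < e" using z(2) by blast
qed

lemma closure_image_eq_zero:
  fixes F :: "'a::topological_space \<Rightarrow> 'b::real_normed_vector"
  assumes "z \<in> closure S" "continuous_on UNIV F" "\<And>x. x \<in> S \<Longrightarrow> F x = 0"
  shows "F z = 0"
proof -
  have "closed {x. F x = 0}"
    using assms(2) by (intro closed_Collect_eq continuous_intros)
  then have "closure S \<subseteq> {x. F x = 0}" using assms(3) by (intro closure_minimal) auto
  then show ?thesis using assms(1) by blast
qed

section \<open>Germs of transition maps\<close>

text \<open>Stated through common points instead of \<open>the_inv_into\<close>, so that germs can
  be composed and lifted to a blow-up. Every \<open>a\<close> in \<open>N\<close> must come from a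
  point of the overlap, so openness of the chart image near \<open>x\<close> is included;
  \<open>germ A A x\<close> expresses just that.\<close>

definition germ :: "'a chart \<Rightarrow> 'a chart \<Rightarrow> 'a \<Rightarrow> bool" where
  "germ A B x \<longleftrightarrow> (\<exists>N g. open N \<and> snd A x \<in> N \<and> holo_on g N \<and>
     (\<forall>a\<in>N. \<exists>y\<in>fst A \<inter> fst B. snd A y = a \<and> snd B y = g a))"

lemma germI:
  assumes "open N" "snd A x \<in> N" "holo_on g N"
    and "\<And>a. a \<in> N \<Longrightarrow> \<exists>y\<in>fst A \<inter> fst B. snd A y = a \<and> snd B y = g a"
  shows "germ A B x"
  using assms unfolding germ_def by blast

lemma germ_trans:
  assumes "germ A B x" "germ B C x" "x \<in> fst A" "x \<in> fst B"
    and "inj_on (snd A) (fst A)" "inj_on (snd B) (fst B)"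
  shows "germ A C x"
proof -
  obtain N g where N: "open N" "snd A x \<in> N" "holo_on g N"
    "\<And>a. a \<in> N \<Longrightarrow> \<exists>y\<in>fst A \<inter> fst B. snd A y = a \<and> snd B y = g a"
    using assms(1) unfolding germ_def by blast
  obtain M h where M: "open M" "snd B x \<in> M" "holo_on h M"
    "\<And>a. a \<in> M \<Longrightarrow> \<exists>y\<in>fst B \<inter> fst C. snd B y = a \<and> snd C y = h a"
    using assms(2) unfolding germ_def by blast
  have gx: "g (snd A x) = snd B x"
  proof -
    obtain y where y: "y \<in> fst A \<inter> fst B" "snd A y = snd A x" "snd B y = g (snd A x)"
      using N(4)[OF N(2)] by blast
    then have "y = x" using inj_onD[OF assms(5), of y x] assms(3) by simp
    then show ?thesis using y by simp
  qed
  show ?thesis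
  proof (rule germI)
    show "open (N \<inter> g -` M)"
      using continuous_open_preimage[OF holo_on_imp_continuous_on[OF N(3)] N(1) M(1)] .
    show "snd A x \<in> N \<inter> g -` M" using N(2) M(2) gx by simp
    show "holo_on (h \<circ> g) (N \<inter> g -` M)"
      by (rule holo_on_compose[OF holo_on_subset[OF N(3)] M(3)]) auto
    fix a assume "a \<in> N \<inter> g -` M"
    then have a: "a \<in> N" "g a \<in> M" by auto
    obtain y where y: "y \<in> fst A \<inter> fst B" "snd A y = a" "snd B y = g a"
      using N(4)[OF a(1)] by blast
    obtain z where z: "z \<in> fst B \<inter> fst C" "snd B z = g a" "snd C z = h (g a)"
      using M(4)[OF a(2)] by blast
    have "y = z" using inj_onD[OF assms(6), of y z] y z by simp
    then show "\<exists>y\<in>fst A \<inter> fst C. snd A y = a \<and> snd C y = (h \<circ> g) a"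
      using y z by auto
  qed
qed

text \<open>Injectivity of the chart forces all local germs to agree with the one transition map, so
  openness and holomorphy can be checked point by point.\<close>

lemma germs_imp_transition:
  assumes inj: "inj_on \<phi> U" and g: "\<And>x. x \<in> U \<inter> V \<Longrightarrow> germ (U, \<phi>) (V, \<psi>) x"
  shows "open (\<phi> ` (U \<inter> V))" "holo_on (\<psi> \<circ> the_inv_into U \<phi>) (\<phi> ` (U \<inter> V))"
proof -
  have *: "\<exists>N h. open N \<and> \<phi> x \<in> N \<and> N \<subseteq> \<phi> ` (U \<inter> V) \<and> holo_on h N \<and>
      (\<forall>a\<in>N. (\<psi> \<circ> the_inv_into U \<phi>) a = h a)" if x: "x \<in> U \<inter> V" for x
  proof -
    obtain N h where N: "open N" "\<phi> x \<in> N" "holo_on h N"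
      "\<And>a. a \<in> N \<Longrightarrow> \<exists>y\<in>U \<inter> V. \<phi> y = a \<and> \<psi> y = h a"
      using g[OF x] unfolding germ_def by auto
    have "(\<psi> \<circ> the_inv_into U \<phi>) a = h a" if a: "a \<in> N" for a
    proof -
      obtain y where "y \<in> U" "\<phi> y = a" "\<psi> y = h a" using N(4)[OF a] by blast
      then show ?thesis using the_inv_into_f_f[OF inj, of y] by simp
    qed
    moreover have "N \<subseteq> \<phi> ` (U \<inter> V)" using N(4) by blast
    ultimately show ?thesis using N by blast
  qed
  show "open (\<phi> ` (U \<inter> V))"
  proof (subst open_subopen, intro ballI)
    fix z assume "z \<in> \<phi> ` (U \<inter> V)"
    then obtain x where "x \<in> U \<inter> V" "z = \<phi> x" by blast
    then show "\<exists>T. open T \<and> z \<in> T \<and> T \<subseteq> \<phi> ` (U \<inter> V)" using *[of x] by metis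
  qed
  show "holo_on (\<psi> \<circ> the_inv_into U \<phi>) (\<phi> ` (U \<inter> V))"
  proof (rule holo_on_openI)
    fix z assume "z \<in> \<phi> ` (U \<inter> V)"
    then obtain x where "x \<in> U \<inter> V" "z = \<phi> x" by blast
    then show "\<exists>M. open M \<and> z \<in> M \<and> (\<exists>g. holo_on g M \<and> (\<forall>x\<in>M. (\<psi> \<circ> the_inv_into U \<phi>) x = g x))"
      using *[of x] by metis
  qed
qed

lemma transition_imp_germ:
  assumes "inj_on \<phi> U" "open (\<phi> ` (U \<inter> V))"
    "holo_on (\<psi> \<circ> the_inv_into U \<phi>) (\<phi> ` (U \<inter> V))" "x \<in> U \<inter> V"
  shows "germ (U, \<phi>) (V, \<psi>) x"
proof (rule germI[where N = "\<phi> ` (U \<inter> V)" and g = "\<psi> \<circ> the_inv_into U \<phi>"])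
  fix a assume "a \<in> \<phi> ` (U \<inter> V)"
  then obtain y where "y \<in> U \<inter> V" "a = \<phi> y" by blast
  then show "\<exists>y\<in>fst (U, \<phi>) \<inter> fst (V, \<psi>). snd (U, \<phi>) y = a \<and>
      snd (V, \<psi>) y = (\<psi> \<circ> the_inv_into U \<phi>) a"
    using assms(1) by (auto simp: the_inv_into_f_f intro!: bexI[of _ y])
qed (use assms in auto)

lemma compatible_chartI:
  assumes "V \<subseteq> points X" "inj_on \<psi> V" "open (\<psi> ` V)"
    and "\<And>A. A \<in> atlas X \<Longrightarrow> inj_on (snd A) (fst A)"
    and "\<And>A x. A \<in> atlas X \<Longrightarrow> x \<in> fst A \<inter> V \<Longrightarrow> germ A (V, \<psi>) x \<and> germ (V, \<psi>) A x"
  shows "compatible_chart X (V, \<psi>)"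
proof -
  have *: "open (\<phi> ` (U \<inter> V))" "holo_on (\<psi> \<circ> the_inv_into U \<phi>) (\<phi> ` (U \<inter> V))"
      "open (\<psi> ` (U \<inter> V))" "holo_on (\<phi> \<circ> the_inv_into V \<psi>) (\<psi> ` (U \<inter> V))"
    if A: "(U, \<phi>) \<in> atlas X" for U \<phi>
  proof -
    have inj: "inj_on \<phi> U" using assms(4)[OF A] by simp
    have g: "germ (U, \<phi>) (V, \<psi>) x" if "x \<in> U \<inter> V" for x
      using assms(5)[OF A] that by simp
    have g': "germ (V, \<psi>) (U, \<phi>) x" if "x \<in> V \<inter> U" for x
      using assms(5)[OF A, of x] that by simp
    show "open (\<phi> ` (U \<inter> V))" "holo_on (\<psi> \<circ> the_inv_into U \<phi>) (\<phi> ` (U \<inter> V))"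
      using germs_imp_transition[OF inj g] by blast+
    show "open (\<psi> ` (U \<inter> V))" "holo_on (\<phi> \<circ> the_inv_into V \<psi>) (\<psi> ` (U \<inter> V))"
      using germs_imp_transition[OF assms(2) g'] by (metis Int_commute)+
  qed
  then show ?thesis
    using assms(1-3) unfolding compatible_chart_def holo_map_def by auto
qed

lemma compatible_chartD:
  assumes "compatible_chart X (V, \<psi>)" "A \<in> atlas X" "inj_on (snd A) (fst A)" "x \<in> fst A \<inter> V"
  shows "germ A (V, \<psi>) x" "germ (V, \<psi>) A x"
proof -
  obtain U \<phi> where A: "A = (U, \<phi>)" by force
  have *: "inj_on \<psi> V" "open (\<phi> ` (U \<inter> V))" "holo_on (\<psi> \<circ> the_inv_into U \<phi>) (\<phi> ` (U \<inter> V))"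
    "open (\<psi> ` (U \<inter> V))" "holo_on (\<phi> \<circ> the_inv_into V \<psi>) (\<psi> ` (U \<inter> V))"
    using assms(1,2) unfolding A compatible_chart_def holo_map_def by auto
  show "germ A (V, \<psi>) x"
    unfolding A by (rule transition_imp_germ) (use * assms A in auto)
  show "germ (V, \<psi>) A x"
    unfolding A by (rule transition_imp_germ) (use * assms A in \<open>auto simp: Int_commute\<close>)
qed

text \<open>With \<open>B = A\<close> the germ condition says that chart images are open. Hausdorff
  separation is not part of this notion; it enters through the assumption \<open>sep\<close>
  below.\<close>

definition complex_surface :: "'a surface \<Rightarrow> bool" where
  "complex_surface X \<longleftrightarrow> (\<forall>A\<in>atlas X. fst A \<subseteq> points X \<and> inj_on (snd A) (fst A) \<and>
     (\<forall>B\<in>atlas X. \<forall>x\<in>fst A \<inter> fst B. germ A B x))"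


section \<open>Surfaces glued from planes\<close>

text \<open>\<open>pt i\<close> is the inverse of a chart onto the \<open>i\<close>-th plane; \<open>sep\<close> is the Hausdorff property.\<close>
locale plane_model =
  fixes J :: "'i set" and f :: "'i \<Rightarrow> c2 \<Rightarrow> c2" and D :: "c2 set" and e :: "c2 \<Rightarrow> 'z"
    and pt :: "'i \<Rightarrow> c2 \<Rightarrow> 'z"
  assumes D: "open D" "closure D = UNIV"
    and inj: "i \<in> J \<Longrightarrow> inj (pt i)"
    and rep: "i \<in> J \<Longrightarrow> z \<in> D \<Longrightarrow> pt i (f i z) = e z"
    and cont: "i \<in> J \<Longrightarrow> continuous_on D (f i)"
    and dense: "i \<in> J \<Longrightarrow> closure (f i ` D) = UNIV"
    and trans: "\<And>i j a b. i \<in> J \<Longrightarrow> j \<in> J \<Longrightarrow> pt i a = pt j b \<Longrightarrow>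
        \<exists>N h. open N \<and> a \<in> N \<and> holo_on h N \<and> (\<forall>c\<in>N. pt j (h c) = pt i c)"
    and sep: "\<And>i j a b. i \<in> J \<Longrightarrow> j \<in> J \<Longrightarrow> (a, b) \<in> closure ((\<lambda>z. (f i z, f j z)) ` D) \<Longrightarrow>
        pt i a = pt j b"
begin

text \<open>One direction is the separation of limit points. For the other, local transitions
  \<open>h\<close> and \<open>k\<close> are taken in opposite directions. Injectivity of the maps
  \<open>pt\<close> makes them inverse to each other, which gives a biholomorphic germ without any
  inverse function theorem.\<close>

lemma glue_rel_iff:
  assumes i: "i \<in> J" and j: "j \<in> J"
  shows "glue_rel f i a j b \<longleftrightarrow> pt i a = pt j b"
proof
  assume g: "glue_rel f i a j b"
  show "pt i a = pt j b"
    by (rule sep[OF i j glue_rel_imp_closure[OF g D(1) cont[OF i] dense[OF i]]])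
next
  assume eq: "pt i a = pt j b"
  obtain N h where N: "open N" "a \<in> N" "holo_on h N" "\<And>c. c \<in> N \<Longrightarrow> pt j (h c) = pt i c"
    using trans[OF i j eq] by blast
  obtain M k where M: "open M" "b \<in> M" "holo_on k M" "\<And>c. c \<in> M \<Longrightarrow> pt i (k c) = pt j c"
    using trans[OF j i eq[symmetric]] by blast
  have inv: "k (h c) = c" if "c \<in> N" "h c \<in> M" for c
    using N(4)[OF that(1)] M(4)[OF that(2)] inj[OF i] by (simp add: inj_eq)
  have inv': "h (k c) = c" if "c \<in> M" "k c \<in> N" for c
    using M(4)[OF that(1)] N(4)[OF that(2)] inj[OF j] by (simp add: inj_eq)
  have ha: "h a = b" using N(4)[OF N(2)] eq inj[OF j] by (simp add: inj_eq)
  have kb: "k b = a" using M(4)[OF M(2)] eq inj[OF i] by (metis inj_eq)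
  \<comment> \<open>After this shrinking \<open>h\<close> maps \<open>N'\<close> into
    \<open>M'\<close>, because \<open>k (h c) = c\<close> lies in \<open>N\<close>.\<close>
  define N' where "N' = N \<inter> h -` M"
  define M' where "M' = M \<inter> k -` N"
  have "biholomorphic h N' M'"
  proof (rule biholomorphicI[where k = k])
    show "open N'" unfolding N'_def
      by (intro continuous_open_preimage holo_on_imp_continuous_on N M)
    show "open M'" unfolding M'_def
      by (intro continuous_open_preimage holo_on_imp_continuous_on N M)
    show "holo_on h N'" "holo_on k M'"
      unfolding N'_def M'_def using N(3) M(3) by (auto intro: holo_on_subset)
  qed (use inv inv' in \<open>auto simp: N'_def M'_def\<close>)
  moreover have "f j z = h (f i z)" if "z \<in> D" "f i z \<in> N'" for z
  proof -
    have "pt j (h (f i z)) = pt j (f j z)"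
      using N(4)[of "f i z"] rep[OF i that(1)] rep[OF j that(1)] that(2) by (simp add: N'_def)
    then show ?thesis using inj[OF j] by (simp add: inj_eq)
  qed
  moreover have "a \<in> N'" "b \<in> M'" using N M ha kb by (auto simp: N'_def M'_def)
  ultimately show "glue_rel f i a j b"
    unfolding glue_rel_def using ha D by blast
qed

text \<open>Being the kernel of the maps \<open>pt\<close>, the gluing relation is an equivalence
  relation on the planes in \<open>J\<close>; its definition does not show transitivity.\<close>

lemma glue_point_eq_iff:
  assumes "i \<in> J" "j \<in> J"
  shows "glue_point J f i a = glue_point J f j b \<longleftrightarrow> pt i a = pt j b"
proof
  assume *: "glue_point J f i a = glue_point J f j b"
  have "(i, a) \<in> glue_point J f i a"
    using assms by (simp add: glue_point_def glue_rel_iff)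
  then show "pt i a = pt j b"
    unfolding * using assms by (simp add: glue_point_def glue_rel_iff)
qed (use assms in \<open>auto simp: glue_point_def glue_rel_iff\<close>)

lemma glue_chart_point:
  assumes "i \<in> J"
  shows "snd (glue_chart J f i) (glue_point J f i a) = a"
  using assms inj[OF assms] by (auto simp: glue_chart_def glue_point_def glue_rel_iff inj_eq)

lemma complex_surface_glue: "complex_surface (glue J f)"
proof -
  have "inj_on (snd (glue_chart J f i)) (fst (glue_chart J f i))" if "i \<in> J" for i
    using glue_chart_point[OF that] by (intro inj_onI) (auto simp: glue_chart_def)
  moreover have "germ (glue_chart J f i) (glue_chart J f j) x"
    if ij: "i \<in> J" "j \<in> J" and x: "x \<in> fst (glue_chart J f i) \<inter> fst (glue_chart J f j)" for i j x
  proof -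
    have "x \<in> range (glue_point J f i)" "x \<in> range (glue_point J f j)"
      using x by (simp_all add: glue_chart_def)
    then obtain a b where ab: "x = glue_point J f i a" "x = glue_point J f j b" by blast
    then have "pt i a = pt j b" using glue_point_eq_iff[OF ij] by metis
    then obtain N h where N: "open N" "a \<in> N" "holo_on h N" "\<forall>c\<in>N. pt j (h c) = pt i c"
      using trans[OF ij] by blast
    show ?thesis
    proof (rule germI[where N = N and g = h])
      show "snd (glue_chart J f i) x \<in> N" using N(2) ab(1) glue_chart_point[OF ij(1)] by simp
      fix c assume "c \<in> N"
      then have *: "glue_point J f i c = glue_point J f j (h c)"
        using N(4) glue_point_eq_iff[OF ij] by metis
      then have "glue_point J f i c \<in> fst (glue_chart J f i) \<inter> fst (glue_chart J f j)"
        by (auto simp: glue_chart_def)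
      moreover have "snd (glue_chart J f i) (glue_point J f i c) = c"
        using glue_chart_point[OF ij(1)] .
      moreover have "snd (glue_chart J f j) (glue_point J f i c) = h c"
        unfolding * using glue_chart_point[OF ij(2)] .
      ultimately show "\<exists>y\<in>fst (glue_chart J f i) \<inter> fst (glue_chart J f j).
          snd (glue_chart J f i) y = c \<and> snd (glue_chart J f j) y = h c" by blast
    qed (use N in auto)
  qed
  ultimately show ?thesis
    unfolding complex_surface_def glue_def by (auto simp: glue_chart_def)
qed

end


section \<open>Blow-ups\<close>

definition off_chart :: "'a set \<Rightarrow> 'a chart \<Rightarrow> 'a blown chart" where
  "off_chart P k = (Off ` (fst k - P), snd k \<circ> blow_proj)"

lemma blow_up_atlas:
  "atlas (blow_up X B) = off_chart (fst ` B) ` atlas X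
     \<union> (\<lambda>(c, k). blow_chart1 (fst ` B) c k) ` B \<union> (\<lambda>(c, k). blow_chart2 (fst ` B) c k) ` B"
proof -
  have 1: "{(Off ` (U - P), \<phi> \<circ> blow_proj) | U \<phi>. (U, \<phi>) \<in> A} = off_chart P ` A" for P A
    unfolding off_chart_def image_def by (simp only: Bex_def split_paired_Ex fst_conv snd_conv) blast
  have 2: "{h c k | c k. (c, k) \<in> B} = (\<lambda>(c, k). h c k) ` B" for h :: "'a \<Rightarrow> 'a chart \<Rightarrow> 'a blown chart"
    unfolding image_def by (simp only: Bex_def split_paired_Ex prod.case) blast
  show ?thesis unfolding blow_up_def 1 2 by simp
qed

lemma inj_on_off_chart: "inj_on (snd k) (fst k) \<Longrightarrow> inj_on (snd (off_chart P k)) (fst (off_chart P k))"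
  unfolding off_chart_def by (auto intro!: inj_onI dest: inj_onD)

lemma fst_blow_chart1:
  "fst (blow_chart1 P c k) =
     Off ` {x \<in> fst k - P. snd (snd k x - snd k c) \<noteq> 0} \<union> {Exc c (Some s) | s. True}"
  by (cases k) (simp add: blow_chart1_def)

lemma fst_blow_chart2:
  "fst (blow_chart2 P c k) =
     Off ` {x \<in> fst k - P. fst (snd k x - snd k c) \<noteq> 0} \<union> {Exc c s | s. s \<noteq> Some 0}"
  by (cases k) (simp add: blow_chart2_def)

lemma Off_in_blow_chart1 [simp]:
  "Off x \<in> fst (blow_chart1 P c k) \<longleftrightarrow> x \<in> fst k \<and> x \<notin> P \<and> snd (snd k x - snd k c) \<noteq> 0"
  unfolding fst_blow_chart1 by blast

lemma Exc_in_blow_chart1 [simp]: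
  "Exc d s \<in> fst (blow_chart1 P c k) \<longleftrightarrow> d = c \<and> s \<noteq> None"
  unfolding fst_blow_chart1 by blast

lemma Off_in_blow_chart2 [simp]:
  "Off x \<in> fst (blow_chart2 P c k) \<longleftrightarrow> x \<in> fst k \<and> x \<notin> P \<and> fst (snd k x - snd k c) \<noteq> 0"
  unfolding fst_blow_chart2 by blast

lemma Exc_in_blow_chart2 [simp]:
  "Exc d s \<in> fst (blow_chart2 P c k) \<longleftrightarrow> d = c \<and> s \<noteq> Some 0"
  unfolding fst_blow_chart2 by blast

lemma in_off_chart [simp]:
  "Off x \<in> fst (off_chart P k) \<longleftrightarrow> x \<in> fst k \<and> x \<notin> P"
  "Exc d s \<notin> fst (off_chart P k)"
  unfolding off_chart_def by auto

lemma snd_off_chart [simp]: "snd (off_chart P k) (Off x) = snd k x"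
  unfolding off_chart_def by simp

lemma snd_blow_chart1 [simp]:
  "snd (blow_chart1 P c k) (Off x) =
     (fst (snd k x - snd k c) / snd (snd k x - snd k c), snd (snd k x - snd k c))"
  "snd (blow_chart1 P c k) (Exc d (Some s)) = (s, 0)"
  by (cases k, simp add: blow_chart1_def)+

lemma snd_blow_chart2 [simp]:
  "snd (blow_chart2 P c k) (Off x) =
     (fst (snd k x - snd k c), snd (snd k x - snd k c) / fst (snd k x - snd k c))"
  "snd (blow_chart2 P c k) (Exc d None) = (0, 0)"
  "snd (blow_chart2 P c k) (Exc d (Some s)) = (0, 1 / s)"
  by (cases k, simp add: blow_chart2_def)+

lemma inj_on_blow_chart1:
  assumes "inj_on (snd k) (fst k)"
  shows "inj_on (snd (blow_chart1 P c k)) (fst (blow_chart1 P c k))"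
proof (rule inj_onI)
  fix x y assume *: "x \<in> fst (blow_chart1 P c k)" "y \<in> fst (blow_chart1 P c k)"
    "snd (blow_chart1 P c k) x = snd (blow_chart1 P c k) y"
  show "x = y"
  proof (cases x; cases y)
    fix u v assume [simp]: "x = Off u" "y = Off v"
    have "snd k u = snd k v" using * by (auto simp: prod_eq_iff)
    then have "u = v" using * assms by (simp add: inj_on_def)
    then show ?thesis by simp
  qed (use * in auto)
qed

lemma inj_on_blow_chart2:
  assumes "inj_on (snd k) (fst k)"
  shows "inj_on (snd (blow_chart2 P c k)) (fst (blow_chart2 P c k))"
proof (rule inj_onI)
  fix x y assume *: "x \<in> fst (blow_chart2 P c k)" "y \<in> fst (blow_chart2 P c k)"
    "snd (blow_chart2 P c k) x = snd (blow_chart2 P c k) y"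
  \<comment> \<open>In this chart exceptional points have first coordinate 0 and all other points do
    not.\<close>
  have exc: "fst (snd (blow_chart2 P c k) (Exc d s)) = 0" for d s
    by (cases s) simp_all
  show "x = y"
  proof (cases x; cases y)
    fix u v assume [simp]: "x = Off u" "y = Off v"
    have "snd k u = snd k v" using * by (auto simp: prod_eq_iff)
    then have "u = v" using * assms by (simp add: inj_on_def)
    then show ?thesis by simp
  next
    fix d s d' s' assume [simp]: "x = Exc d s" "y = Exc d' s'"
    show ?thesis using * by (cases s; cases s') auto
  next
    fix u d s assume [simp]: "x = Off u" "y = Exc d s"
    show ?thesis using * exc[of d s] by (metis Off_in_blow_chart2 fst_conv snd_blow_chart2(1) \<open>x = Off u\<close> \<open>y = Exc d s\<close>)
  next
    fix u d s assume [simp]: "y = Off u" "x = Exc d s"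
    show ?thesis using * exc[of d s] by (metis Off_in_blow_chart2 fst_conv snd_blow_chart2(1) \<open>y = Off u\<close> \<open>x = Exc d s\<close>)
  qed
qed

lemma complex_surfaceD:
  assumes "complex_surface X" "A \<in> atlas X"
  shows "fst A \<subseteq> points X" "inj_on (snd A) (fst A)"
    "B \<in> atlas X \<Longrightarrow> x \<in> fst A \<Longrightarrow> x \<in> fst B \<Longrightarrow> germ A B x"
  using assms unfolding complex_surface_def by auto

lemma germ_off_chart:
  assumes "germ k k' x" "x \<in> fst k" "x \<notin> P" "inj_on (snd k) (fst k)" "finite P"
  shows "germ (off_chart P k) (off_chart P k') (Off x)"
proof -
  obtain N g where N: "open N" "snd k x \<in> N" "holo_on g N"
    "\<And>a. a \<in> N \<Longrightarrow> \<exists>y\<in>fst k \<inter> fst k'. snd k y = a \<and> snd k' y = g a"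
    using assms(1) unfolding germ_def by blast
  \<comment> \<open>The finitely many centres are cut out of the coordinate neighbourhood;
    \<open>x\<close> survives because the chart is injective.\<close>
  let ?N = "N - snd k ` (P \<inter> fst k)"
  show ?thesis
  proof (rule germI)
    show "open ?N" using N(1) assms(5) by (intro open_Diff finite_imp_closed) auto
    have "snd k x \<noteq> snd k y" if "y \<in> P \<inter> fst k" for y
      using inj_onD[OF assms(4), of x y] assms(2,3) that by blast
    then show "snd (off_chart P k) (Off x) \<in> ?N" using N(2) by auto
    show "holo_on g ?N" using N(3) by (rule holo_on_subset) blast
    fix a assume a: "a \<in> ?N"
    then obtain y where y: "y \<in> fst k \<inter> fst k'" "snd k y = a" "snd k' y = g a"
      using N(4)[of a] by blast
    have "y \<notin> P" using y a by blast
    then show "\<exists>y\<in>fst (off_chart P k) \<inter> fst (off_chart P k').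
        snd (off_chart P k) y = a \<and> snd (off_chart P k') y = g a"
      using y by (intro bexI[of _ "Off y"]) simp_all
  qed
qed

text \<open>By \<open>germ k k x\<close> the image of \<open>k\<close> contains a neighbourhood of
  \<open>snd k x\<close>, and near a point outside \<open>P\<close> it can be kept free of the
  centres.\<close>

lemma off_chart_nhd:
  assumes "germ k k x" "x \<in> fst k" "x \<notin> P" "inj_on (snd k) (fst k)" "finite P"
  obtains N where "open N" "snd k x \<in> N" "N \<subseteq> snd k ` (fst k - P)"
proof -
  obtain N g where N: "open N" "snd (off_chart P k) (Off x) \<in> N"
    and *: "\<forall>a\<in>N. \<exists>y\<in>fst (off_chart P k) \<inter> fst (off_chart P k).
      snd (off_chart P k) y = a \<and> snd (off_chart P k) y = g a"
    using germ_off_chart[OF assms] unfolding germ_def by blast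
  have "a \<in> snd k ` (fst k - P)" if a: "a \<in> N" for a
  proof -
    obtain y where y: "y \<in> fst (off_chart P k)" "snd (off_chart P k) y = a" using * a by blast
    then show ?thesis by (cases y) auto
  qed
  then have "N \<subseteq> snd k ` (fst k - P)" by blast
  moreover have "snd k x \<in> N" using N(2) by simp
  ultimately show ?thesis using that N(1) by blast
qed

lemma image_DiffD: "N \<subseteq> g ` (U - P) \<Longrightarrow> a \<in> N \<Longrightarrow> \<exists>y\<in>U. y \<notin> P \<and> g y = a"
  by blast

lemma germ_off_chart_blow_chart1:
  assumes "open N" "snd k x \<in> N" "N \<subseteq> snd k ` (fst k - P)" "Off x \<in> fst (blow_chart1 P c k)"
  shows "germ (off_chart P k) (blow_chart1 P c k) (Off x)"
    and "germ (blow_chart1 P c k) (off_chart P k) (Off x)"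
proof -
  let ?c = "snd k c"
  let ?N = "N \<inter> {a. snd a - snd ?c \<noteq> 0}"
  show "germ (off_chart P k) (blow_chart1 P c k) (Off x)"
  proof (rule germI)
    show "open ?N" using assms(1) by (intro open_Int open_Collect_neq continuous_intros)
    show "snd (off_chart P k) (Off x) \<in> ?N" using assms by simp
    show "holo_on (\<lambda>a. ((fst a - fst ?c) / (snd a - snd ?c), snd a - snd ?c)) ?N"
      by (intro holo_on_PairI) auto
    fix a assume a: "a \<in> ?N"
    then obtain y where "y \<in> fst k" "y \<notin> P" "snd k y = a" using assms(3) by blast
    then show "\<exists>y\<in>fst (off_chart P k) \<inter> fst (blow_chart1 P c k). snd (off_chart P k) y = a \<and>
        snd (blow_chart1 P c k) y = ((fst a - fst ?c) / (snd a - snd ?c), snd a - snd ?c)"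
      using a by (intro bexI[of _ "Off y"]) simp_all
  qed
  \<comment> \<open>The blow-down in this chart: \<open>(u, v)\<close> goes to
    \<open>(u v, v)\<close>, shifted to the centre. It inverts the chart map away from the
    exceptional curve.\<close>
  let ?h = "\<lambda>b. (fst b * snd b + fst ?c, snd b + snd ?c)"
  have h: "holo_on ?h UNIV" by (intro holo_on_PairI) auto
  let ?M = "?h -` N \<inter> {b. snd b \<noteq> 0}"
  show "germ (blow_chart1 P c k) (off_chart P k) (Off x)"
  proof (rule germI)
    show "open ?M"
      using assms(1) holo_on_imp_continuous_on[OF h]
      by (intro open_Int open_vimage open_Collect_neq continuous_intros)
    show "snd (blow_chart1 P c k) (Off x) \<in> ?M" using assms by simp
    show "holo_on ?h ?M" using h by (rule holo_on_subset) blast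
    fix b assume b: "b \<in> ?M"
    then have "?h b \<in> N" by simp
    then have "\<exists>y\<in>fst k. y \<notin> P \<and> snd k y = ?h b" by (rule image_DiffD[OF assms(3)])
    then obtain y where y: "y \<in> fst k" "y \<notin> P" "snd k y = ?h b" by blast
    have "snd b \<noteq> 0" using b by simp
    then show "\<exists>y\<in>fst (blow_chart1 P c k) \<inter> fst (off_chart P k).
        snd (blow_chart1 P c k) y = b \<and> snd (off_chart P k) y = ?h b"
      using y by (intro bexI[of _ "Off y"]) (simp_all add: prod_eq_iff)
  qed
qed

lemma germ_off_chart_blow_chart2:
  assumes "open N" "snd k x \<in> N" "N \<subseteq> snd k ` (fst k - P)" "Off x \<in> fst (blow_chart2 P c k)"
  shows "germ (off_chart P k) (blow_chart2 P c k) (Off x)"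
    and "germ (blow_chart2 P c k) (off_chart P k) (Off x)"
proof -
  let ?c = "snd k c"
  let ?N = "N \<inter> {a. fst a - fst ?c \<noteq> 0}"
  show "germ (off_chart P k) (blow_chart2 P c k) (Off x)"
  proof (rule germI)
    show "open ?N" using assms(1) by (intro open_Int open_Collect_neq continuous_intros)
    show "snd (off_chart P k) (Off x) \<in> ?N" using assms by simp
    show "holo_on (\<lambda>a. (fst a - fst ?c, (snd a - snd ?c) / (fst a - fst ?c))) ?N"
      by (intro holo_on_PairI) auto
    fix a assume a: "a \<in> ?N"
    then obtain y where "y \<in> fst k" "y \<notin> P" "snd k y = a" using assms(3) by blast
    then show "\<exists>y\<in>fst (off_chart P k) \<inter> fst (blow_chart2 P c k). snd (off_chart P k) y = a \<and>
        snd (blow_chart2 P c k) y = (fst a - fst ?c, (snd a - snd ?c) / (fst a - fst ?c))"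
      using a by (intro bexI[of _ "Off y"]) simp_all
  qed
  let ?h = "\<lambda>b. (fst b + fst ?c, fst b * snd b + snd ?c)"
  have h: "holo_on ?h UNIV" by (intro holo_on_PairI) auto
  let ?M = "?h -` N \<inter> {b. fst b \<noteq> 0}"
  show "germ (blow_chart2 P c k) (off_chart P k) (Off x)"
  proof (rule germI)
    show "open ?M"
      using assms(1) holo_on_imp_continuous_on[OF h]
      by (intro open_Int open_vimage open_Collect_neq continuous_intros)
    show "snd (blow_chart2 P c k) (Off x) \<in> ?M" using assms by simp
    show "holo_on ?h ?M" using h by (rule holo_on_subset) blast
    fix b assume b: "b \<in> ?M"
    then have "?h b \<in> N" by simp
    then have "\<exists>y\<in>fst k. y \<notin> P \<and> snd k y = ?h b" by (rule image_DiffD[OF assms(3)])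
    then obtain y where y: "y \<in> fst k" "y \<notin> P" "snd k y = ?h b" by blast
    have "fst b \<noteq> 0" using b by simp
    then show "\<exists>y\<in>fst (blow_chart2 P c k) \<inter> fst (off_chart P k).
        snd (blow_chart2 P c k) y = b \<and> snd (off_chart P k) y = ?h b"
      using y by (intro bexI[of _ "Off y"]) (simp_all add: prod_eq_iff)
  qed
qed

text \<open>Coordinates with \<open>snd b = 0\<close> belong to a point of the exceptional curve,
  all others to a point off it. Under the blow-down the centre \<open>c\<close> itself may be hit,
  other centres may not, whence \<open>P - {c}\<close>. The coordinates in the second chart are
  recorded at once, because a transition needs both for the same point \<open>y\<close>.\<close>

lemma blow_chart1_surj:
  assumes "(fst b * snd b + fst (snd k c), snd b + snd (snd k c)) \<in> snd k ` (fst k - (P - {c}))"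
  shows "\<exists>y\<in>fst (blow_chart1 P c k). snd (blow_chart1 P c k) y = b \<and> (fst b \<noteq> 0 \<longrightarrow>
     y \<in> fst (blow_chart2 P c k) \<and> snd (blow_chart2 P c k) y = (fst b * snd b, 1 / fst b))"
proof (cases "snd b = 0")
  case True
  then show ?thesis by (intro bexI[of _ "Exc c (Some (fst b))"]) (auto simp: prod_eq_iff)
next
  case False
  obtain x where x: "x \<in> fst k" "x \<notin> P - {c}"
    "snd k x = (fst b * snd b + fst (snd k c), snd b + snd (snd k c))"
    using image_DiffD[OF subset_refl assms] by blast
  then have "x \<noteq> c" using False by (auto simp: prod_eq_iff)
  then show ?thesis using x False by (intro bexI[of _ "Off x"]) (auto simp: prod_eq_iff)
qed

lemma blow_chart2_surj:
  assumes "(fst b + fst (snd k c), fst b * snd b + snd (snd k c)) \<in> snd k ` (fst k - (P - {c}))"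
  shows "\<exists>y\<in>fst (blow_chart2 P c k). snd (blow_chart2 P c k) y = b \<and> (snd b \<noteq> 0 \<longrightarrow>
     y \<in> fst (blow_chart1 P c k) \<and> snd (blow_chart1 P c k) y = (1 / snd b, fst b * snd b))"
proof (cases "fst b = 0")
  case True
  show ?thesis
  proof (cases "snd b = 0")
    case True
    then show ?thesis using \<open>fst b = 0\<close>
      by (intro bexI[of _ "Exc c None"]) (auto simp: prod_eq_iff)
  next
    case False
    then show ?thesis using \<open>fst b = 0\<close>
      by (intro bexI[of _ "Exc c (Some (1 / snd b))"]) (auto simp: prod_eq_iff)
  qed
next
  case False
  obtain x where x: "x \<in> fst k" "x \<notin> P - {c}"
    "snd k x = (fst b + fst (snd k c), fst b * snd b + snd (snd k c))"
    using image_DiffD[OF subset_refl assms] by blast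
  then have "x \<noteq> c" using False by (auto simp: prod_eq_iff)
  then show ?thesis using x False by (intro bexI[of _ "Off x"]) (auto simp: prod_eq_iff)
qed

text \<open>Between the two charts over \<open>c\<close> the transition sends \<open>(u, v)\<close>
  to \<open>(u v, 1 / u)\<close>. The neighbourhoods are preimages of \<open>N\<close> under the
  blow-down maps \<open>?h1\<close> and \<open>?h2\<close>, which are polynomial and therefore
  regular on the exceptional curve.\<close>

lemma germ_blow_chart_Exc:
  assumes "open N" "snd k c \<in> N" "N \<subseteq> snd k ` (fst k - (P - {c}))"
    "A \<in> {blow_chart1 P c k, blow_chart2 P c k}" "B \<in> {blow_chart1 P c k, blow_chart2 P c k}"
    "Exc c s \<in> fst A" "Exc c s \<in> fst B"
  shows "germ A B (Exc c s)"
proof -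
  let ?c = "snd k c"
  let ?h1 = "\<lambda>b. (fst b * snd b + fst ?c, snd b + snd ?c)"
  let ?h2 = "\<lambda>b. (fst b + fst ?c, fst b * snd b + snd ?c)"
  have h: "holo_on ?h1 UNIV" "holo_on ?h2 UNIV" by (intro holo_on_PairI; auto)+
  have o: "open (?h1 -` N)" "open (?h2 -` N)"
    by (intro open_vimage assms(1) holo_on_imp_continuous_on h)+
  have c: "snd (blow_chart1 P c k) (Exc c s) \<in> ?h1 -` N" if "s \<noteq> None"
    using assms(2) that by auto
  have c': "snd (blow_chart2 P c k) (Exc c s) \<in> ?h2 -` N"
    using assms(2) by (cases s) auto
  have s1: "\<exists>y\<in>fst (blow_chart1 P c k). snd (blow_chart1 P c k) y = b \<and> (fst b \<noteq> 0 \<longrightarrow>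
     y \<in> fst (blow_chart2 P c k) \<and> snd (blow_chart2 P c k) y = (fst b * snd b, 1 / fst b))"
    if "b \<in> ?h1 -` N" for b
    by (rule blow_chart1_surj) (rule subsetD[OF assms(3)], use that in simp)
  have s2: "\<exists>y\<in>fst (blow_chart2 P c k). snd (blow_chart2 P c k) y = b \<and> (snd b \<noteq> 0 \<longrightarrow>
     y \<in> fst (blow_chart1 P c k) \<and> snd (blow_chart1 P c k) y = (1 / snd b, fst b * snd b))"
    if "b \<in> ?h2 -` N" for b
    by (rule blow_chart2_surj) (rule subsetD[OF assms(3)], use that in simp)
  consider "A = blow_chart1 P c k" "B = blow_chart1 P c k" | "A = blow_chart1 P c k" "B = blow_chart2 P c k"
    | "A = blow_chart2 P c k" "B = blow_chart1 P c k" | "A = blow_chart2 P c k" "B = blow_chart2 P c k"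
    using assms(4,5) by blast
  then show ?thesis
  proof cases
    case 1
    show ?thesis unfolding 1
    proof (rule germI[OF o(1) _ holo_on_id])
      fix b assume "b \<in> ?h1 -` N"
      then show "\<exists>y\<in>fst (blow_chart1 P c k) \<inter> fst (blow_chart1 P c k).
          snd (blow_chart1 P c k) y = b \<and> snd (blow_chart1 P c k) y = b" using s1 by blast
    qed (use c assms(6) 1 in simp)
  next
    case 2
    have s: "s \<noteq> None" "s \<noteq> Some 0" using assms(6,7) 2 by simp_all
    show ?thesis unfolding 2
    proof (rule germI[where N = "?h1 -` N \<inter> {b. fst b \<noteq> 0}" and g = "\<lambda>b. (fst b * snd b, 1 / fst b)"])
      show "open (?h1 -` N \<inter> {b. fst b \<noteq> 0})"
        by (intro open_Int o(1)) (intro open_Collect_neq continuous_intros)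
      show "snd (blow_chart1 P c k) (Exc c s) \<in> ?h1 -` N \<inter> {b. fst b \<noteq> 0}"
        using c s by auto
      show "holo_on (\<lambda>b. (fst b * snd b, 1 / fst b)) (?h1 -` N \<inter> {b. fst b \<noteq> 0})"
        by (intro holo_on_PairI) auto
      fix b assume "b \<in> ?h1 -` N \<inter> {b. fst b \<noteq> 0}"
      then show "\<exists>y\<in>fst (blow_chart1 P c k) \<inter> fst (blow_chart2 P c k).
          snd (blow_chart1 P c k) y = b \<and> snd (blow_chart2 P c k) y = (fst b * snd b, 1 / fst b)"
        using s1[of b] by blast
    qed
  next
    case 3
    have s: "s \<noteq> None" "s \<noteq> Some 0" using assms(6,7) 3 by simp_all
    show ?thesis unfolding 3
    proof (rule germI[where N = "?h2 -` N \<inter> {b. snd b \<noteq> 0}" and g = "\<lambda>b. (1 / snd b, fst b * snd b)"])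
      show "open (?h2 -` N \<inter> {b. snd b \<noteq> 0})"
        by (intro open_Int o(2)) (intro open_Collect_neq continuous_intros)
      show "snd (blow_chart2 P c k) (Exc c s) \<in> ?h2 -` N \<inter> {b. snd b \<noteq> 0}"
        using c' s by auto
      show "holo_on (\<lambda>b. (1 / snd b, fst b * snd b)) (?h2 -` N \<inter> {b. snd b \<noteq> 0})"
        by (intro holo_on_PairI) auto
      fix b assume "b \<in> ?h2 -` N \<inter> {b. snd b \<noteq> 0}"
      then show "\<exists>y\<in>fst (blow_chart2 P c k) \<inter> fst (blow_chart1 P c k).
          snd (blow_chart2 P c k) y = b \<and> snd (blow_chart1 P c k) y = (1 / snd b, fst b * snd b)"
        using s2[of b] by blast
    qed
  next
    case 4
    show ?thesis unfolding 4
    proof (rule germI[OF o(2) c' holo_on_id])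
      fix b assume "b \<in> ?h2 -` N"
      then show "\<exists>y\<in>fst (blow_chart2 P c k) \<inter> fst (blow_chart2 P c k).
          snd (blow_chart2 P c k) y = b \<and> snd (blow_chart2 P c k) y = b" using s2 by blast
    qed
  qed
qed

lemma blow_up_atlasE:
  assumes "A \<in> atlas (blow_up X B)"
  obtains k where "k \<in> atlas X" "A = off_chart (fst ` B) k"
  | c k where "(c, k) \<in> B" "A = blow_chart1 (fst ` B) c k"
  | c k where "(c, k) \<in> B" "A = blow_chart2 (fst ` B) c k"
  using assms unfolding blow_up_atlas by auto

text \<open>Off the exceptional curves each chart is linked to the lift of a chart of
  \<open>X\<close>, and \<open>germ_trans\<close> passes through two such lifts. On an exceptional
  curve the assumption \<open>unique\<close> leaves the two blow-up charts of one centre, which are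
  compared directly.\<close>

theorem complex_surface_blow_up:
  assumes X: "complex_surface X" and "finite B"
    and B: "\<And>c k. (c, k) \<in> B \<Longrightarrow> k \<in> atlas X \<and> c \<in> fst k"
    and unique: "\<And>c k k'. (c, k) \<in> B \<Longrightarrow> (c, k') \<in> B \<Longrightarrow> k = k'"
  shows "complex_surface (blow_up X B)"
proof -
  let ?P = "fst ` B"
  have P: "finite ?P" using assms(2) by simp
  have pts: "points (blow_up X B) = Off ` (points X - ?P) \<union> {Exc c s | c s. c \<in> ?P}"
    unfolding blow_up_def by simp
  have injk: "inj_on (snd k) (fst k)" if "(c, k) \<in> B" for c k
    using complex_surfaceD(2)[OF X] B[OF that] by blast
  have subk: "fst k \<subseteq> points X" if "(c, k) \<in> B" for c k
    using complex_surfaceD(1)[OF X] B[OF that] by blast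
  have inj: "inj_on (snd A) (fst A)" if "A \<in> atlas (blow_up X B)" for A
    using that
  proof (cases rule: blow_up_atlasE)
    case (1 k)
    then show ?thesis using inj_on_off_chart complex_surfaceD(2)[OF X] by metis
  next
    case (2 c k)
    then show ?thesis using inj_on_blow_chart1 injk by metis
  next
    case (3 c k)
    then show ?thesis using inj_on_blow_chart2 injk by metis
  qed
  have sub: "fst A \<subseteq> points (blow_up X B)" if "A \<in> atlas (blow_up X B)" for A
    using that
  proof (cases rule: blow_up_atlasE)
    case (1 k)
    then have "fst k \<subseteq> points X" using complex_surfaceD(1)[OF X] by metis
    then show ?thesis unfolding pts off_chart_def 1(2) fst_conv by blast
  next
    case (2 c k)
    moreover have "c \<in> ?P" using 2 by force
    ultimately show ?thesis unfolding pts 2(2) fst_blow_chart1 using subk[OF 2(1)] by blast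
  next
    case (3 c k)
    moreover have "c \<in> ?P" using 3 by force
    ultimately show ?thesis unfolding pts 3(2) fst_blow_chart2 using subk[OF 3(1)] by blast
  qed
  \<comment> \<open>Applied with \<open>P' = ?P\<close> near a point that is not a centre, and with
    \<open>P' = ?P - {d}\<close> near the centre \<open>d\<close>.\<close>
  have nhd: "\<exists>N. open N \<and> snd k x \<in> N \<and> N \<subseteq> snd k ` (fst k - P')"
    if "k \<in> atlas X" "x \<in> fst k" "x \<notin> P'" "P' \<subseteq> ?P" for k x P'
    by (rule off_chart_nhd[of k x P'])
      (use that complex_surfaceD[OF X that(1)] P in \<open>auto intro: finite_subset\<close>)
  have off: "\<exists>k\<in>atlas X. x \<in> fst k \<and> x \<notin> ?P \<and> germ A (off_chart ?P k) (Off x) \<and> germ (off_chart ?P k) A (Off x)"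
    if A: "A \<in> atlas (blow_up X B)" and x: "Off x \<in> fst A" for A x
    using A
  proof (cases rule: blow_up_atlasE)
    case (1 k)
    then have "x \<in> fst k" "x \<notin> ?P" using x by simp_all
    then show ?thesis
      using 1 germ_off_chart[OF complex_surfaceD(3)[OF X 1(1) 1(1)] _ _ complex_surfaceD(2)[OF X 1(1)] P]
      by blast
  next
    case (2 c k)
    then have *: "k \<in> atlas X" "x \<in> fst k" "x \<notin> ?P" using x B[of c k] by simp_all
    obtain N where "open N" "snd k x \<in> N" "N \<subseteq> snd k ` (fst k - ?P)" using nhd[OF *] by blast
    then show ?thesis using * germ_off_chart_blow_chart1[of N k x ?P c] x 2 by blast
  next
    case (3 c k)
    then have *: "k \<in> atlas X" "x \<in> fst k" "x \<notin> ?P" using x B[of c k] by simp_all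
    obtain N where "open N" "snd k x \<in> N" "N \<subseteq> snd k ` (fst k - ?P)" using nhd[OF *] by blast
    then show ?thesis using * germ_off_chart_blow_chart2[of N k x ?P c] x 3 by blast
  qed
  have exc: "\<exists>k. (d, k) \<in> B \<and> A \<in> {blow_chart1 ?P d k, blow_chart2 ?P d k}"
    if A: "A \<in> atlas (blow_up X B)" and x: "Exc d s \<in> fst A" for A d s
    using A
  proof (cases rule: blow_up_atlasE)
    case (1 k)
    then show ?thesis using x by simp
  next
    case (2 c k)
    then have "d = c" using x by simp
    then show ?thesis using 2 by blast
  next
    case (3 c k)
    then have "d = c" using x by simp
    then show ?thesis using 3 by blast
  qed
  have "germ A A' z" if A: "A \<in> atlas (blow_up X B)" "A' \<in> atlas (blow_up X B)"
    and z: "z \<in> fst A" "z \<in> fst A'" for A A' z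
  proof (cases z)
    case (Off x)
    obtain k where k: "k \<in> atlas X" "x \<in> fst k" "x \<notin> ?P" "germ A (off_chart ?P k) z"
      using off[OF A(1)] z Off by blast
    obtain k' where k': "k' \<in> atlas X" "x \<in> fst k'" "x \<notin> ?P" "germ (off_chart ?P k') A' z"
      using off[OF A(2)] z Off by blast
    have "germ (off_chart ?P k) (off_chart ?P k') z"
      unfolding Off using germ_off_chart[OF complex_surfaceD(3)[OF X k(1) k'(1)]] k k'
        complex_surfaceD(2)[OF X k(1)] P by blast
    moreover have "z \<in> fst (off_chart ?P k)" "z \<in> fst (off_chart ?P k')" using k k' Off by simp_all
    moreover have "inj_on (snd (off_chart ?P k)) (fst (off_chart ?P k))"
      "inj_on (snd (off_chart ?P k')) (fst (off_chart ?P k'))"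
      using inj_on_off_chart complex_surfaceD(2)[OF X] k k' by blast+
    ultimately show ?thesis
      using k(4) k'(4) z inj[OF A(1)] by (meson germ_trans)
  next
    case (Exc d s)
    obtain k where k: "(d, k) \<in> B" "A \<in> {blow_chart1 ?P d k, blow_chart2 ?P d k}"
      using exc[OF A(1)] z Exc by blast
    obtain k' where k': "(d, k') \<in> B" "A' \<in> {blow_chart1 ?P d k', blow_chart2 ?P d k'}"
      using exc[OF A(2)] z Exc by blast
    have "k' = k" using unique k k' by blast
    obtain N where N: "open N" "snd k d \<in> N" "N \<subseteq> snd k ` (fst k - (?P - {d}))"
      using nhd[of k d "?P - {d}"] B k(1) by blast
    show ?thesis
      unfolding Exc by (rule germ_blow_chart_Exc[OF N]) (use k k' z Exc \<open>k' = k\<close> in simp_all)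
  qed
  then show ?thesis unfolding complex_surface_def using inj sub by blast
qed

section \<open>Limits of pairs of coordinates\<close>

lemma limit_pair_swap:
  fixes f g :: "'a \<Rightarrow> c2"
  assumes "(a, b) \<in> closure ((\<lambda>z. (f z, g z)) ` D)"
  shows "(b, a) \<in> closure ((\<lambda>z. (g z, f z)) ` D)"
  unfolding closure_approachable
proof (intro allI impI)
  fix e :: real assume "e > 0"
  then obtain z where "z \<in> D" "dist (f z, g z) (a, b) < e"
    using assms unfolding closure_approachable by blast
  moreover have "dist (g z, f z) (b, a) = dist (f z, g z) (a, b)" for z
    by (simp add: dist_prod_def add.commute)
  ultimately show "\<exists>y\<in>(\<lambda>z. (g z, f z)) ` D. dist y (b, a) < e" by auto
qed

lemma limit_pair_eq_zero:
  fixes F :: "_ \<Rightarrow> complex"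
  assumes "(a, b) \<in> closure ((\<lambda>z. (f z, g z)) ` D)" "continuous_on UNIV F"
    "\<And>z. z \<in> D \<Longrightarrow> F (f z, g z) = 0"
  shows "F (a, b) = 0"
  using closure_image_eq_zero[OF assms(1,2)] assms(3) by blast

lemma limit_pair_same:
  fixes f :: "'a \<Rightarrow> c2"
  assumes "(a, b) \<in> closure ((\<lambda>z. (f z, f z)) ` D)"
  shows "a = b"
proof -
  have "(\<lambda>p. fst p - snd p) (a, b) = 0"
    by (rule closure_image_eq_zero[OF assms]) (auto intro!: continuous_intros)
  then show ?thesis by simp
qed

lemma dense_superset: "closure A = UNIV \<Longrightarrow> A \<subseteq> B \<Longrightarrow> closure B = UNIV"
  using closure_mono[of A B] by blast

section \<open>The Hirzebruch surface as a glued surface\<close>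

text \<open>The transition between the planes of \<open>(q, p)\<close> and
  \<open>(x_0, y_0)\<close>. It is an involution where the first coordinate is nonzero, which makes
  the planes 0 and 1, and likewise 2 and 3, interchangeable.\<close>

definition flip :: "complex \<Rightarrow> c2 \<Rightarrow> c2" where
  "flip a z = (1 / fst z, - (fst z * snd z + a) * fst z)"

definition recip :: "c2 \<Rightarrow> c2" where
  "recip z = (fst z, 1 / snd z)"

text \<open>On this dense set all coordinate functions below are defined.\<close>
definition generic :: "complex \<Rightarrow> c2 set" where
  "generic a = {z. fst z \<noteq> 0 \<and> snd z \<noteq> 0 \<and> fst z * snd z + a \<noteq> 0}"

lemma flip_flip [simp]: "fst z \<noteq> 0 \<Longrightarrow> flip a (flip a z) = z"
  by (cases z) (simp add: flip_def field_simps)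

lemma recip_recip [simp]: "snd z \<noteq> 0 \<Longrightarrow> recip (recip z) = z"
  by (simp add: recip_def)

lemma flip_eq_iff:
  "fst z \<noteq> 0 \<Longrightarrow> fst w \<noteq> 0 \<Longrightarrow> flip a z = flip a w \<longleftrightarrow> z = w"
  by (metis flip_flip)

lemma flip_generic: "z \<in> generic a \<Longrightarrow> flip a z \<in> generic a"
proof -
  assume z: "z \<in> generic a"
  then have "fst (flip a z) * snd (flip a z) + a = - (fst z * snd z)"
    by (simp add: generic_def flip_def)
  also have "\<dots> \<noteq> 0" using z by (simp add: generic_def)
  finally have 1: "fst (flip a z) * snd (flip a z) + a \<noteq> 0" .
  have "fst z * snd z + a \<noteq> 0" "fst z \<noteq> 0" using z by (simp_all add: generic_def)
  then have "fst (flip a z) \<noteq> 0" "snd (flip a z) \<noteq> 0"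
    unfolding flip_def fst_conv snd_conv mult_eq_0_iff neg_equal_0_iff_equal by simp_all
  with 1 show ?thesis unfolding generic_def by blast
qed

lemma flip_image_generic: "flip a ` generic a = generic a"
proof
  show "generic a \<subseteq> flip a ` generic a"
  proof
    fix z assume z: "z \<in> generic a"
    then have "z = flip a (flip a z)" by (simp add: generic_def)
    then show "z \<in> flip a ` generic a" using flip_generic[OF z] by blast
  qed
qed (use flip_generic in blast)

lemma open_generic: "open (generic a)"
  unfolding generic_def by (intro open_Collect_conj open_Collect_neq continuous_intros)

lemma dense_generic: "closure (generic a) = UNIV"
proof -
  have "{z. fst z \<notin> {0} \<and> snd z \<notin> {0, - a / fst z}} \<subseteq> generic a"
    by (auto simp: generic_def field_simps add_eq_0_iff)
  then show ?thesis by (rule dense_superset[OF dense_fibrewise, rotated 2]) simp_all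
qed

lemma holo_on_flip: "holo_on (flip a) {z. fst z \<noteq> 0}"
  unfolding flip_def[abs_def] by (intro holo_on_PairI) auto

lemma holo_on_recip: "holo_on recip {z. snd z \<noteq> 0}"
  unfolding recip_def[abs_def] by (intro holo_on_PairI) auto

lemma continuous_on_flip: "continuous_on (generic a) (flip a)"
  by (rule holo_on_imp_continuous_on, rule holo_on_subset[OF holo_on_flip]) (auto simp: generic_def)

lemma continuous_on_recip: "continuous_on (generic a) recip"
  by (rule holo_on_imp_continuous_on, rule holo_on_subset[OF holo_on_recip]) (auto simp: generic_def)

lemma continuous_on_recip_flip: "continuous_on (generic a) (recip \<circ> flip a)"
  by (rule continuous_on_compose[OF continuous_on_flip])
    (simp add: flip_image_generic continuous_on_recip)

lemma dense_recip: "closure (recip ` generic a) = UNIV"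
proof -
  \<comment> \<open>The second excluded value solves \<open>fst z / snd z + a = 0\<close>. For
    \<open>a = 0\<close> the quotient by zero is 0 and repeats the first value, while the equation
    then has no solution because \<open>fst z\<close> is nonzero.\<close>
  have "z \<in> recip ` generic a" if "fst z \<notin> {0}" "snd z \<notin> {0, - fst z / a}" for z
  proof -
    have "fst z / snd z + a \<noteq> 0"
    proof
      assume *: "fst z / snd z + a = 0"
      then have "a \<noteq> 0" using that by auto
      with * that show False by (auto simp: field_simps add_eq_0_iff)
    qed
    then have "recip z \<in> generic a" using that by (simp add: generic_def recip_def)
    moreover have "z = recip (recip z)" using that by simp
    ultimately show ?thesis by blast
  qed
  then have "{z. fst z \<notin> {0} \<and> snd z \<notin> {0, - fst z / a}} \<subseteq> recip ` generic a" by blast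
  then show ?thesis by (rule dense_superset[OF dense_fibrewise, rotated 2]) simp_all
qed

lemma hirz_coords_simps:
  "hirz_coords a 0 = (\<lambda>z. z)" "hirz_coords a (Suc 0) = flip a"
  "hirz_coords a 2 = recip" "hirz_coords a 3 = recip \<circ> flip a"
  unfolding hirz_coords_def flip_def recip_def by (simp_all add: fun_eq_iff split: prod.split)

text \<open>A point of the Hirzebruch surface is represented by its coordinates in the first of the four
  planes that contains it.\<close>
definition hirz_model :: "complex \<Rightarrow> nat \<Rightarrow> c2 \<Rightarrow> nat \<times> c2" where
  "hirz_model a j z =
     (let m1 = \<lambda>z. if fst z \<noteq> 0 then (0, flip a z) else (1, z) in
      if j = 0 then (0, z)
      else if j = 1 then m1 z
      else if j = 2 then if snd z \<noteq> 0 then (0, recip z) else (2, z)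
      else if snd z \<noteq> 0 then m1 (recip z)
      else if fst z \<noteq> 0 then (2, (1 / fst z, 0)) else (3, z))"

lemma hirz_model_simps:
  "hirz_model a 0 z = (0, z)"
  "hirz_model a (Suc 0) z = (if fst z \<noteq> 0 then (0, flip a z) else (1, z))"
  "hirz_model a 2 z = (if snd z \<noteq> 0 then (0, recip z) else (2, z))"
  "hirz_model a 3 z = (if snd z \<noteq> 0 then hirz_model a (Suc 0) (recip z)
     else if fst z \<noteq> 0 then (2, (1 / fst z, 0)) else (3, z))"
  by (simp_all add: hirz_model_def Let_def)

lemma le_3_cases:
  assumes "i \<in> {0..3::nat}"
  obtains "i = 0" | "i = Suc 0" | "i = 2" | "i = 3"
  using assms by fastforce

lemma inj_hirz_model_1: "inj (hirz_model a (Suc 0))"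
  by (rule injI) (auto simp: hirz_model_simps flip_eq_iff split: if_splits)

lemma recip_eq_iff: "snd z \<noteq> 0 \<Longrightarrow> snd w \<noteq> 0 \<Longrightarrow> recip z = recip w \<longleftrightarrow> z = w"
  by (metis recip_recip)

lemma inj_hirz_model: 
  assumes "i \<in> {0..3}" shows "inj (hirz_model a i)"
  using assms
proof (cases rule: le_3_cases)
  case 1
  then show ?thesis by (simp add: hirz_model_simps inj_def)
next
  case 2
  then show ?thesis by (simp add: inj_hirz_model_1)
next
  case 3
  show ?thesis unfolding 3
    by (rule injI) (auto simp: hirz_model_simps recip_eq_iff split: if_splits)
next
  case 4
  have "z = w" if *: "hirz_model a 3 z = hirz_model a 3 w" for z w
  proof (cases "snd z = 0 \<or> snd w = 0")
    case True
    then show ?thesis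
      using * by (auto simp: hirz_model_simps prod_eq_iff split: if_splits)
  next
    case False
    then have "hirz_model a (Suc 0) (recip z) = hirz_model a (Suc 0) (recip w)"
      using * by (simp add: hirz_model_simps(4))
    then show ?thesis using inj_hirz_model_1[of a] False by (metis injD recip_recip)
  qed
  then show ?thesis unfolding 4 by (rule injI)
qed

text \<open>The assumption \<open>trans\<close> of \<open>plane_model\<close> at one point, isolated
  so that transitions can be composed through an intermediate plane.\<close>

definition local_transition :: "('i \<Rightarrow> c2 \<Rightarrow> 'z) \<Rightarrow> 'i \<Rightarrow> c2 \<Rightarrow> 'i \<Rightarrow> bool" where
  "local_transition m i a j \<longleftrightarrow>
     (\<exists>N h. open N \<and> a \<in> N \<and> holo_on h N \<and> (\<forall>c\<in>N. m j (h c) = m i c))"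

lemma local_transitionI:
  assumes "open N" "a \<in> N" "holo_on h N" "\<And>c. c \<in> N \<Longrightarrow> m j (h c) = m i c"
  shows "local_transition m i a j"
  using assms unfolding local_transition_def by blast

lemma local_transition_trans:
  assumes "local_transition m i a j" "local_transition m j b k" "m i a = m j b" "inj (m j)"
  shows "local_transition m i a k"
proof -
  obtain N g where N: "open N" "a \<in> N" "holo_on g N" "\<And>c. c \<in> N \<Longrightarrow> m j (g c) = m i c"
    using assms(1) unfolding local_transition_def by blast
  obtain M h where M: "open M" "b \<in> M" "holo_on h M" "\<And>c. c \<in> M \<Longrightarrow> m k (h c) = m j c"
    using assms(2) unfolding local_transition_def by blast
  have "m j (g a) = m j b" using N(4)[OF N(2)] assms(3) by simp
  then have "g a = b" using assms(4) by (rule injD[rotated])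
  show ?thesis
  proof (rule local_transitionI)
    show "open (N \<inter> g -` M)"
      by (rule continuous_open_preimage[OF holo_on_imp_continuous_on[OF N(3)] N(1) M(1)])
    show "a \<in> N \<inter> g -` M" using N(2) M(2) \<open>g a = b\<close> by simp
    show "holo_on (h \<circ> g) (N \<inter> g -` M)"
      by (rule holo_on_compose[OF holo_on_subset[OF N(3)] M(3)]) auto
    show "m k ((h \<circ> g) c) = m i c" if "c \<in> N \<inter> g -` M" for c
      using M(4)[of "g c"] N(4)[of c] that by simp
  qed
qed

lemma local_transition_refl: "local_transition m i a i"
  by (rule local_transitionI[of UNIV a "\<lambda>z. z"]) (auto intro: holo_on_id)

lemma hirz_transition_flip:
  "fst z \<noteq> 0 \<Longrightarrow> local_transition (hirz_model a) 0 z (Suc 0)"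
  "fst z \<noteq> 0 \<Longrightarrow> local_transition (hirz_model a) (Suc 0) z 0"
  by (rule local_transitionI[of "{z. fst z \<noteq> 0}" _ "flip a"];
      auto simp: hirz_model_simps intro!: holo_on_flip open_Collect_neq continuous_intros; simp add: flip_def)+

lemma hirz_transition_recip:
  "snd z \<noteq> 0 \<Longrightarrow> local_transition (hirz_model a) 0 z 2"
  "snd z \<noteq> 0 \<Longrightarrow> local_transition (hirz_model a) 2 z 0"
  "snd z \<noteq> 0 \<Longrightarrow> local_transition (hirz_model a) (Suc 0) z 3"
  "snd z \<noteq> 0 \<Longrightarrow> local_transition (hirz_model a) 3 z (Suc 0)"
  by (rule local_transitionI[of "{z. snd z \<noteq> 0}" _ recip];
      auto simp: hirz_model_simps intro!: holo_on_recip open_Collect_neq continuous_intros; simp add: recip_def)+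


lemma hirz_model_2_1:
  assumes "hirz_model a 2 z = hirz_model a (Suc 0) w"
  shows "snd z \<noteq> 0" "fst w \<noteq> 0" "recip z = flip a w"
  using assms by (auto simp: hirz_model_simps split: if_splits)

lemma hirz_model_3_0:
  assumes "hirz_model a 3 z = hirz_model a 0 w"
  shows "snd z \<noteq> 0" "fst z \<noteq> 0" "flip a (recip z) = w"
  using assms by (auto simp: hirz_model_simps recip_def split: if_splits)

lemma hirz_model_2_0:
  assumes "hirz_model a 2 z = hirz_model a 0 w"
  shows "snd z \<noteq> 0" "recip z = w"
  using assms by (auto simp: hirz_model_simps split: if_splits)

lemma hirz_model_3_1:
  assumes "hirz_model a 3 z = hirz_model a (Suc 0) w"
  shows "snd z \<noteq> 0" "recip z = w"
proof -
  show *: "snd z \<noteq> 0"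
    using assms by (auto simp: hirz_model_simps split: if_splits)
  then have "hirz_model a (Suc 0) (recip z) = hirz_model a (Suc 0) w"
    using assms by (simp add: hirz_model_simps(4))
  then show "recip z = w" using inj_hirz_model_1 by (metis injD)
qed

lemma hirz_model_2_3:
  assumes "hirz_model a 2 z = hirz_model a 3 w"
  shows "snd z \<noteq> 0 \<and> snd w \<noteq> 0 \<and> hirz_model a 0 (recip z) = hirz_model a (Suc 0) (recip w) \<or>
    snd z = 0 \<and> snd w = 0 \<and> fst w \<noteq> 0 \<and> fst z = 1 / fst w"
  using assms by (auto simp: hirz_model_simps split: if_splits)

text \<open>These points at infinity lie in neither plane 0 nor plane 1, so a direct transition is
  required. It is \<open>flip\<close> written in \<open>w = 1 / p\<close>: the expression
  \<open>1 / (- (z / w + a) z)\<close> equals \<open>- w / ((z + a w) z)\<close>, which is regular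
  at \<open>w = 0\<close>. As \<open>flip\<close> is an involution, one formula serves both
  directions.\<close>

lemma hirz_model_mid:
  assumes "fst z \<noteq> 0" "snd z = 0"
  shows "local_transition (hirz_model a) 2 z 3" "local_transition (hirz_model a) 3 z 2"
proof -
  let ?N = "{z. fst z \<noteq> 0 \<and> fst z + a * snd z \<noteq> 0}"
  let ?h = "\<lambda>z. (1 / fst z, - snd z / ((fst z + a * snd z) * fst z))"
  have N: "open ?N" by (intro open_Collect_conj open_Collect_neq continuous_intros)
  have h: "holo_on ?h ?N" by (intro holo_on_PairI) auto
  have z: "z \<in> ?N" using assms by simp
  have *: "flip a (recip c) = recip (?h c)" if "c \<in> ?N" "snd c \<noteq> 0" for c
    using that by (simp add: flip_def recip_def field_simps)
  have h0: "snd (?h c) = 0 \<longleftrightarrow> snd c = 0" "fst (?h c) \<noteq> 0" if "c \<in> ?N" for c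
    using that by auto
  show "local_transition (hirz_model a) 2 z 3"
  proof (rule local_transitionI[OF N z h])
    fix c assume c: "c \<in> ?N"
    show "hirz_model a 3 (?h c) = hirz_model a 2 c"
    proof (cases "snd c = 0")
      case True
      then show ?thesis using h0[OF c] c by (simp add: hirz_model_simps prod_eq_iff)
    next
      case False
      have "fst (recip c) \<noteq> 0" using c by (simp add: recip_def)
      moreover have "fst (recip (?h c)) \<noteq> 0" using h0[OF c] by (simp add: recip_def)
      ultimately have "flip a (recip (?h c)) = recip c" using *[OF c False] by (metis flip_flip)
      then show ?thesis using False h0[OF c] \<open>fst (recip (?h c)) \<noteq> 0\<close>
        by (simp add: hirz_model_simps del: fst_conv snd_conv)
    qed
  qed
  show "local_transition (hirz_model a) 3 z 2"
  proof (rule local_transitionI[OF N z h])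
    fix c assume c: "c \<in> ?N"
    show "hirz_model a 2 (?h c) = hirz_model a 3 c"
    proof (cases "snd c = 0")
      case True
      then show ?thesis using h0[OF c] c by (simp add: hirz_model_simps)
    next
      case False
      then show ?thesis using h0[OF c] *[OF c False] c
        by (simp add: hirz_model_simps recip_def)
    qed
  qed
qed

text \<open>All pairs of planes are linked through planes 0 and 1, except 2 and 3 at infinity, where
  \<open>hirz_model_mid\<close> applies.\<close>

lemma hirz_transition:
  assumes ij: "i \<in> {0..3}" "j \<in> {0..3}" and eq: "hirz_model a i z = hirz_model a j w"
  shows "local_transition (hirz_model a) i z j"
proof -
  let ?m = "hirz_model a" and ?lt = "local_transition (hirz_model a)"
  note tr = local_transition_trans[where m = "?m"]
  have inj: "inj (?m 0)" "inj (?m (Suc 0))" by (simp_all add: inj_hirz_model)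
  have t01: "?lt 0 z (Suc 0)" if "?m 0 z = ?m (Suc 0) w" for z w
    using that by (intro hirz_transition_flip) (auto simp: hirz_model_simps flip_def split: if_splits)
  have t10: "?lt (Suc 0) z 0" if "?m (Suc 0) z = ?m 0 w" for z w
    using that by (intro hirz_transition_flip) (auto simp: hirz_model_simps split: if_splits)
  have t02: "?lt 0 z 2" if "?m 0 z = ?m 2 w" for z w
    using that by (intro hirz_transition_recip) (auto simp: hirz_model_simps recip_def split: if_splits)
  have t20: "?lt 2 z 0" if "?m 2 z = ?m 0 w" for z w
    using that by (intro hirz_transition_recip hirz_model_2_0)
  have t13: "?lt (Suc 0) z 3" if "?m (Suc 0) z = ?m 3 w" for z w
    using hirz_model_3_1[OF that[symmetric]] by (intro hirz_transition_recip) (auto simp: recip_def)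
  have t31: "?lt 3 z (Suc 0)" if "?m 3 z = ?m (Suc 0) w" for z w
    using that by (intro hirz_transition_recip hirz_model_3_1)
  have e2: "?m 2 z = ?m 0 (recip z)" if "snd z \<noteq> 0" for z
    using that by (simp add: hirz_model_simps)
  have e3: "?m 3 z = ?m (Suc 0) (recip z)" if "snd z \<noteq> 0" for z
    using that by (simp add: hirz_model_simps)
  have t12: "?lt (Suc 0) z 2" if "?m (Suc 0) z = ?m 2 w" for z w
  proof -
    have "?m 2 w = ?m 0 (recip w)" using e2 hirz_model_2_1[OF that[symmetric]] by simp
    then show ?thesis using tr[OF t10 t02] that inj by metis
  qed
  have t21: "?lt 2 z (Suc 0)" if "?m 2 z = ?m (Suc 0) w" for z w
  proof -
    have "?m 2 z = ?m 0 (recip z)" using e2 hirz_model_2_1[OF that] by simp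
    then show ?thesis using tr[OF t20 t01] that inj by metis
  qed
  have t03: "?lt 0 z 3" if "?m 0 z = ?m 3 w" for z w
  proof -
    have "?m 3 w = ?m (Suc 0) (recip w)" using e3 hirz_model_3_0[OF that[symmetric]] by simp
    then show ?thesis using tr[OF t01 t13] that inj by metis
  qed
  have t30: "?lt 3 z 0" if "?m 3 z = ?m 0 w" for z w
  proof -
    have "?m 3 z = ?m (Suc 0) (recip z)" using e3 hirz_model_3_0[OF that] by simp
    then show ?thesis using tr[OF t31 t10] that inj by metis
  qed
  have t23: "?lt 2 z 3" if *: "?m 2 z = ?m 3 w" for z w
    using hirz_model_2_3[OF *]
  proof (elim disjE conjE)
    assume "snd z \<noteq> 0" "snd w \<noteq> 0"
    then show ?thesis using tr[OF t20 t03] e2 * inj by metis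
  qed (use hirz_model_mid in auto)
  have t32: "?lt 3 z 2" if *: "?m 3 z = ?m 2 w" for z w
    using hirz_model_2_3[OF *[symmetric]]
  proof (elim disjE conjE)
    assume "snd z \<noteq> 0" "snd w \<noteq> 0"
    then show ?thesis using tr[OF t31 t12] e3 * inj by metis
  qed (use hirz_model_mid in auto)
  show ?thesis
    by (rule le_3_cases[OF ij(1)]; rule le_3_cases[OF ij(2)])
      (use eq t01 t10 t02 t20 t03 t30 t12 t21 t13 t31 t23 t32 local_transition_refl in metis)+
qed

text \<open>Since \<open>flip\<close> permutes \<open>generic a\<close>, pairs of coordinates may be
  reparametrised by it. This turns the pairs of planes (1, 3) and (1, 2) into (0, 2) and (0,
  3).\<close>

lemma limit_pair_flip:
  "(\<lambda>p. (f p, g p)) ` generic a = (\<lambda>p. (f (flip a p), g (flip a p))) ` generic a"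
  by (subst flip_image_generic[of a, symmetric]) (simp add: image_image)

lemma one_divide_eqI: "a * b = 1 \<Longrightarrow> 1 / a = b" for a b :: complex
  by (metis divide_divide_eq_right mult_1 nonzero_mult_div_cancel_right mult_zero_right zero_neq_one)

lemma fst_flip [simp]: "fst (flip a z) = 1 / fst z"
  by (simp add: flip_def)

lemma fst_recip [simp]: "fst (recip z) = fst z" and snd_recip [simp]: "snd (recip z) = 1 / snd z"
  by (simp_all add: recip_def)

text \<open>The transition formulas, cleared of denominators, hold on \<open>generic a\<close> and
  survive in the limit. A product that stays equal to 1 keeps its factors away from zero, so the
  limit points lie where the transition is defined.\<close>

lemma hirz_separated:
  assumes ij: "i \<in> {0..3}" "j \<in> {0..3}"
    and cl: "(z, w) \<in> closure ((\<lambda>p. (hirz_coords a i p, hirz_coords a j p)) ` generic a)"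
  shows "hirz_model a i z = hirz_model a j w"
proof -
  let ?cl = "\<lambda>f g z w. (z, w) \<in> closure ((\<lambda>p. (f p, g p)) ` generic a)"
  note ze = limit_pair_eq_zero[where D = "generic a"]
  have g: "fst p \<noteq> 0" "snd p \<noteq> 0" "fst p * snd p + a \<noteq> 0" if "p \<in> generic a" for p
    using that by (auto simp: generic_def)
  have flip2: "(\<lambda>p. (f (flip a p), g (flip a (flip a p)))) ` generic a = (\<lambda>p. (f (flip a p), g p)) ` generic a"
    for f g :: "c2 \<Rightarrow> c2"
    by (rule image_cong) (simp_all add: g)
  have id_flip: "fst z \<noteq> 0 \<and> w = flip a z" if cl: "?cl (\<lambda>p. p) (flip a) z w" for z w
  proof -
    have "(\<lambda>p. fst (fst p) * fst (snd p) - 1) (z, w) = 0"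
      by (rule ze[OF cl]) (auto intro!: continuous_intros simp: flip_def dest: g)
    moreover have "(\<lambda>p. snd (snd p) + (fst (fst p) * snd (fst p) + a) * fst (fst p)) (z, w) = 0"
      by (rule ze[OF cl]) (auto intro!: continuous_intros simp: flip_def algebra_simps)
    ultimately have *: "fst z * fst w = 1" "snd w + (fst z * snd z + a) * fst z = 0" by simp_all
    have "fst z \<noteq> 0" using *(1) by auto
    moreover have "fst w = 1 / fst z" using *(1) \<open>fst z \<noteq> 0\<close> by (simp add: field_simps)
    moreover have "snd w = - (fst z * snd z + a) * fst z" using *(2) by algebra
    ultimately show ?thesis by (simp add: flip_def prod_eq_iff)
  qed
  have id_recip: "snd w \<noteq> 0 \<and> z = recip w" if cl: "?cl (\<lambda>p. p) recip z w" for z w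
  proof -
    have "(\<lambda>p. fst (fst p) - fst (snd p)) (z, w) = 0"
      by (rule ze[OF cl]) (auto intro!: continuous_intros simp: recip_def)
    moreover have "(\<lambda>p. snd (fst p) * snd (snd p) - 1) (z, w) = 0"
      by (rule ze[OF cl]) (auto intro!: continuous_intros simp: recip_def dest: g)
    ultimately have *: "fst z = fst w" "snd z * snd w = 1" by simp_all
    then have "snd w \<noteq> 0" by auto
    then show ?thesis using * by (simp add: recip_def prod_eq_iff field_simps)
  qed
  have id_flip_recip: "fst z \<noteq> 0 \<and> snd w \<noteq> 0 \<and> flip a z = recip w"
    if cl: "?cl (\<lambda>p. p) (\<lambda>p. recip (flip a p)) z w" for z w
  proof -
    have "(\<lambda>p. fst (fst p) * fst (snd p) - 1) (z, w) = 0"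
      by (rule ze[OF cl]) (auto intro!: continuous_intros simp: recip_def flip_def dest: g)
    moreover have "(\<lambda>p. (- (fst (fst p) * snd (fst p) + a) * fst (fst p)) * snd (snd p) - 1) (z, w) = 0"
    proof (rule ze[OF cl])
      fix p assume p: "p \<in> generic a"
      define m where "m = fst p * snd p + a"
      have "m \<noteq> 0" "fst p \<noteq> 0" using g p by (auto simp: m_def)
      then show "- (fst (fst (p, recip (flip a p))) * snd (fst (p, recip (flip a p))) + a) *
          fst (fst (p, recip (flip a p))) * snd (snd (p, recip (flip a p))) - 1 = 0"
        by (simp add: recip_def flip_def m_def[symmetric])
    qed (auto intro!: continuous_intros)
    ultimately have *: "fst z * fst w = 1" "(- (fst z * snd z + a) * fst z) * snd w = 1" by simp_all
    then have z: "fst z \<noteq> 0" "snd w \<noteq> 0" by auto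
    moreover have "1 / fst z = fst w" using *(1) z by (simp add: field_simps)
    moreover have "- (fst z * snd z + a) * fst z = 1 / snd w"
      using *(2) z(2) by (simp only: nonzero_eq_divide_eq not_False_eq_True)
    ultimately show ?thesis by (simp add: flip_def recip_def)
  qed
  have s01: "hirz_model a 0 z = hirz_model a (Suc 0) w"
    if "?cl (hirz_coords a 0) (hirz_coords a (Suc 0)) z w" for z w
  proof -
    have "fst z \<noteq> 0" "w = flip a z" using id_flip[of z w] that by (simp_all add: hirz_coords_simps)
    then show ?thesis by (simp add: hirz_model_simps)
  qed
  have s02: "hirz_model a 0 z = hirz_model a 2 w" if "?cl (hirz_coords a 0) (hirz_coords a 2) z w" for z w
    using id_recip[of z w] that by (simp add: hirz_coords_simps hirz_model_simps)
  have s13: "hirz_model a (Suc 0) z = hirz_model a 3 w"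
    if "?cl (hirz_coords a (Suc 0)) (hirz_coords a 3) z w" for z w
    using id_recip[of z w] that limit_pair_flip[of "\<lambda>p. p" recip a]
    by (simp add: hirz_coords_simps hirz_model_simps(4) comp_def)
  have s03: "hirz_model a 0 z = hirz_model a 3 w" if "?cl (hirz_coords a 0) (hirz_coords a 3) z w" for z w
  proof -
    have *: "fst z \<noteq> 0" "snd w \<noteq> 0" "flip a z = recip w"
      using id_flip_recip[of z w] that by (simp_all add: hirz_coords_simps comp_def)
    from *(1) have "hirz_model a 0 z = hirz_model a (Suc 0) (flip a z)"
      by (simp add: hirz_model_simps)
    then show ?thesis using * by (simp add: hirz_model_simps(4))
  qed
  have s12: "hirz_model a (Suc 0) z = hirz_model a 2 w"
    if "?cl (hirz_coords a (Suc 0)) (hirz_coords a 2) z w" for z w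
  proof -
    have "?cl (\<lambda>p. p) (\<lambda>p. recip (flip a p)) z w"
      using that flip2[of "\<lambda>p. p" recip] limit_pair_flip[of "\<lambda>p. p" "\<lambda>p. recip (flip a p)" a]
      by (simp add: hirz_coords_simps)
    then show ?thesis using id_flip_recip[of z w] by (simp add: hirz_model_simps)
  qed
  have s23: "hirz_model a 2 z = hirz_model a 3 w" if cl: "?cl (hirz_coords a 2) (hirz_coords a 3) z w" for z w
  proof -
    have "(\<lambda>p. fst (fst p) * fst (snd p) - 1) (z, w) = 0"
      by (rule ze[OF cl]) (auto intro!: continuous_intros simp: hirz_coords_simps recip_def flip_def dest: g)
    \<comment> \<open>The transition of \<open>hirz_model_mid\<close> without denominators. It shows
      that the last coordinates of \<open>z\<close> and \<open>w\<close> vanish together.\<close>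
    moreover have "(\<lambda>p. snd (snd p) * (fst (fst p) + a * snd (fst p)) * fst (fst p) + snd (fst p)) (z, w) = 0"
    proof (rule ze[OF cl])
      fix p assume p: "p \<in> generic a"
      define m where "m = fst p * snd p + a"
      have "fst p + a / snd p = m / snd p" using g[OF p] by (simp add: m_def field_simps)
      then show "snd (snd (hirz_coords a 2 p, hirz_coords a 3 p)) *
         (fst (fst (hirz_coords a 2 p, hirz_coords a 3 p)) + a * snd (fst (hirz_coords a 2 p, hirz_coords a 3 p))) *
         fst (fst (hirz_coords a 2 p, hirz_coords a 3 p)) + snd (fst (hirz_coords a 2 p, hirz_coords a 3 p)) = 0"
        using g[OF p] by (simp add: hirz_coords_simps recip_def flip_def m_def[symmetric])
    qed (auto intro!: continuous_intros)
    ultimately have *: "fst z * fst w = 1" "snd w * (fst z + a * snd z) * fst z + snd z = 0" by simp_all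
    have "fst z \<noteq> 0" "fst w \<noteq> 0" using *(1) by auto
    then have z: "fst z \<noteq> 0" "fst w \<noteq> 0" "fst z = 1 / fst w" using *(1) by (simp_all add: nonzero_eq_divide_eq)
    show ?thesis
    proof (cases "snd z = 0")
      case True
      then have "snd w = 0" using *(2) z by simp
      then show ?thesis using True z by (simp add: hirz_model_simps prod_eq_iff)
    next
      case False
      then have w: "snd w \<noteq> 0" using *(2) by auto
      \<comment> \<open>The method \<open>algebra\<close> then treats the inverse as a variable
        bound by \<open>t * snd z = 1\<close>, so no division occurs.\<close>
      define t where "t = 1 / snd z"
      have "t * snd z = 1" using False by (simp add: t_def)
      then have "snd w * (- (fst z * t + a) * fst z) * snd z = snd z"
        using *(2) by algebra
      then have "snd w * (- (fst z * (1 / snd z) + a) * fst z) * snd z = snd z"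
        unfolding t_def .
      then have "snd w * (- (fst z * (1 / snd z) + a) * fst z) = 1" using False by simp
      then have "1 / snd w = - (fst z * (1 / snd z) + a) * fst z" by (rule one_divide_eqI)
      moreover have "1 / fst z = fst w" using z by simp
      ultimately have "flip a (recip z) = recip w"
        by (simp add: flip_def recip_def)
      moreover have "fst (recip z) \<noteq> 0" using z by (simp add: recip_def)
      ultimately have "flip a (recip w) = recip z" by (metis flip_flip)
      then show ?thesis using False w z by (simp add: hirz_model_simps)
    qed
  qed
  have diag: "hirz_model a i z = hirz_model a i w" if "?cl (hirz_coords a i) (hirz_coords a i) z w" for i z w
    using limit_pair_same[OF that] by simp
  show ?thesis
    by (rule le_3_cases[OF ij(1)]; rule le_3_cases[OF ij(2)]; insert cl; hypsubst;
        (erule diag s01 s02 s03 s12 s13 s23 |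
          rule s01[symmetric] s02[symmetric] s03[symmetric] s12[symmetric] s13[symmetric] s23[symmetric],
          erule limit_pair_swap))
qed

global_interpretation hirz: plane_model "{0..3}" "hirz_coords a" "generic a" "hirz_model a 0" "hirz_model a" for a
proof
  show "open (generic a)" "closure (generic a) = UNIV" by (rule open_generic dense_generic)+
  fix i :: nat assume i: "i \<in> {0..3}"
  show "inj (hirz_model a i)" using i by (rule inj_hirz_model)
  show "continuous_on (generic a) (hirz_coords a i)"
    using i
    by (cases rule: le_3_cases) (simp_all add: hirz_coords_simps continuous_on_flip continuous_on_recip
       continuous_on_recip_flip del: comp_apply o_apply)
  show "closure (hirz_coords a i ` generic a) = UNIV"
    using i
    by (cases rule: le_3_cases)
      (simp_all only: hirz_coords_simps flip_image_generic dense_recip dense_generic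
        image_comp[symmetric] image_ident)
  show "hirz_model a i (hirz_coords a i z) = hirz_model a 0 z" if "z \<in> generic a" for z
    using i
  proof (cases rule: le_3_cases)
    case 4
    have "flip a z \<in> generic a" using that by (rule flip_generic)
    then show ?thesis using that unfolding 4
      by (simp add: hirz_coords_simps hirz_model_simps generic_def)
  qed (use that in \<open>auto simp: hirz_coords_simps hirz_model_simps generic_def\<close>)
next
  fix i j z w assume "i \<in> {0..3::nat}" "j \<in> {0..3::nat}" "hirz_model a i z = hirz_model a j w"
  then show "\<exists>N h. open N \<and> z \<in> N \<and> holo_on h N \<and> (\<forall>c\<in>N. hirz_model a j (h c) = hirz_model a i c)"
    using hirz_transition[of i j a z w] unfolding local_transition_def by blast
next
  fix i j z w assume "i \<in> {0..3::nat}" "j \<in> {0..3::nat}"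
    "(z, w) \<in> closure ((\<lambda>z. (hirz_coords a i z, hirz_coords a j z)) ` generic a)"
  then show "hirz_model a i z = hirz_model a j w" by (rule hirz_separated)
qed

section \<open>The topology generated by the charts\<close>

lemma topspace_surface_topology: "topspace (surface_topology X) = (\<Union>A\<in>atlas X. fst A)"
proof -
  have "\<Union> {U \<inter> \<phi> -` N |U \<phi> N. (U, \<phi>) \<in> atlas X \<and> open N} = (\<Union>A\<in>atlas X. fst A)" (is "\<Union> ?B = _")
  proof
    show "(\<Union>A\<in>atlas X. fst A) \<subseteq> \<Union> ?B"
    proof
      fix x assume "x \<in> (\<Union>A\<in>atlas X. fst A)"
      then obtain U \<phi> where U: "(U, \<phi>) \<in> atlas X" "x \<in> U" by force
      then have "U \<inter> \<phi> -` UNIV \<in> ?B" using open_UNIV by blast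
      then show "x \<in> \<Union> ?B" using U(2) by blast
    qed
  qed force
  then show ?thesis unfolding surface_topology_def topology_generated_by_topspace .
qed

lemma not_in_surface_closure:
  assumes "A \<in> atlas X" "x \<in> fst A" "fst A \<inter> S = {}"
  shows "x \<notin> surface_topology X closure_of S"
proof -
  obtain U \<phi> where A: "A = (U, \<phi>)" by fastforce
  have "U \<inter> \<phi> -` UNIV \<in> {U \<inter> \<phi> -` N |U \<phi> N. (U, \<phi>) \<in> atlas X \<and> open N}"
    using assms(1) A open_UNIV by blast
  then have "openin (surface_topology X) (U \<inter> \<phi> -` UNIV)"
    unfolding surface_topology_def by (rule topology_generated_by_Basis)
  then have "openin (surface_topology X) (fst A)" by (simp add: A)
  then show ?thesis using assms(2,3) unfolding in_closure_of by blast
qed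

text \<open>The topology is given by a subbasis, so the path is followed by induction over the
  generation of an open set: entering it eventually is preserved by finite intersections and by
  unions. For the subbasis, convergence is required in every chart around \<open>x\<close>.\<close>

lemma in_surface_closureI:
  fixes \<gamma> :: "complex \<Rightarrow> 'a"
  assumes x: "x \<in> (\<Union>A\<in>atlas X. fst A)"
    and S: "eventually (\<lambda>t. \<gamma> t \<in> S) (at 0)"
    and A: "\<And>A. A \<in> atlas X \<Longrightarrow> x \<in> fst A \<Longrightarrow>
      eventually (\<lambda>t. \<gamma> t \<in> fst A) (at 0) \<and> ((\<lambda>t. snd A (\<gamma> t)) \<longlongrightarrow> snd A x) (at 0)"
  shows "x \<in> surface_topology X closure_of S"
  unfolding in_closure_of
proof (intro conjI allI impI)
  show "x \<in> topspace (surface_topology X)" using x unfolding topspace_surface_topology .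
  fix T assume T: "x \<in> T \<and> openin (surface_topology X) T"
  then have "generate_topology_on {U \<inter> \<phi> -` N |U \<phi> N. (U, \<phi>) \<in> atlas X \<and> open N} T"
    unfolding surface_topology_def openin_topology_generated_by_iff by blast
  then have "x \<in> T \<Longrightarrow> eventually (\<lambda>t. \<gamma> t \<in> T) (at 0)"
  proof induction
    case (Basis T)
    then obtain U \<phi> N where T: "T = U \<inter> \<phi> -` N" "(U, \<phi>) \<in> atlas X" "open N" by blast
    then have *: "eventually (\<lambda>t. \<gamma> t \<in> U) (at 0)" "((\<lambda>t. \<phi> (\<gamma> t)) \<longlongrightarrow> \<phi> x) (at 0)"
      using A[OF T(2)] Basis(2) by auto
    have "eventually (\<lambda>t. \<phi> (\<gamma> t) \<in> N) (at 0)"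
      using topological_tendstoD[OF *(2) T(3)] Basis(2) T(1) by blast
    with *(1) show ?case unfolding T(1) by eventually_elim simp
  next
    case (Int S T)
    then have "eventually (\<lambda>t. \<gamma> t \<in> S) (at 0)" "eventually (\<lambda>t. \<gamma> t \<in> T) (at 0)" by blast+
    then show ?case by eventually_elim simp
  next
    case (UN K)
    then obtain k where "k \<in> K" "x \<in> k" by blast
    then have "eventually (\<lambda>t. \<gamma> t \<in> k) (at 0)" using UN by blast
    then show ?case by eventually_elim (use \<open>k \<in> K\<close> in blast)
  qed simp
  then have "eventually (\<lambda>t. \<gamma> t \<in> T) (at 0)" using T by blast
  with S have "eventually (\<lambda>t. \<gamma> t \<in> S \<and> \<gamma> t \<in> T) (at 0)" by (rule eventually_conj)
  then have "\<exists>t. \<gamma> t \<in> S \<and> \<gamma> t \<in> T" by (rule eventually_happens'[rotated]) simp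
  then show "\<exists>y. y \<in> S \<and> y \<in> T" by blast
qed

lemma subset_surface_closure:
  assumes "S \<subseteq> (\<Union>A\<in>atlas X. fst A)"
  shows "S \<subseteq> surface_topology X closure_of S"
  by (rule closure_of_subset) (simp only: topspace_surface_topology assms)


section \<open>The Hirzebruch surface and its blow-ups\<close>

lemma hirz_pt_eq_iff:
  "i \<in> {0..3} \<Longrightarrow> j \<in> {0..3} \<Longrightarrow> hirz_pt a i z = hirz_pt a j w \<longleftrightarrow> hirz_model a i z = hirz_model a j w"
  unfolding hirz_pt_def by (rule hirz.glue_point_eq_iff)

lemma fst_hirz_chart: "fst (hirz_chart a i) = range (hirz_pt a i)"
  unfolding hirz_chart_def hirz_pt_def glue_chart_def by simp

lemma snd_hirz_chart: "i \<in> {0..3} \<Longrightarrow> snd (hirz_chart a i) (hirz_pt a i z) = z"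
  unfolding hirz_chart_def hirz_pt_def by (rule hirz.glue_chart_point)

lemma atlas_hirz: "atlas (hirz a) = hirz_chart a ` {0..3}"
  unfolding hirz_def glue_def hirz_chart_def by simp

lemma points_hirz: "points (hirz a) = (\<Union>i\<in>{0..3}. range (hirz_pt a i))"
  unfolding hirz_def glue_def hirz_pt_def by simp

lemma complex_surface_hirz: "complex_surface (hirz a)"
  unfolding hirz_def by (rule hirz.complex_surface_glue)

lemma hirz_pt_recip:
  assumes "snd z \<noteq> 0"
  shows "hirz_pt a 2 z = hirz_pt a 0 (recip z)" "hirz_pt a 3 z = hirz_pt a 1 (recip z)"
  using assms by (simp_all add: hirz_pt_eq_iff hirz_model_simps)

lemma hirz_pt_flip: "fst z \<noteq> 0 \<Longrightarrow> hirz_pt a 1 z = hirz_pt a 0 (flip a z)"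
  by (simp add: hirz_pt_eq_iff hirz_model_simps)

text \<open>The label of the normal form detects the section at infinity independently of the plane
  in which the point is given.\<close>

lemma infinity_label: "i \<in> {0..3} \<Longrightarrow> fst (hirz_model a i z) \<ge> 2 \<longleftrightarrow> i \<ge> 2 \<and> snd z = 0"
  by (erule le_3_cases) (simp_all add: hirz_model_simps)

lemma D_section_label:
  assumes "i \<in> {0..3}"
  shows "hirz_pt a i z \<in> D_section a \<longleftrightarrow> i \<ge> 2 \<and> snd z = 0"
proof
  assume "hirz_pt a i z \<in> D_section a"
  then obtain j w where "j \<in> {2, 3}" "hirz_pt a i z = hirz_pt a j (w, 0)"
    unfolding D_section_def by auto
  then have "j \<in> {2, 3}" "hirz_model a i z = hirz_model a j (w, 0)"
    using assms by (auto simp: hirz_pt_eq_iff)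
  then show "i \<ge> 2 \<and> snd z = 0"
    using infinity_label[OF assms, of a z] infinity_label[of j a "(w, 0)"] by auto
next
  assume *: "i \<ge> 2 \<and> snd z = 0"
  then obtain x where "z = (x, 0)" by (cases z) simp
  moreover have "i = 2 \<or> i = 3" using * assms by auto
  ultimately show "hirz_pt a i z \<in> D_section a" unfolding D_section_def by blast
qed

definition centre_plane :: "complex option \<Rightarrow> nat" where
  "centre_plane \<nu> = (case \<nu> of Some _ \<Rightarrow> 2 | None \<Rightarrow> 3)"

definition centre_coord :: "complex option \<Rightarrow> complex" where
  "centre_coord \<nu> = (case \<nu> of Some c \<Rightarrow> c | None \<Rightarrow> 0)"

lemma centre_plane_range [simp]: "centre_plane \<nu> \<in> {0..3}" "centre_plane \<nu> \<le> 3" "2 \<le> centre_plane \<nu>"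
  by (auto simp: centre_plane_def split: option.split)

lemma first_centre_eq: "first_centre a \<nu> = hirz_pt a (centre_plane \<nu>) (centre_coord \<nu>, 0)"
  by (cases \<nu>) (simp_all add: first_centre_def centre_plane_def centre_coord_def)

lemma first_chart_eq: "first_chart a \<nu> = hirz_chart a (centre_plane \<nu>)"
  by (cases \<nu>) (simp_all add: first_chart_def centre_plane_def)

text \<open>Proved for all indices and not just three, because
  \<open>first_centre a (Some t)\<close> runs through the finite part of the section at infinity,
  and a path along it has to avoid the centres.\<close>

lemma inj_first_centre: "inj (first_centre a)"
proof (rule injI)
  fix \<nu> \<mu> assume "first_centre a \<nu> = first_centre a \<mu>"
  then have "hirz_model a (centre_plane \<nu>) (centre_coord \<nu>, 0) = hirz_model a (centre_plane \<mu>) (centre_coord \<mu>, 0)"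
    unfolding first_centre_eq by (simp add: hirz_pt_eq_iff)
  then show "\<nu> = \<mu>"
    by (cases \<nu>; cases \<mu>) (simp_all add: centre_plane_def centre_coord_def hirz_model_simps)
qed

definition first_index :: "complex option set" where
  "first_index = {Some 0, Some 1, None}"

lemma fst_first_centres: "fst ` first_centres a = first_centre a ` first_index"
  unfolding first_centres_def first_index_def image_image by simp

lemma complex_surface_X1: "complex_surface (X1 a)"
  unfolding X1_def
proof (rule complex_surface_blow_up[OF complex_surface_hirz])
  show "finite (first_centres a)" unfolding first_centres_def by simp
  fix c k assume "(c, k) \<in> first_centres a"
  then obtain \<nu> where k: "c = first_centre a \<nu>" "k = first_chart a \<nu>"
    unfolding first_centres_def by blast
  have "k \<in> atlas (hirz a)" unfolding k first_chart_eq atlas_hirz using centre_plane_range(1) by blast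
  moreover have "c \<in> fst k" unfolding k first_chart_eq first_centre_eq fst_hirz_chart by blast
  ultimately show "k \<in> atlas (hirz a) \<and> c \<in> fst k" ..
  fix k' assume "(c, k') \<in> first_centres a"
  then obtain \<mu> where "c = first_centre a \<mu>" "k' = first_chart a \<mu>"
    unfolding first_centres_def by blast
  then show "k = k'" using k injD[OF inj_first_centre] by metis
qed

lemma uv_pt_eq_iff: "uv_pt a \<nu> c = uv_pt a \<mu> d \<longleftrightarrow> \<nu> = \<mu> \<and> c = d"
  unfolding uv_pt_def using injD[OF inj_first_centre] by auto

definition second_index :: "(nat \<Rightarrow> complex) \<Rightarrow> (complex option \<times> complex) set" where
  "second_index \<alpha> = {(Some 0, \<alpha> 1 + \<alpha> 2), (Some 0, \<alpha> 2), (Some 1, \<alpha> 3 + \<alpha> 4), (Some 1, \<alpha> 4),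
     (None, \<alpha> 5), (None, \<alpha> 5 + \<alpha> 6)}"

lemma second_centres_eq:
  "second_centres \<alpha> = (\<lambda>(\<nu>, c). (uv_pt (\<alpha> 0) \<nu> c, uv_chart (\<alpha> 0) \<nu>)) ` second_index \<alpha>"
  unfolding second_centres_def second_index_def ..

lemma second_centresI:
  "(\<nu>, c) \<in> second_index \<alpha> \<Longrightarrow> (uv_pt (\<alpha> 0) \<nu> c, uv_chart (\<alpha> 0) \<nu>) \<in> second_centres \<alpha>"
  unfolding second_centres_eq by (rule image_eqI[of _ _ "(\<nu>, c)"]) simp_all

lemma second_centresE:
  assumes "(x, k) \<in> second_centres \<alpha>"
  obtains \<nu> c where "(\<nu>, c) \<in> second_index \<alpha>" "x = uv_pt (\<alpha> 0) \<nu> c" "k = uv_chart (\<alpha> 0) \<nu>"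
proof -
  obtain i where "i \<in> second_index \<alpha>" "(x, k) = (case i of (\<nu>, c) \<Rightarrow> (uv_pt (\<alpha> 0) \<nu> c, uv_chart (\<alpha> 0) \<nu>))"
    using assms unfolding second_centres_eq by blast
  then show ?thesis using that[of "fst i" "snd i"] by (simp add: case_prod_beta)
qed

lemma finite_second_centres: "finite (second_centres \<alpha>)"
  unfolding second_centres_def by simp

lemma second_index_first: "(\<nu>, c) \<in> second_index \<alpha> \<Longrightarrow> \<nu> \<in> first_index"
  unfolding second_index_def first_index_def by auto

lemma fst_second_centresE:
  assumes "x \<in> fst ` second_centres \<alpha>"
  obtains \<nu> c where "(\<nu>, c) \<in> second_index \<alpha>" "x = uv_pt (\<alpha> 0) \<nu> c"
proof -
  obtain i where i: "i \<in> second_centres \<alpha>" "x = fst i" using assms by blast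
  then have "(x, snd i) \<in> second_centres \<alpha>" by simp
  then show ?thesis using that by (elim second_centresE) simp
qed

lemma fst_second_centres_iff:
  "uv_pt (\<alpha> 0) \<nu> c \<in> fst ` second_centres \<alpha> \<longleftrightarrow> (\<nu>, c) \<in> second_index \<alpha>"
proof
  assume "uv_pt (\<alpha> 0) \<nu> c \<in> fst ` second_centres \<alpha>"
  then show "(\<nu>, c) \<in> second_index \<alpha>" by (rule fst_second_centresE) (simp add: uv_pt_eq_iff)
next
  assume "(\<nu>, c) \<in> second_index \<alpha>"
  then show "uv_pt (\<alpha> 0) \<nu> c \<in> fst ` second_centres \<alpha>"
    by (rule image_eqI[OF _ second_centresI, rotated]) simp
qed

lemma Off_notin_second_centres: "Off x \<notin> fst ` second_centres \<alpha>"
proof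
  assume "Off x \<in> fst ` second_centres \<alpha>"
  then show False by (rule fst_second_centresE) (simp add: uv_pt_def)
qed

lemma None_notin_second_centres: "Exc x None \<notin> fst ` second_centres \<alpha>"
proof
  assume "Exc x None \<in> fst ` second_centres \<alpha>"
  then show False by (rule fst_second_centresE) (simp add: uv_pt_def)
qed

lemma uv_chart_in_atlas: "\<nu> \<in> first_index \<Longrightarrow> uv_chart a \<nu> \<in> atlas (X1 a)"
  unfolding X1_def blow_up_atlas uv_chart_def first_centres_def first_index_def by force

lemma complex_surface_X2: "complex_surface (X2 \<alpha>)"
  unfolding X2_def
proof (rule complex_surface_blow_up[OF complex_surface_X1 finite_second_centres])
  fix x k assume "(x, k) \<in> second_centres \<alpha>"
  then obtain \<nu> c where k: "(\<nu>, c) \<in> second_index \<alpha>" "x = uv_pt (\<alpha> 0) \<nu> c" "k = uv_chart (\<alpha> 0) \<nu>"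
    by (rule second_centresE)
  have "k \<in> atlas (X1 (\<alpha> 0))" unfolding k(3)
    by (rule uv_chart_in_atlas[OF second_index_first[OF k(1)]])
  moreover have "x \<in> fst k" unfolding k(2,3) uv_pt_def uv_chart_def by simp
  ultimately show "k \<in> atlas (X1 (\<alpha> 0)) \<and> x \<in> fst k" ..
  fix k' assume "(x, k') \<in> second_centres \<alpha>"
  then obtain \<mu> d where k': "x = uv_pt (\<alpha> 0) \<mu> d" "k' = uv_chart (\<alpha> 0) \<mu>"
    by (rule second_centresE)
  then show "k = k'" using k by (simp add: uv_pt_eq_iff)
qed

text \<open>Every centre lies on the section at infinity, so planes 0 and 1 are untouched by the
  first blow-up.\<close>

lemma first_centre_label:
  assumes "i \<in> {0..3}" "hirz_pt a i z \<in> fst ` first_centres a"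
  shows "i \<ge> 2 \<and> snd z = 0"
proof -
  obtain \<nu> where "hirz_pt a i z = first_centre a \<nu>"
    using assms(2) unfolding fst_first_centres by blast
  moreover have "first_centre a \<nu> \<in> D_section a"
    unfolding first_centre_eq D_section_label[OF centre_plane_range(1)] by simp
  ultimately show ?thesis using D_section_label[OF assms(1)] by metis
qed

section \<open>The eight planes\<close>

lemma uv_chart_Off:
  assumes "snd z \<noteq> 0"
  shows "Off (hirz_pt a (centre_plane \<nu>) z) \<in> fst (uv_chart a \<nu>)"
    and "snd (uv_chart a \<nu>) (Off (hirz_pt a (centre_plane \<nu>) z)) = ((fst z - centre_coord \<nu>) / snd z, snd z)"
proof -
  have 1: "snd (hirz_chart a (centre_plane \<nu>)) (hirz_pt a (centre_plane \<nu>) w) = w" for w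
    by (rule snd_hirz_chart) simp
  show "snd (uv_chart a \<nu>) (Off (hirz_pt a (centre_plane \<nu>) z)) = ((fst z - centre_coord \<nu>) / snd z, snd z)"
    unfolding uv_chart_def first_chart_eq first_centre_eq by (simp add: 1)
  have "hirz_pt a (centre_plane \<nu>) z \<notin> fst ` first_centres a"
    using first_centre_label[OF centre_plane_range(1)] assms by blast
  then show "Off (hirz_pt a (centre_plane \<nu>) z) \<in> fst (uv_chart a \<nu>)"
    unfolding uv_chart_def first_chart_eq first_centre_eq using assms by (simp add: 1 fst_hirz_chart)
qed

lemma uv_chart_OffE:
  assumes "Off h \<in> fst (uv_chart a \<nu>)"
  obtains z where "snd z \<noteq> 0" "h = hirz_pt a (centre_plane \<nu>) z"
proof -
  have 1: "snd (hirz_chart a (centre_plane \<nu>)) (hirz_pt a (centre_plane \<nu>) w) = w" for w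
    by (rule snd_hirz_chart) simp
  have "h \<in> range (hirz_pt a (centre_plane \<nu>))"
    using assms unfolding uv_chart_def first_chart_eq fst_hirz_chart[symmetric] by simp
  then obtain z where z: "h = hirz_pt a (centre_plane \<nu>) z" by blast
  then have "snd z \<noteq> 0"
    using assms unfolding uv_chart_def first_chart_eq first_centre_eq by (simp add: 1)
  then show ?thesis using that z by blast
qed

lemma uv_chart_uv_pt: "snd (uv_chart a \<nu>) (uv_pt a \<nu> c) = (c, 0)"
  unfolding uv_chart_def uv_pt_def by simp

definition base_pt :: "complex \<Rightarrow> nat \<Rightarrow> c2 \<Rightarrow> hirz_point blown blown" where
  "base_pt a j z = Off (Off (hirz_pt a j z))"

definition base_chart :: "(nat \<Rightarrow> complex) \<Rightarrow> nat \<Rightarrow> hirz_point blown blown chart" where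
  "base_chart \<alpha> j =
     off_chart (fst ` second_centres \<alpha>) (off_chart (fst ` first_centres (\<alpha> 0)) (hirz_chart (\<alpha> 0) j))"

text \<open>Expresses \<open>(z\<^sub>2, w\<^sub>2)\<close> or \<open>(z\<^sub>3, w\<^sub>3)\<close> through \<open>(x\<^sub>j, y\<^sub>j)\<close>.\<close>
definition blow_map :: "complex \<Rightarrow> complex \<Rightarrow> c2 \<Rightarrow> c2" where
  "blow_map c \<beta> z = (c + (\<beta> - fst z * snd z) * snd z, snd z)"

definition unblow_map :: "complex \<Rightarrow> complex \<Rightarrow> c2 \<Rightarrow> c2" where
  "unblow_map c \<beta> z = (- ((fst z - c) * snd z - \<beta>) * snd z, 1 / snd z)"

text \<open>The line \<open>snd z = 0\<close> parametrises the second exceptional curve without its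
  direction \<open>None\<close>. The direction is \<open>- fst z\<close> because the blow-up
  coordinate is the negative of \<open>x_j\<close>.\<close>

definition exc_pt :: "complex \<Rightarrow> complex option \<Rightarrow> complex \<Rightarrow> c2 \<Rightarrow> hirz_point blown blown" where
  "exc_pt a \<nu> \<beta> z =
     (if snd z = 0 then Exc (uv_pt a \<nu> \<beta>) (Some (- fst z))
      else base_pt a (centre_plane \<nu>) (blow_map (centre_coord \<nu>) \<beta> z))"

definition exc_chart :: "(nat \<Rightarrow> complex) \<Rightarrow> complex option \<Rightarrow> complex \<Rightarrow> hirz_point blown blown chart" where
  "exc_chart \<alpha> \<nu> \<beta> = blow_chart1 (fst ` second_centres \<alpha>) (uv_pt (\<alpha> 0) \<nu> \<beta>) (uv_chart (\<alpha> 0) \<nu>)"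

lemma base_chart_pt:
  assumes "j \<le> 1"
  shows "base_pt (\<alpha> 0) j z \<in> fst (base_chart \<alpha> j)" "snd (base_chart \<alpha> j) (base_pt (\<alpha> 0) j z) = z"
proof -
  have j: "j \<in> {0..3}" using assms by simp
  have "hirz_pt (\<alpha> 0) j z \<notin> fst ` first_centres (\<alpha> 0)"
    using first_centre_label[OF j] assms by fastforce
  then show "base_pt (\<alpha> 0) j z \<in> fst (base_chart \<alpha> j)"
    unfolding base_pt_def base_chart_def by (simp add: Off_notin_second_centres fst_hirz_chart)
  show "snd (base_chart \<alpha> j) (base_pt (\<alpha> 0) j z) = z"
    unfolding base_pt_def base_chart_def by (simp add: snd_hirz_chart[OF j])
qed

lemma base_chart_range:
  assumes "j \<le> 1" shows "fst (base_chart \<alpha> j) = range (base_pt (\<alpha> 0) j)"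
proof
  show "fst (base_chart \<alpha> j) \<subseteq> range (base_pt (\<alpha> 0) j)"
    unfolding base_chart_def off_chart_def base_pt_def fst_conv fst_hirz_chart by blast
  show "range (base_pt (\<alpha> 0) j) \<subseteq> fst (base_chart \<alpha> j)"
    using base_chart_pt(1)[OF assms] by blast
qed

text \<open>At the image of \<open>blow_map\<close> the coordinates of the first blow-up are
  \<open>u = \<beta> - x y\<close> and \<open>v = y\<close>, whence
  \<open>(u - \<beta>) / v = - x\<close>.\<close>

lemma exc_chart_pt:
  "exc_pt (\<alpha> 0) \<nu> \<beta> z \<in> fst (exc_chart \<alpha> \<nu> \<beta>)"
  "snd (exc_chart \<alpha> \<nu> \<beta>) (exc_pt (\<alpha> 0) \<nu> \<beta> z) = (- fst z, snd z)"
proof -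
  have "exc_pt (\<alpha> 0) \<nu> \<beta> z \<in> fst (exc_chart \<alpha> \<nu> \<beta>) \<and>
    snd (exc_chart \<alpha> \<nu> \<beta>) (exc_pt (\<alpha> 0) \<nu> \<beta> z) = (- fst z, snd z)"
  proof (cases "snd z = 0")
    case True
    then show ?thesis by (simp add: exc_pt_def exc_chart_def)
  next
    case False
    let ?w = "blow_map (centre_coord \<nu>) \<beta> z"
    have w: "snd ?w \<noteq> 0" using False by (simp add: blow_map_def)
    have "(fst ?w - centre_coord \<nu>) / snd ?w = \<beta> - fst z * snd z" using False by (simp add: blow_map_def)
    then have "snd (uv_chart (\<alpha> 0) \<nu>) (Off (hirz_pt (\<alpha> 0) (centre_plane \<nu>) ?w)) = (\<beta> - fst z * snd z, snd z)"
      using uv_chart_Off(2)[OF w, of "\<alpha> 0" \<nu>] by (simp add: blow_map_def)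
    then show ?thesis
      using False uv_chart_Off(1)[OF w, of "\<alpha> 0" \<nu>]
      by (simp add: exc_pt_def exc_chart_def base_pt_def uv_chart_uv_pt Off_notin_second_centres)
  qed
  then show "exc_pt (\<alpha> 0) \<nu> \<beta> z \<in> fst (exc_chart \<alpha> \<nu> \<beta>)"
    "snd (exc_chart \<alpha> \<nu> \<beta>) (exc_pt (\<alpha> 0) \<nu> \<beta> z) = (- fst z, snd z)" by blast+
qed

lemma exc_chart_cases:
  assumes "y \<in> fst (exc_chart \<alpha> \<nu> \<beta>)"
  obtains s where "y = Exc (uv_pt (\<alpha> 0) \<nu> \<beta>) (Some s)"
  | z where "snd z \<noteq> 0" "y = base_pt (\<alpha> 0) (centre_plane \<nu>) z"
proof (cases y)
  case (Exc d s)
  then have "d = uv_pt (\<alpha> 0) \<nu> \<beta>" "s \<noteq> None" using assms by (simp_all add: exc_chart_def)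
  then show ?thesis using that(1) Exc by (cases s) simp_all
next
  case (Off x)
  then have x: "x \<in> fst (uv_chart (\<alpha> 0) \<nu>)" "snd (snd (uv_chart (\<alpha> 0) \<nu>) x) \<noteq> 0"
    using assms by (simp_all add: exc_chart_def uv_chart_uv_pt)
  show ?thesis
  proof (cases x)
    \<comment> \<open>A point of the first exceptional curve has \<open>v = 0\<close>, which this
      chart of the second blow-up excludes.\<close>
    case (Exc d s)
    then show ?thesis using x unfolding uv_chart_def by (cases s) simp_all
  next
    case (Off h)
    obtain z where "snd z \<noteq> 0" "h = hirz_pt (\<alpha> 0) (centre_plane \<nu>) z"
      using x(1) unfolding Off by (rule uv_chart_OffE)
    then show ?thesis using that(2) \<open>y = Off x\<close> Off unfolding base_pt_def by blast
  qed
qed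

lemma exc_chart_range: "fst (exc_chart \<alpha> \<nu> \<beta>) = range (exc_pt (\<alpha> 0) \<nu> \<beta>)"
proof
  show "range (exc_pt (\<alpha> 0) \<nu> \<beta>) \<subseteq> fst (exc_chart \<alpha> \<nu> \<beta>)" using exc_chart_pt(1) by blast
  show "fst (exc_chart \<alpha> \<nu> \<beta>) \<subseteq> range (exc_pt (\<alpha> 0) \<nu> \<beta>)"
  proof
    fix y assume "y \<in> fst (exc_chart \<alpha> \<nu> \<beta>)"
    then show "y \<in> range (exc_pt (\<alpha> 0) \<nu> \<beta>)"
    proof (cases rule: exc_chart_cases)
      case (1 s)
      then have "y = exc_pt (\<alpha> 0) \<nu> \<beta> (- s, 0)" by (simp add: exc_pt_def)
      then show ?thesis by blast
    next
      case (2 z)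
      let ?x = "(\<beta> - (fst z - centre_coord \<nu>) / snd z) / snd z"
      have "blow_map (centre_coord \<nu>) \<beta> (?x, snd z) = z" using 2(1) by (simp add: blow_map_def prod_eq_iff)
      then have "y = exc_pt (\<alpha> 0) \<nu> \<beta> (?x, snd z)" using 2 by (simp add: exc_pt_def)
      then show ?thesis by blast
    qed
  qed
qed

text \<open>For special parameters two indices name the same centre, as 1 and 2 do if
  \<open>\<alpha> 1 = 0\<close>; the two planes then coincide.\<close>

definition plane_centre :: "(nat \<Rightarrow> complex) \<Rightarrow> nat \<Rightarrow> complex option \<times> complex" where
  "plane_centre \<alpha> j =
     (if j = 1 then (Some 0, \<alpha> 1 + \<alpha> 2) else if j = 2 then (Some 0, \<alpha> 2)
      else if j = 3 then (Some 1, \<alpha> 3 + \<alpha> 4) else if j = 4 then (Some 1, \<alpha> 4)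
      else if j = 5 then (None, \<alpha> 5) else (None, \<alpha> 5 + \<alpha> 6))"

lemma second_index_eq: "second_index \<alpha> = plane_centre \<alpha> ` {1..6}"
proof -
  have "{1..6} = {1, 2, 3, 4, 5, 6::nat}" by auto
  then show ?thesis unfolding second_index_def plane_centre_def by (simp add: insert_commute)
qed

lemma plane_index_cases:
  assumes "i \<in> plane_index"
  obtains "i = None" | "i = Some 0" | j where "j \<in> {1..6}" "i = Some j"
proof (cases i)
  case (Some j)
  then have "j \<le> 6" using assms by (auto simp: plane_index_def)
  then show ?thesis using that(2,3) Some by (cases "j = 0") simp_all
qed (use that in simp)

definition plane_pt :: "(nat \<Rightarrow> complex) \<Rightarrow> nat option \<Rightarrow> c2 \<Rightarrow> hirz_point blown blown" where
  "plane_pt \<alpha> i = (case i of None \<Rightarrow> base_pt (\<alpha> 0) 0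
     | Some j \<Rightarrow> if j = 0 then base_pt (\<alpha> 0) 1 else case_prod (exc_pt (\<alpha> 0)) (plane_centre \<alpha> j))"

definition plane_chart :: "(nat \<Rightarrow> complex) \<Rightarrow> nat option \<Rightarrow> hirz_point blown blown chart" where
  "plane_chart \<alpha> i = (case i of None \<Rightarrow> base_chart \<alpha> 0
     | Some j \<Rightarrow> if j = 0 then base_chart \<alpha> 1 else case_prod (exc_chart \<alpha>) (plane_centre \<alpha> j))"

text \<open>The map from \<open>(q, p)\<close> to \<open>((q p - b) p, 1 / p)\<close>, which the
  blow-up charts produce, has Jacobian determinant -1. The minus sign in \<open>x_j\<close> makes it
  symplectic and has to be undone here.\<close>

definition plane_sign :: "nat option \<Rightarrow> c2 \<Rightarrow> c2" where
  "plane_sign i z = (if i \<in> {None, Some 0} then z else (- fst z, snd z))"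

lemma plane_sign_involution [simp]: "plane_sign i (plane_sign i z) = z"
  by (simp add: plane_sign_def)

lemma plane_chart_range: "i \<in> plane_index \<Longrightarrow> fst (plane_chart \<alpha> i) = range (plane_pt \<alpha> i)"
  by (erule plane_index_cases)
    (simp_all add: plane_chart_def plane_pt_def base_chart_range exc_chart_range case_prod_beta)

lemma plane_chart_pt: "i \<in> plane_index \<Longrightarrow> snd (plane_chart \<alpha> i) (plane_pt \<alpha> i z) = plane_sign i z"
  by (erule plane_index_cases)
    (simp_all add: plane_chart_def plane_pt_def base_chart_pt exc_chart_pt case_prod_beta plane_sign_def)

lemma plane_chart_in_atlas:
  assumes "i \<in> plane_index" shows "plane_chart \<alpha> i \<in> atlas (X2 \<alpha>)"
proof -
  have base: "base_chart \<alpha> j \<in> atlas (X2 \<alpha>)" if "j \<le> 1" for j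
    unfolding base_chart_def X2_def X1_def blow_up_atlas atlas_hirz using that by simp
  show ?thesis
    using assms
  proof (cases rule: plane_index_cases)
    case (3 j)
    then have "plane_centre \<alpha> j \<in> second_index \<alpha>" unfolding second_index_eq by blast
    then have "(uv_pt (\<alpha> 0) (fst (plane_centre \<alpha> j)) (snd (plane_centre \<alpha> j)),
        uv_chart (\<alpha> 0) (fst (plane_centre \<alpha> j))) \<in> second_centres \<alpha>"
      by (intro second_centresI) simp
    then show ?thesis using 3 unfolding plane_chart_def exc_chart_def X2_def blow_up_atlas
      by (force simp: case_prod_beta)
  qed (simp_all add: plane_chart_def base)
qed

lemma inj_plane_pt: "i \<in> plane_index \<Longrightarrow> inj (plane_pt \<alpha> i)"
  by (rule injI) (metis plane_chart_pt plane_sign_involution)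

lemma holo_on_plane_sign: "holo_on (plane_sign i) N"
  unfolding plane_sign_def[abs_def]
  by (cases "i \<in> {None, Some 0}") (auto intro!: holo_on_id holo_on_PairI simp del: insert_iff)

lemma open_vimage_plane_sign: "open N \<Longrightarrow> open (plane_sign i -` N)"
  by (rule open_vimage[OF _ holo_on_imp_continuous_on[OF holo_on_plane_sign]])

text \<open>Inherited from the blown-up surface: up to sign both planes are charts of its
  atlas.\<close>

lemma plane_transition:
  assumes ij: "i \<in> plane_index" "j \<in> plane_index" and eq: "plane_pt \<alpha> i z = plane_pt \<alpha> j w"
  shows "local_transition (plane_pt \<alpha>) i z j"
proof -
  have r: "plane_pt \<alpha> i z \<in> range (plane_pt \<alpha> i)" "plane_pt \<alpha> i z \<in> range (plane_pt \<alpha> j)"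
    by blast (simp add: eq)
  have "germ (plane_chart \<alpha> i) (plane_chart \<alpha> j) (plane_pt \<alpha> i z)"
    by (rule complex_surfaceD(3)[OF complex_surface_X2 plane_chart_in_atlas[OF ij(1)] plane_chart_in_atlas[OF ij(2)]])
      (simp_all only: plane_chart_range ij r)
  then obtain N g where N: "open N" "plane_sign i z \<in> N" "holo_on g N"
    and g: "\<forall>a\<in>N. \<exists>y\<in>fst (plane_chart \<alpha> i) \<inter> fst (plane_chart \<alpha> j).
      snd (plane_chart \<alpha> i) y = a \<and> snd (plane_chart \<alpha> j) y = g a"
    unfolding germ_def plane_chart_pt[OF ij(1)] by blast
  show ?thesis
  proof (rule local_transitionI)
    show "open (plane_sign i -` N)" using N(1) by (rule open_vimage_plane_sign)
    show "z \<in> plane_sign i -` N" using N(2) by simp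
    have 1: "holo_on (g \<circ> plane_sign i) (plane_sign i -` N)"
      by (rule holo_on_compose[OF holo_on_plane_sign N(3)]) blast
    show "holo_on (plane_sign j \<circ> (g \<circ> plane_sign i)) (plane_sign i -` N)"
      by (rule holo_on_compose[OF 1 holo_on_plane_sign]) (rule subset_UNIV)
    fix c assume "c \<in> plane_sign i -` N"
    then obtain y where y: "y \<in> fst (plane_chart \<alpha> i)" "y \<in> fst (plane_chart \<alpha> j)"
      "snd (plane_chart \<alpha> i) y = plane_sign i c" "snd (plane_chart \<alpha> j) y = g (plane_sign i c)"
      using g by blast
    obtain c' d where c': "y = plane_pt \<alpha> i c'" "y = plane_pt \<alpha> j d"
      using y(1,2) unfolding plane_chart_range[OF ij(1)] plane_chart_range[OF ij(2)] by blast
    have "c' = c" using y(3) unfolding c'(1) plane_chart_pt[OF ij(1)] by (metis plane_sign_involution)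
    moreover have "d = plane_sign j (g (plane_sign i c))"
      using y(4) unfolding c'(2) plane_chart_pt[OF ij(2)] by (metis plane_sign_involution)
    ultimately show "plane_pt \<alpha> j ((plane_sign j \<circ> (g \<circ> plane_sign i)) c) = plane_pt \<alpha> i c"
      using c' by simp
  qed
qed

section \<open>Separation of the eight planes\<close>

text \<open>The coordinates to which the formulas of \<open>r_map\<close> apply:
  \<open>(q, p)\<close> for the finite centres, \<open>(x_0, y_0)\<close> at infinity.\<close>

definition base_map :: "complex \<Rightarrow> complex option \<Rightarrow> c2 \<Rightarrow> c2" where
  "base_map a \<nu> = (case \<nu> of Some _ \<Rightarrow> (\<lambda>z. z) | None \<Rightarrow> flip a)"

lemma hirz_coords_centre_plane: "hirz_coords a (centre_plane \<nu>) = (\<lambda>z. recip (base_map a \<nu> z))"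
  by (cases \<nu>) (simp_all add: centre_plane_def base_map_def hirz_coords_simps comp_def)

lemma base_map_image_generic: "base_map a \<nu> ` generic a = generic a"
  by (cases \<nu>) (simp_all add: base_map_def flip_image_generic)

lemma base_map_generic: "z \<in> generic a \<Longrightarrow> base_map a \<nu> z \<in> generic a"
  using base_map_image_generic by blast

lemma blow_map_unblow_map:
  assumes "snd z \<noteq> 0" shows "blow_map c \<beta> (unblow_map c \<beta> z) = recip z"
  using assms by (simp add: blow_map_def unblow_map_def recip_def)

lemma plane_coords_simps:
  "plane_coords \<alpha> None = hirz_coords (\<alpha> 0) 0"
  "plane_coords \<alpha> (Some 0) = hirz_coords (\<alpha> 0) (Suc 0)"
  "j \<in> {1..6} \<Longrightarrow> plane_coords \<alpha> (Some j) =
     unblow_map (centre_coord (fst (plane_centre \<alpha> j))) (snd (plane_centre \<alpha> j)) \<circ>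
       base_map (\<alpha> 0) (fst (plane_centre \<alpha> j))"
proof -
  show "plane_coords \<alpha> None = hirz_coords (\<alpha> 0) 0"
    by (simp add: plane_coords_def hirz_coords_simps fun_eq_iff)
  show "plane_coords \<alpha> (Some 0) = hirz_coords (\<alpha> 0) (Suc 0)"
    by (simp add: plane_coords_def hirz_coords_simps fun_eq_iff r_map_def flip_def)
  assume "j \<in> {1..6}"
  then have "j = 1 \<or> j = 2 \<or> j = 3 \<or> j = 4 \<or> j = 5 \<or> j = 6" by auto
  then show "plane_coords \<alpha> (Some j) =
     unblow_map (centre_coord (fst (plane_centre \<alpha> j))) (snd (plane_centre \<alpha> j)) \<circ>
       base_map (\<alpha> 0) (fst (plane_centre \<alpha> j))"
    by (elim disjE) (simp_all add: plane_coords_def fun_eq_iff r_map_def flip_def plane_centre_def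
      centre_coord_def base_map_def unblow_map_def mult.commute)
qed

lemma holo_on_unblow_map: "holo_on (unblow_map c \<beta>) {z. snd z \<noteq> 0}"
  unfolding unblow_map_def[abs_def] by (intro holo_on_PairI) auto

lemma continuous_on_unblow_map_base:
  "continuous_on (generic a) (unblow_map c \<beta> \<circ> base_map a \<nu>)"
proof (rule continuous_on_compose)
  show "continuous_on (generic a) (base_map a \<nu>)"
    by (cases \<nu>) (simp_all add: base_map_def continuous_on_flip)
  show "continuous_on (base_map a \<nu> ` generic a) (unblow_map c \<beta>)"
    unfolding base_map_image_generic
    by (rule holo_on_imp_continuous_on, rule holo_on_subset[OF holo_on_unblow_map]) (auto simp: generic_def)
qed

lemma dense_unblow_map: "closure (unblow_map c \<beta> ` generic a) = UNIV"
proof -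
  \<comment> \<open>The two values excluded for \<open>fst w\<close> solve \<open>fst ?z = 0\<close>
    and \<open>fst ?z * snd ?z + a = 0\<close> for the preimage \<open>?z\<close> below.\<close>
  have "w \<in> unblow_map c \<beta> ` generic a"
    if w: "snd w \<notin> {0}" "fst w \<notin> {(\<beta> + c / snd w) / snd w, (\<beta> + a + c / snd w) / snd w}" for w
  proof -
    have y: "snd w \<noteq> 0" using w by simp
    let ?z = "recip (blow_map c \<beta> w)"
    have "unblow_map c \<beta> ?z = w" using y by (simp add: unblow_map_def blow_map_def prod_eq_iff)
    moreover have "?z \<in> generic a"
    proof -
      have 1: "fst w * snd w \<noteq> \<beta> + c / snd w" "fst w * snd w \<noteq> \<beta> + a + c / snd w"
        using w y by (simp_all add: nonzero_eq_divide_eq)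
      have 2: "fst ?z = (\<beta> + c / snd w - fst w * snd w) * snd w"
        using y by (simp add: blow_map_def field_simps)
      have 3: "fst ?z * snd ?z + a = (\<beta> + a + c / snd w) - fst w * snd w"
        using y by (simp add: blow_map_def field_simps)
      have "fst ?z \<noteq> 0" unfolding 2 mult_eq_0_iff right_minus_eq using 1 y by auto
      moreover have "fst ?z * snd ?z + a \<noteq> 0" unfolding 3 right_minus_eq using 1 by auto
      moreover have "snd ?z \<noteq> 0" using y by (simp add: blow_map_def)
      ultimately show ?thesis unfolding generic_def by blast
    qed
    ultimately show ?thesis by (metis imageI)
  qed
  then have "{w. snd w \<notin> {0} \<and> fst w \<notin> {(\<beta> + c / snd w) / snd w, (\<beta> + a + c / snd w) / snd w}}
      \<subseteq> unblow_map c \<beta> ` generic a" by blast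
  then show ?thesis by (rule dense_superset[OF dense_fibrewise', rotated 2]) simp_all
qed

lemma limit_pair_map:
  fixes f g :: "c2 \<Rightarrow> c2"
  assumes "(z, w) \<in> closure ((\<lambda>p. (f p, g p)) ` D)" "continuous_on UNIV F" "continuous_on UNIV G"
  shows "(F z, G w) \<in> closure ((\<lambda>p. (F (f p), G (g p))) ` D)"
proof -
  have "continuous_on UNIV (\<lambda>x. (F (fst x), G (snd x)))"
    by (intro continuous_intros continuous_on_compose2[OF assms(2)] continuous_on_compose2[OF assms(3)]) auto
  then have "(\<lambda>x. (F (fst x), G (snd x))) ` closure ((\<lambda>p. (f p, g p)) ` D) \<subseteq>
     closure ((\<lambda>x. (F (fst x), G (snd x))) ` (\<lambda>p. (f p, g p)) ` D)"
    by (intro continuous_image_closure_subset[of UNIV]) auto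
  then show ?thesis using assms(1) by (force simp: image_image)
qed

text \<open>The blow-down to the Hirzebruch surface: the index of a plane of that surface and a
  polynomial map into it. Being continuous also on the exceptional line, which
  \<open>plane_coords\<close> does not reach on \<open>generic\<close>, it pushes limits of
  coordinate pairs forward.\<close>

definition plane_hirz :: "(nat \<Rightarrow> complex) \<Rightarrow> nat option \<Rightarrow> nat \<times> (c2 \<Rightarrow> c2)" where
  "plane_hirz \<alpha> i = (case i of None \<Rightarrow> (0, \<lambda>z. z)
     | Some j \<Rightarrow> if j = 0 then (1, \<lambda>z. z) else
         (centre_plane (fst (plane_centre \<alpha> j)),
          blow_map (centre_coord (fst (plane_centre \<alpha> j))) (snd (plane_centre \<alpha> j))))"

lemma continuous_on_blow_map: "continuous_on UNIV (blow_map c \<beta>)"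
  unfolding blow_map_def[abs_def] by (intro continuous_intros)

lemma plane_hirz:
  assumes "i \<in> plane_index"
  shows "fst (plane_hirz \<alpha> i) \<in> {0..3}" "continuous_on UNIV (snd (plane_hirz \<alpha> i))"
    and "p \<in> generic (\<alpha> 0) \<Longrightarrow> snd (plane_hirz \<alpha> i) (plane_coords \<alpha> i p) = hirz_coords (\<alpha> 0) (fst (plane_hirz \<alpha> i)) p"
proof -
  show "fst (plane_hirz \<alpha> i) \<in> {0..3}"
    using assms by (cases rule: plane_index_cases) (simp_all add: plane_hirz_def)
  show "continuous_on UNIV (snd (plane_hirz \<alpha> i))"
    using assms by (cases rule: plane_index_cases) (simp_all add: plane_hirz_def continuous_on_blow_map)
  assume p: "p \<in> generic (\<alpha> 0)"
  show "snd (plane_hirz \<alpha> i) (plane_coords \<alpha> i p) = hirz_coords (\<alpha> 0) (fst (plane_hirz \<alpha> i)) p"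
    using assms
  proof (cases rule: plane_index_cases)
    case (3 j)
    have "snd (base_map (\<alpha> 0) (fst (plane_centre \<alpha> j)) p) \<noteq> 0"
      using base_map_generic[OF p] unfolding generic_def by blast
    then show ?thesis using 3
      by (simp add: plane_hirz_def plane_coords_simps(3) blow_map_unblow_map hirz_coords_centre_plane)
  qed (simp_all add: plane_hirz_def plane_coords_simps)
qed

lemma plane_pt_hirz:
  assumes "i \<in> plane_index" "fst (plane_hirz \<alpha> i) < 2 \<or> snd (snd (plane_hirz \<alpha> i) z) \<noteq> 0"
  shows "plane_pt \<alpha> i z = base_pt (\<alpha> 0) (fst (plane_hirz \<alpha> i)) (snd (plane_hirz \<alpha> i) z)"
  using assms
  by (cases rule: plane_index_cases)
    (auto simp: plane_pt_def plane_hirz_def case_prod_beta exc_pt_def blow_map_def leD[OF centre_plane_range(3)])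

lemma plane_hirz_infinity:
  assumes "i \<in> plane_index" "fst (plane_hirz \<alpha> i) \<ge> 2"
  obtains j where "j \<in> {1..6}" "i = Some j"
  using assms(1) by (cases rule: plane_index_cases) (use assms(2) that in \<open>simp_all add: plane_hirz_def\<close>)

text \<open>The limit is pushed forward to the Hirzebruch surface, where separation is known. Off
  infinity a point is determined by its image there. Otherwise both points lie on second exceptional
  curves over the same first centre, and comparing their coordinates identifies the second centres
  and then the points.\<close>

lemma plane_separated:
  assumes ij: "i \<in> plane_index" "j \<in> plane_index"
    and cl: "(z, w) \<in> closure ((\<lambda>p. (plane_coords \<alpha> i p, plane_coords \<alpha> j p)) ` generic (\<alpha> 0))"
  shows "plane_pt \<alpha> i z = plane_pt \<alpha> j w"
proof -
  let ?a = "\<alpha> 0"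
  let ?k = "\<lambda>i. fst (plane_hirz \<alpha> i)" and ?H = "\<lambda>i. snd (plane_hirz \<alpha> i)"
  have "(?H i z, ?H j w) \<in> closure ((\<lambda>p. (?H i (plane_coords \<alpha> i p), ?H j (plane_coords \<alpha> j p))) ` generic ?a)"
    by (rule limit_pair_map[OF cl plane_hirz(2)[OF ij(1)] plane_hirz(2)[OF ij(2)]])
  also have "(\<lambda>p. (?H i (plane_coords \<alpha> i p), ?H j (plane_coords \<alpha> j p))) ` generic ?a =
      (\<lambda>p. (hirz_coords ?a (?k i) p, hirz_coords ?a (?k j) p)) ` generic ?a"
    by (rule image_cong) (simp_all add: plane_hirz(3) ij)
  finally have m: "hirz_model ?a (?k i) (?H i z) = hirz_model ?a (?k j) (?H j w)"
    by (rule hirz_separated[OF plane_hirz(1)[OF ij(1)] plane_hirz(1)[OF ij(2)]])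
  then have e: "hirz_pt ?a (?k i) (?H i z) = hirz_pt ?a (?k j) (?H j w)"
    by (simp only: hirz_pt_eq_iff plane_hirz(1) ij)
  have lab: "2 \<le> ?k i \<and> snd (?H i z) = 0 \<longleftrightarrow> 2 \<le> ?k j \<and> snd (?H j w) = 0"
    using m infinity_label[OF plane_hirz(1)[OF ij(1)]] infinity_label[OF plane_hirz(1)[OF ij(2)]] by metis
  show ?thesis
  proof (cases "2 \<le> ?k i \<and> snd (?H i z) = 0")
    case False
    then have "plane_pt \<alpha> i z = base_pt ?a (?k i) (?H i z)" "plane_pt \<alpha> j w = base_pt ?a (?k j) (?H j w)"
      using plane_pt_hirz ij lab by (meson not_less)+
    then show ?thesis using e unfolding base_pt_def by simp
  next
    case True
    obtain m where m: "m \<in> {1..6}" "i = Some m" using plane_hirz_infinity[OF ij(1)] True by blast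
    obtain n where n: "n \<in> {1..6}" "j = Some n" using plane_hirz_infinity[OF ij(2)] True lab by blast
    obtain \<nu> \<beta> where \<nu>: "plane_centre \<alpha> m = (\<nu>, \<beta>)" by fastforce
    obtain \<mu> \<gamma> where \<mu>: "plane_centre \<alpha> n = (\<mu>, \<gamma>)" by fastforce
    have y: "snd z = 0" "snd w = 0"
      using True lab m n by (simp_all add: plane_hirz_def blow_map_def)
    then have "first_centre ?a \<nu> = first_centre ?a \<mu>"
      using e m n \<nu> \<mu> by (simp add: plane_hirz_def blow_map_def first_centre_eq)
    then have [simp]: "\<mu> = \<nu>" using injD[OF inj_first_centre] by metis
    let ?f = "\<lambda>\<beta> p. unblow_map (centre_coord \<nu>) \<beta> (base_map ?a \<nu> p)"
    have cl': "(z, w) \<in> closure ((\<lambda>p. (?f \<beta> p, ?f \<gamma> p)) ` generic ?a)"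
      using cl m n \<nu> \<mu> by (simp add: plane_coords_simps(3))
    \<comment> \<open>Both first coordinates have the form \<open>- (s - b) p\<close> with the same
      \<open>s\<close>, so their difference times \<open>y = 1 / p\<close> is the constant
      \<open>\<beta> - \<gamma>\<close>. In the limit \<open>y = 0\<close>.\<close>
    have "(\<lambda>p. (fst (fst p) - fst (snd p)) * snd (fst p) - (\<beta> - \<gamma>)) (z, w) = 0"
    proof (rule limit_pair_eq_zero[OF cl'])
      fix p assume "p \<in> generic ?a"
      then have "snd (base_map ?a \<nu> p) \<noteq> 0"
        using base_map_generic unfolding generic_def by blast
      then show "(fst (fst (?f \<beta> p, ?f \<gamma> p)) - fst (snd (?f \<beta> p, ?f \<gamma> p))) * snd (fst (?f \<beta> p, ?f \<gamma> p))
          - (\<beta> - \<gamma>) = 0"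
        by (simp add: unblow_map_def field_simps)
    qed (auto intro!: continuous_intros)
    then have "\<gamma> = \<beta>" using y by simp
    moreover have "z = w" by (rule limit_pair_same[OF cl'[unfolded \<open>\<gamma> = \<beta>\<close>]])
    ultimately show ?thesis using m n \<nu> \<mu> by (simp add: plane_pt_def)
  qed
qed

lemma qp_pt_eq: "qp_pt \<alpha> = (\<lambda>z. Some (base_pt (\<alpha> 0) 0 z))"
  unfolding qp_pt_def base_pt_def by auto

lemma plane_pt_coords:
  assumes "i \<in> plane_index" "p \<in> generic (\<alpha> 0)"
  shows "plane_pt \<alpha> i (plane_coords \<alpha> i p) = base_pt (\<alpha> 0) 0 p"
proof -
  have g: "snd (hirz_coords (\<alpha> 0) k p) \<noteq> 0" if "k \<in> {0..3}" for k
    using that assms(2) flip_generic[OF assms(2)]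
    by (elim le_3_cases) (simp_all add: hirz_coords_simps generic_def)
  have k: "fst (plane_hirz \<alpha> i) \<in> {0..3}" by (rule plane_hirz(1)[OF assms(1)])
  have "plane_pt \<alpha> i (plane_coords \<alpha> i p) =
      base_pt (\<alpha> 0) (fst (plane_hirz \<alpha> i)) (hirz_coords (\<alpha> 0) (fst (plane_hirz \<alpha> i)) p)"
    by (subst plane_pt_hirz) (simp_all only: plane_hirz(3) assms g[OF k] simp_thms)
  moreover have "hirz_pt (\<alpha> 0) k (hirz_coords (\<alpha> 0) k p) = hirz_pt (\<alpha> 0) 0 p" if "k \<in> {0..3}" for k
    using hirz.rep[OF that assms(2)] that by (simp add: hirz_pt_eq_iff)
  ultimately show ?thesis using k unfolding base_pt_def by simp
qed

global_interpretation planes: plane_model plane_index "plane_coords \<alpha>" "generic (\<alpha> 0)" "qp_pt \<alpha>"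
  "\<lambda>i z. Some (plane_pt \<alpha> i z)" for \<alpha>
proof
  show "open (generic (\<alpha> 0))" "closure (generic (\<alpha> 0)) = UNIV" by (rule open_generic dense_generic)+
  fix i assume i: "i \<in> plane_index"
  show "inj (\<lambda>z. Some (plane_pt \<alpha> i z))" using inj_plane_pt[OF i] by (simp add: inj_def)
  show "Some (plane_pt \<alpha> i (plane_coords \<alpha> i z)) = qp_pt \<alpha> z" if "z \<in> generic (\<alpha> 0)" for z
    using plane_pt_coords[of i z \<alpha>] i that by (simp add: qp_pt_eq)
  show "continuous_on (generic (\<alpha> 0)) (plane_coords \<alpha> i)"
    using i by (cases rule: plane_index_cases)
     (simp_all only: plane_coords_simps continuous_on_unblow_map_base hirz_coords_simps continuous_on_flip continuous_on_id)
  show "closure (plane_coords \<alpha> i ` generic (\<alpha> 0)) = UNIV"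
    using i by (cases rule: plane_index_cases)
      (simp_all only: plane_coords_simps hirz_coords_simps flip_image_generic dense_generic image_ident
         dense_unblow_map image_comp[symmetric] base_map_image_generic)
next
  fix i j z w assume ij: "i \<in> plane_index" "j \<in> plane_index"
  {
    assume "Some (plane_pt \<alpha> i z) = Some (plane_pt \<alpha> j w)"
    then show "\<exists>N h. open N \<and> z \<in> N \<and> holo_on h N \<and> (\<forall>c\<in>N. Some (plane_pt \<alpha> j (h c)) = Some (plane_pt \<alpha> i c))"
      using plane_transition[OF ij, of \<alpha> z w] unfolding local_transition_def by simp
  next
    assume "(z, w) \<in> closure ((\<lambda>z. (plane_coords \<alpha> i z, plane_coords \<alpha> j z)) ` generic (\<alpha> 0))"
    then show "Some (plane_pt \<alpha> i z) = Some (plane_pt \<alpha> j w)" using plane_separated[OF ij] by simp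
  }
qed

section \<open>The removed curves\<close>

lemma blow_up_cover:
  assumes "points X \<subseteq> (\<Union>A\<in>atlas X. fst A)"
  shows "points (blow_up X B) \<subseteq> (\<Union>A\<in>atlas (blow_up X B). fst A)"
proof
  fix y assume y: "y \<in> points (blow_up X B)"
  show "y \<in> (\<Union>A\<in>atlas (blow_up X B). fst A)"
  proof (cases y)
    case (Off x)
    then have "x \<in> points X" "x \<notin> fst ` B" using y unfolding blow_up_def by auto
    then obtain k where "k \<in> atlas X" "x \<in> fst k" using assms by blast
    then have "off_chart (fst ` B) k \<in> atlas (blow_up X B)" "y \<in> fst (off_chart (fst ` B) k)"
      using Off \<open>x \<notin> fst ` B\<close> unfolding blow_up_atlas by simp_all
    then show ?thesis by blast
  next
    case (Exc c s)
    then have "c \<in> fst ` B" using y unfolding blow_up_def by auto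
    then obtain b where "b \<in> B" "c = fst b" by blast
    then have k: "(c, snd b) \<in> B" by simp
    let ?A = "if s = None then blow_chart2 (fst ` B) c (snd b) else blow_chart1 (fst ` B) c (snd b)"
    have "?A \<in> atlas (blow_up X B)" using k unfolding blow_up_atlas by auto
    moreover have "y \<in> fst ?A" using Exc by simp
    ultimately show ?thesis by blast
  qed
qed

lemma points_X1_cover: "points (X1 a) \<subseteq> (\<Union>A\<in>atlas (X1 a). fst A)"
  unfolding X1_def by (rule blow_up_cover) (auto simp: points_hirz atlas_hirz fst_hirz_chart)

lemma points_X2_cover: "points (X2 \<alpha>) \<subseteq> (\<Union>A\<in>atlas (X2 \<alpha>). fst A)"
  unfolding X2_def by (rule blow_up_cover[OF points_X1_cover])

lemma X1_cover_points: "(\<Union>A\<in>atlas (X1 a). fst A) \<subseteq> points (X1 a)"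
  using complex_surfaceD(1)[OF complex_surface_X1] by blast

lemma points_X1:
  "points (X1 a) = Off ` (points (hirz a) - fst ` first_centres a) \<union> {Exc c s | c s. c \<in> fst ` first_centres a}"
  unfolding X1_def blow_up_def by simp

lemma points_X2:
  "points (X2 \<alpha>) = Off ` (points (X1 (\<alpha> 0)) - fst ` second_centres \<alpha>) \<union> {Exc c s | c s. c \<in> fst ` second_centres \<alpha>}"
  unfolding X2_def blow_up_def by simp

text \<open>A curve through a centre in the direction \<open>w = 0\<close> lifts to a curve through the point
  \<open>Exc c None\<close>.\<close>
lemma Exc_None_in_closure:
  assumes ck: "(c, k) \<in> B" and unique: "\<And>k'. (c, k') \<in> B \<Longrightarrow> k' = k"
    and \<eta>: "eventually (\<lambda>t. \<eta> t \<in> fst k \<and> \<eta> t \<in> S \<and> \<eta> t \<notin> fst ` B \<and> snd k (\<eta> t) - snd k c = (t, 0)) (at 0)"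
  shows "Exc c None \<in> surface_topology (blow_up X B) closure_of (Off ` (S - fst ` B))"
proof (rule in_surface_closureI[where \<gamma> = "\<lambda>t. Off (\<eta> t)"])
  have "blow_chart2 (fst ` B) c k \<in> atlas (blow_up X B)" using ck unfolding blow_up_atlas by auto
  moreover have "Exc c None \<in> fst (blow_chart2 (fst ` B) c k)" by simp
  ultimately show "Exc c None \<in> (\<Union>A\<in>atlas (blow_up X B). fst A)" by blast
  show "eventually (\<lambda>t. Off (\<eta> t) \<in> Off ` (S - fst ` B)) (at 0)"
    using \<eta> by eventually_elim blast
  fix A assume A: "A \<in> atlas (blow_up X B)" "Exc c None \<in> fst A"
  have A_eq: "A = blow_chart2 (fst ` B) c k"
    using A(1)
  proof (cases rule: blow_up_atlasE)
    case (3 d l)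
    then have "d = c" using A(2) by simp
    then show ?thesis using 3 unique by simp
  qed (use A(2) in simp_all)
  have ne: "eventually (\<lambda>t. t \<noteq> 0) (at (0::complex))" by (simp add: eventually_at_filter)
  show "eventually (\<lambda>t. Off (\<eta> t) \<in> fst A) (at 0) \<and> ((\<lambda>t. snd A (Off (\<eta> t))) \<longlongrightarrow> snd A (Exc c None)) (at 0)"
  proof
    show "eventually (\<lambda>t. Off (\<eta> t) \<in> fst A) (at 0)"
      using \<eta> ne by eventually_elim (simp add: A_eq del: fst_diff)
    have "((\<lambda>t. (t, 0)) \<longlongrightarrow> (0, 0 :: complex)) (at (0::complex))"
      by (intro tendsto_Pair tendsto_ident_at tendsto_const)
    moreover have "eventually (\<lambda>t. (t, 0) = snd A (Off (\<eta> t))) (at 0)"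
      using \<eta> by eventually_elim (simp add: A_eq del: fst_diff snd_diff)
    ultimately show "((\<lambda>t. snd A (Off (\<eta> t))) \<longlongrightarrow> snd A (Exc c None)) (at 0)"
      using Lim_transform_eventually by (fastforce simp: A_eq)
  qed
qed

lemma eventually_notin_finite: "finite F \<Longrightarrow> eventually (\<lambda>t. t \<notin> F) (at (x :: complex))"
proof -
  assume "finite F"
  then have "open (- (F - {x}))" by (intro open_Compl finite_imp_closed) simp
  then have "eventually (\<lambda>t. t \<in> - (F - {x})) (at x)" by (intro eventually_at_in_open') simp_all
  moreover have "eventually (\<lambda>t. t \<noteq> x) (at x)" by (simp add: eventually_at_filter)
  ultimately show ?thesis by eventually_elim blast
qed

definition section_strict1 :: "complex \<Rightarrow> hirz_point blown set" where
  "section_strict1 a = strict_transform (hirz a) (first_centres a) (D_section a)"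

lemma D_section_strict_eq:
  "D_section_strict \<alpha> =
     surface_topology (X2 \<alpha>) closure_of (Off ` (section_strict1 (\<alpha> 0) - fst ` second_centres \<alpha>))"
  unfolding D_section_strict_def section_strict1_def strict_transform_def X2_def ..

lemma section_strict1_eq:
  "section_strict1 a = surface_topology (X1 a) closure_of (Off ` (D_section a - fst ` first_centres a))"
  unfolding section_strict1_def strict_transform_def X1_def ..

lemma D_exc_strict_eq:
  "D_exc_strict \<alpha> \<nu> =
     surface_topology (X2 \<alpha>) closure_of (Off ` (exceptional (first_centre (\<alpha> 0) \<nu>) - fst ` second_centres \<alpha>))"
  unfolding D_exc_strict_def strict_transform_def X2_def ..

lemma D_section_subset: "D_section a \<subseteq> points (hirz a)"
proof -
  have "hirz_pt a j w \<in> points (hirz a)" if "j \<in> {0..3}" for j w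
    unfolding points_hirz using that by blast
  from this[of 2] this[of 3] show ?thesis unfolding D_section_def by auto
qed

lemma Off_section_strict1:
  "h \<in> D_section a \<Longrightarrow> h \<notin> fst ` first_centres a \<Longrightarrow> Off h \<in> section_strict1 a"
proof -
  assume h: "h \<in> D_section a" "h \<notin> fst ` first_centres a"
  have "Off ` (D_section a - fst ` first_centres a) \<subseteq> points (X1 a)"
    unfolding points_X1 using D_section_subset by blast
  then have "Off ` (D_section a - fst ` first_centres a) \<subseteq> section_strict1 a"
    unfolding section_strict1_eq using points_X1_cover by (intro subset_surface_closure) blast
  then show "Off h \<in> section_strict1 a" using h by blast
qed

lemma section_strict1_subset: "section_strict1 a \<subseteq> points (X1 a)"
  unfolding section_strict1_eq
  using closure_of_subset_topspace[of "surface_topology (X1 a)"] X1_cover_points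
  unfolding topspace_surface_topology by blast

lemma Off_D_section_strict:
  assumes "x \<in> section_strict1 (\<alpha> 0)" "x \<notin> fst ` second_centres \<alpha>"
  shows "Off x \<in> D_section_strict \<alpha>"
proof -
  have "Off ` (section_strict1 (\<alpha> 0) - fst ` second_centres \<alpha>) \<subseteq> points (X2 \<alpha>)"
    unfolding points_X2 using section_strict1_subset by blast
  then have "Off ` (section_strict1 (\<alpha> 0) - fst ` second_centres \<alpha>) \<subseteq> D_section_strict \<alpha>"
    unfolding D_section_strict_eq using points_X2_cover by (intro subset_surface_closure) blast
  then show ?thesis using assms by blast
qed

lemma Off_D_exc_strict:
  assumes "\<nu> \<in> first_index" "Exc (first_centre (\<alpha> 0) \<nu>) s \<notin> fst ` second_centres \<alpha>"
  shows "Off (Exc (first_centre (\<alpha> 0) \<nu>) s) \<in> D_exc_strict \<alpha> \<nu>"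
proof -
  have "first_centre (\<alpha> 0) \<nu> \<in> fst ` first_centres (\<alpha> 0)"
    unfolding fst_first_centres using assms(1) by blast
  then have "exceptional (first_centre (\<alpha> 0) \<nu>) \<subseteq> points (X1 (\<alpha> 0))"
    unfolding points_X1 exceptional_def by blast
  then have "Off ` (exceptional (first_centre (\<alpha> 0) \<nu>) - fst ` second_centres \<alpha>) \<subseteq> points (X2 \<alpha>)"
    unfolding points_X2 by blast
  then have "Off ` (exceptional (first_centre (\<alpha> 0) \<nu>) - fst ` second_centres \<alpha>) \<subseteq> D_exc_strict \<alpha> \<nu>"
    unfolding D_exc_strict_eq using points_X2_cover by (intro subset_surface_closure) blast
  then show ?thesis using assms(2) unfolding exceptional_def by blast
qed

text \<open>The point is approached along the section itself: the path \<open>(t, 0)\<close> in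
  plane 2 avoids the centres 0 and 1 for small nonzero \<open>t\<close>, and its lift tends to the
  direction \<open>w = 0\<close>.\<close>

lemma Exc_None_section_strict1: "Exc (first_centre a (Some 0)) None \<in> section_strict1 a"
  unfolding section_strict1_eq X1_def
proof (rule Exc_None_in_closure[where \<eta> = "\<lambda>t. hirz_pt a 2 (t, 0)"])
  show "(first_centre a (Some 0), first_chart a (Some 0)) \<in> first_centres a"
    unfolding first_centres_def by blast
  show "k' = first_chart a (Some 0)" if k': "(first_centre a (Some 0), k') \<in> first_centres a" for k'
  proof -
    obtain \<nu> where "first_centre a (Some 0) = first_centre a \<nu>" "k' = first_chart a \<nu>"
      using k' unfolding first_centres_def by blast
    then show ?thesis using injD[OF inj_first_centre, of a "Some 0" \<nu>] by simp
  qed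
  have "eventually (\<lambda>t. t \<notin> {0, 1}) (at (0::complex))" by (rule eventually_notin_finite) simp
  then show "eventually (\<lambda>t. hirz_pt a 2 (t, 0) \<in> fst (first_chart a (Some 0)) \<and>
      hirz_pt a 2 (t, 0) \<in> D_section a \<and> hirz_pt a 2 (t, 0) \<notin> fst ` first_centres a \<and>
      snd (first_chart a (Some 0)) (hirz_pt a 2 (t, 0)) - snd (first_chart a (Some 0)) (first_centre a (Some 0)) = (t, 0)) (at 0)"
  proof eventually_elim
    case (elim t)
    have c: "first_centre a (Some t) = hirz_pt a 2 (t, 0)" for t by (simp add: first_centre_def)
    have k: "first_chart a (Some 0) = hirz_chart a 2" by (simp add: first_chart_def)
    have "Some t \<notin> first_index" using elim by (simp add: first_index_def)
    then have "hirz_pt a 2 (t, 0) \<notin> fst ` first_centres a"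
      unfolding c[symmetric] fst_first_centres inj_image_mem_iff[OF inj_first_centre] .
    moreover have "hirz_pt a 2 (t, 0) \<in> D_section a" unfolding D_section_def by blast
    ultimately show ?case unfolding k c fst_hirz_chart by (simp add: snd_hirz_chart)
  qed
qed

text \<open>At a second centre the direction \<open>None\<close> is that of \<open>v = 0\<close>,
  the first exceptional curve. It is the one point of the second exceptional curve that the plane
  over this centre misses.\<close>

lemma Exc_None_D_exc_strict:
  assumes "(\<nu>, \<beta>) \<in> second_index \<alpha>"
  shows "Exc (uv_pt (\<alpha> 0) \<nu> \<beta>) None \<in> D_exc_strict \<alpha> \<nu>"
  unfolding D_exc_strict_eq X2_def
proof (rule Exc_None_in_closure[where \<eta> = "\<lambda>t. uv_pt (\<alpha> 0) \<nu> (\<beta> + t)"])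
  show "(uv_pt (\<alpha> 0) \<nu> \<beta>, uv_chart (\<alpha> 0) \<nu>) \<in> second_centres \<alpha>" by (rule second_centresI[OF assms])
  show "k' = uv_chart (\<alpha> 0) \<nu>" if "(uv_pt (\<alpha> 0) \<nu> \<beta>, k') \<in> second_centres \<alpha>" for k'
    using that by (rule second_centresE) (simp add: uv_pt_eq_iff)
  have "finite ((\<lambda>i. snd i - \<beta>) ` second_index \<alpha>)" by (simp add: second_index_eq)
  then have "eventually (\<lambda>t. t \<notin> (\<lambda>i. snd i - \<beta>) ` second_index \<alpha>) (at 0)" by (rule eventually_notin_finite)
  then show "eventually (\<lambda>t. uv_pt (\<alpha> 0) \<nu> (\<beta> + t) \<in> fst (uv_chart (\<alpha> 0) \<nu>) \<and>
      uv_pt (\<alpha> 0) \<nu> (\<beta> + t) \<in> exceptional (first_centre (\<alpha> 0) \<nu>) \<and>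
      uv_pt (\<alpha> 0) \<nu> (\<beta> + t) \<notin> fst ` second_centres \<alpha> \<and>
      snd (uv_chart (\<alpha> 0) \<nu>) (uv_pt (\<alpha> 0) \<nu> (\<beta> + t)) - snd (uv_chart (\<alpha> 0) \<nu>) (uv_pt (\<alpha> 0) \<nu> \<beta>) = (t, 0)) (at 0)"
  proof eventually_elim
    case (elim t)
    have "(\<nu>, \<beta> + t) \<notin> second_index \<alpha>"
    proof
      assume "(\<nu>, \<beta> + t) \<in> second_index \<alpha>"
      then have "t \<in> (\<lambda>i. snd i - \<beta>) ` second_index \<alpha>" by (rule image_eqI[rotated]) simp
      with elim show False ..
    qed
    moreover have "uv_pt (\<alpha> 0) \<nu> (\<beta> + t) \<in> fst (uv_chart (\<alpha> 0) \<nu>)" by (simp add: uv_pt_def uv_chart_def)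
    moreover have "uv_pt (\<alpha> 0) \<nu> (\<beta> + t) \<in> exceptional (first_centre (\<alpha> 0) \<nu>)"
      by (simp add: uv_pt_def exceptional_def)
    ultimately show ?case by (simp add: fst_second_centres_iff uv_chart_uv_pt)
  qed
qed

lemma anticanonical_redI: 
  assumes "y \<in> D_exc_strict \<alpha> \<nu>" "\<nu> \<in> first_index"
  shows "contraction (D_section_strict \<alpha>) y \<in> anticanonical_red \<alpha>"
  using assms unfolding anticanonical_red_def first_index_def by blast

text \<open>The strict transform of the section at infinity meets the exceptional curve over 0 in
  the direction \<open>None\<close>, and the contraction sends this common point to the new
  point.\<close>

lemma None_in_anticanonical: "None \<in> anticanonical_red \<alpha>"
proof -
  let ?y = "Off (Exc (first_centre (\<alpha> 0) (Some 0)) None)"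
  have "?y \<in> D_section_strict \<alpha>"
    by (rule Off_D_section_strict[OF Exc_None_section_strict1 None_notin_second_centres])
  then have "contraction (D_section_strict \<alpha>) ?y = None" by (simp add: contraction_def)
  moreover have "?y \<in> D_exc_strict \<alpha> (Some 0)"
    by (rule Off_D_exc_strict[OF _ None_notin_second_centres]) (simp add: first_index_def)
  ultimately show ?thesis using anticanonical_redI[of ?y \<alpha> "Some 0"] by (simp add: first_index_def)
qed

lemma base_pt_in_plane:
  assumes "i \<in> {0..3}" "i < 2 \<or> snd z \<noteq> 0"
  shows "\<exists>j\<le>1. \<exists>w. base_pt a i z = base_pt a j w"
  using assms(1)
proof (cases rule: le_3_cases)
  case 3
  then have "base_pt a i z = base_pt a 0 (recip z)"
    using assms(2) hirz_pt_recip(1)[of z a] by (simp add: base_pt_def)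
  then show ?thesis by (meson zero_le)
next
  case 4
  then have "base_pt a i z = base_pt a 1 (recip z)"
    using assms(2) hirz_pt_recip(2)[of z a] by (simp add: base_pt_def)
  then show ?thesis by (meson le_refl)
next
  case 1
  then have "i \<le> 1" by simp
  then show ?thesis by blast
next
  case 2
  then have "i \<le> 1" by simp
  then show ?thesis by blast
qed

lemma plane_chart_Off:
  assumes "i \<in> plane_index" "Off x \<in> fst (plane_chart \<alpha> i)"
  obtains j w where "j \<le> 1" "x = Off (hirz_pt (\<alpha> 0) j w)"
proof -
  obtain z where z: "Off x = plane_pt \<alpha> i z"
    using assms unfolding plane_chart_range[OF assms(1)] by blast
  have "\<exists>k\<in>{0..3}. \<exists>w. (k < 2 \<or> snd w \<noteq> 0) \<and> Off x = base_pt (\<alpha> 0) k w"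
    using assms(1)
  proof (cases rule: plane_index_cases)
    case 1
    then show ?thesis using z by (intro bexI[of _ 0] exI[of _ z]) (simp_all add: plane_pt_def)
  next
    case 2
    then show ?thesis using z by (intro bexI[of _ 1] exI[of _ z]) (simp_all add: plane_pt_def)
  next
    case (3 j)
    then show ?thesis using z
      by (intro bexI[of _ "centre_plane (fst (plane_centre \<alpha> j))"]
          exI[of _ "blow_map (centre_coord (fst (plane_centre \<alpha> j))) (snd (plane_centre \<alpha> j)) z"])
        (auto simp: plane_pt_def case_prod_beta exc_pt_def blow_map_def split: if_splits)
  qed
  then obtain j w where "j \<le> 1" "Off x = base_pt (\<alpha> 0) j w" using base_pt_in_plane by metis
  then show ?thesis using that unfolding base_pt_def by simp
qed

lemma hirz_pt_notin_section_strict1: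
  assumes "j \<le> 1" shows "Off (hirz_pt a j w) \<notin> section_strict1 a"
  unfolding section_strict1_eq
proof (rule not_in_surface_closure)
  have j: "j \<in> {0..3}" using assms by simp
  show "off_chart (fst ` first_centres a) (hirz_chart a j) \<in> atlas (X1 a)"
    unfolding X1_def blow_up_atlas atlas_hirz using j by simp
  have "hirz_pt a j w \<notin> fst ` first_centres a"
    using first_centre_label[OF j] assms by fastforce
  then show "Off (hirz_pt a j w) \<in> fst (off_chart (fst ` first_centres a) (hirz_chart a j))"
    by (simp add: fst_hirz_chart)
  have "h \<notin> D_section a" if "h \<in> range (hirz_pt a j)" for h
    using that D_section_label[OF j, of a] assms by auto
  then show "fst (off_chart (fst ` first_centres a) (hirz_chart a j)) \<inter> Off ` (D_section a - fst ` first_centres a) = {}"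
    unfolding off_chart_def fst_conv fst_hirz_chart by blast
qed

text \<open>Both strict transforms are closures of sets of points \<open>Off x\<close>. The domain
  of a plane chart is open, and its points of this form lie over planes 0 and 1 of the Hirzebruch
  surface, hence on none of these curves. So it is a neighbourhood disjoint from the sets whose
  closures are taken.\<close>

lemma plane_pt_notin_strict:
  assumes i: "i \<in> plane_index"
  shows "plane_pt \<alpha> i z \<notin> D_section_strict \<alpha>" "plane_pt \<alpha> i z \<notin> D_exc_strict \<alpha> \<nu>"
proof -
  have z: "plane_pt \<alpha> i z \<in> fst (plane_chart \<alpha> i)" unfolding plane_chart_range[OF i] by blast
  show "plane_pt \<alpha> i z \<notin> D_section_strict \<alpha>"
    unfolding D_section_strict_eq
  proof (rule not_in_surface_closure[OF plane_chart_in_atlas[OF i] z])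
    have "x \<notin> section_strict1 (\<alpha> 0)" if "Off x \<in> fst (plane_chart \<alpha> i)" for x
      using plane_chart_Off[OF i that] hirz_pt_notin_section_strict1 by metis
    then show "fst (plane_chart \<alpha> i) \<inter> Off ` (section_strict1 (\<alpha> 0) - fst ` second_centres \<alpha>) = {}"
      by blast
  qed
  show "plane_pt \<alpha> i z \<notin> D_exc_strict \<alpha> \<nu>"
    unfolding D_exc_strict_eq
  proof (rule not_in_surface_closure[OF plane_chart_in_atlas[OF i] z])
    have "x \<notin> exceptional (first_centre (\<alpha> 0) \<nu>)" if "Off x \<in> fst (plane_chart \<alpha> i)" for x
      using plane_chart_Off[OF i that] unfolding exceptional_def by blast
    then show "fst (plane_chart \<alpha> i) \<inter> Off ` (exceptional (first_centre (\<alpha> 0) \<nu>) - fst ` second_centres \<alpha>) = {}"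
      by blast
  qed
qed

lemma plane_pt_in_X2: "i \<in> plane_index \<Longrightarrow> plane_pt \<alpha> i z \<in> points (X2 \<alpha>)"
proof -
  assume i: "i \<in> plane_index"
  have "plane_pt \<alpha> i z \<in> fst (plane_chart \<alpha> i)" unfolding plane_chart_range[OF i] by blast
  then show ?thesis using complex_surfaceD(1)[OF complex_surface_X2 plane_chart_in_atlas[OF i]] by blast
qed

lemma Some_plane_pt:
  assumes "i \<in> plane_index"
  shows "contraction (D_section_strict \<alpha>) (plane_pt \<alpha> i z) = Some (plane_pt \<alpha> i z)"
    "Some (plane_pt \<alpha> i z) \<notin> anticanonical_red \<alpha>"
proof -
  show "contraction (D_section_strict \<alpha>) (plane_pt \<alpha> i z) = Some (plane_pt \<alpha> i z)"
    using plane_pt_notin_strict(1)[OF assms] by (simp add: contraction_def)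
  have n: "plane_pt \<alpha> i z \<notin> D_exc_strict \<alpha> \<nu>" for \<nu> by (rule plane_pt_notin_strict(2)[OF assms])
  show "Some (plane_pt \<alpha> i z) \<notin> anticanonical_red \<alpha>"
    using n unfolding anticanonical_red_def contraction_def by (auto split: if_splits)
qed

text \<open>Each point that no plane reaches turns out to be removed: it lies on a first exceptional
  curve, or on the section at infinity, which contracts to the removed point \<open>None\<close>, or
  it is the direction \<open>None\<close> of a second exceptional curve.\<close>

lemma X2_covered:
  assumes "y \<in> points (X2 \<alpha>)" "contraction (D_section_strict \<alpha>) y \<notin> anticanonical_red \<alpha>"
  shows "\<exists>i\<in>plane_index. y \<in> range (plane_pt \<alpha> i)"
proof (cases y)
  case (Off x)
  then have x: "x \<in> points (X1 (\<alpha> 0))" "x \<notin> fst ` second_centres \<alpha>"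
    using assms(1) unfolding points_X2 by auto
  show ?thesis
  proof (cases x)
    case (Exc c s)
    then have "c \<in> fst ` first_centres (\<alpha> 0)" using x(1) unfolding points_X1 by auto
    then obtain \<nu> where "\<nu> \<in> first_index" "c = first_centre (\<alpha> 0) \<nu>" unfolding fst_first_centres by blast
    then have "y \<in> D_exc_strict \<alpha> \<nu>" using Off_D_exc_strict x(2) unfolding Off Exc by blast
    then show ?thesis using anticanonical_redI assms(2) \<open>\<nu> \<in> first_index\<close> by blast
  next
    case (Off h)
    then have h: "h \<in> points (hirz (\<alpha> 0))" "h \<notin> fst ` first_centres (\<alpha> 0)"
      using x(1) unfolding points_X1 by auto
    then obtain k z where k: "k \<in> {0..3}" "h = hirz_pt (\<alpha> 0) k z" unfolding points_hirz by blast
    show ?thesis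
    proof (cases "k < 2 \<or> snd z \<noteq> 0")
      case True
      then obtain j w where j: "j \<le> 1" "y = base_pt (\<alpha> 0) j w"
        using base_pt_in_plane[OF k(1)] \<open>y = Off x\<close> Off k(2) unfolding base_pt_def by metis
      have "y = plane_pt \<alpha> (if j = 0 then None else Some 0) w"
        using j by (auto simp: plane_pt_def le_Suc_eq)
      moreover have "(if j = 0 then None else Some 0) \<in> plane_index" by (simp add: plane_index_def)
      ultimately show ?thesis by blast
    next
      case False
      then have "h \<in> D_section (\<alpha> 0)" unfolding k(2) D_section_label[OF k(1)] by simp
      then have "y \<in> D_section_strict \<alpha>"
        using Off_section_strict1 h(2) Off_D_section_strict x(2) unfolding \<open>y = Off x\<close> Off by blast
      then show ?thesis using assms(2) None_in_anticanonical[of \<alpha>] by (simp add: contraction_def)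
    qed
  qed
next
  case (Exc d s)
  then have "d \<in> fst ` second_centres \<alpha>" using assms(1) unfolding points_X2 by auto
  then obtain \<nu> \<beta> where d: "(\<nu>, \<beta>) \<in> second_index \<alpha>" "d = uv_pt (\<alpha> 0) \<nu> \<beta>" by (rule fst_second_centresE)
  then obtain j where j: "j \<in> {1..6}" "plane_centre \<alpha> j = (\<nu>, \<beta>)" unfolding second_index_eq by (metis imageE)
  show ?thesis
  proof (cases s)
    case None
    then have "y \<in> D_exc_strict \<alpha> \<nu>" using Exc_None_D_exc_strict[OF d(1)] Exc d(2) by simp
    then show ?thesis using anticanonical_redI assms(2) second_index_first[OF d(1)] by blast
  next
    case (Some t)
    then have "y = plane_pt \<alpha> (Some j) (- t, 0)"
      using Exc d(2) j by (simp add: plane_pt_def exc_pt_def)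
    moreover have "Some j \<in> plane_index" using j(1) by (simp add: plane_index_def)
    ultimately show ?thesis by blast
  qed
qed

lemma points_space:
  "points (space_of_initial_conditions \<alpha>) = (\<Union>i\<in>plane_index. range (\<lambda>z. Some (plane_pt \<alpha> i z)))"
proof -
  have p: "points (space_of_initial_conditions \<alpha>) =
      contraction (D_section_strict \<alpha>) ` points (X2 \<alpha>) - anticanonical_red \<alpha>"
    unfolding space_of_initial_conditions_def surface_diff_def Stilde_def blow_down_def by simp
  show ?thesis unfolding p
  proof
    show "contraction (D_section_strict \<alpha>) ` points (X2 \<alpha>) - anticanonical_red \<alpha> \<subseteq>
        (\<Union>i\<in>plane_index. range (\<lambda>z. Some (plane_pt \<alpha> i z)))"
    proof
      fix x assume "x \<in> contraction (D_section_strict \<alpha>) ` points (X2 \<alpha>) - anticanonical_red \<alpha>"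
      then obtain y where y: "y \<in> points (X2 \<alpha>)" "x = contraction (D_section_strict \<alpha>) y" "x \<notin> anticanonical_red \<alpha>"
        by blast
      then obtain i z where "i \<in> plane_index" "y = plane_pt \<alpha> i z" using X2_covered by blast
      then show "x \<in> (\<Union>i\<in>plane_index. range (\<lambda>z. Some (plane_pt \<alpha> i z)))"
        using y(2) Some_plane_pt(1) by auto
    qed
    show "(\<Union>i\<in>plane_index. range (\<lambda>z. Some (plane_pt \<alpha> i z))) \<subseteq>
        contraction (D_section_strict \<alpha>) ` points (X2 \<alpha>) - anticanonical_red \<alpha>"
    proof
      fix x assume "x \<in> (\<Union>i\<in>plane_index. range (\<lambda>z. Some (plane_pt \<alpha> i z)))"
      then obtain i z where i: "i \<in> plane_index" "x = Some (plane_pt \<alpha> i z)" by blast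
      then have "x = contraction (D_section_strict \<alpha>) (plane_pt \<alpha> i z)" using Some_plane_pt(1)[OF i(1)] by simp
      then show "x \<in> contraction (D_section_strict \<alpha>) ` points (X2 \<alpha>) - anticanonical_red \<alpha>"
        using plane_pt_in_X2[OF i(1), of \<alpha> z] Some_plane_pt(2)[OF i(1), of \<alpha> z] i(2) by (metis DiffI imageI)
    qed
  qed
qed


section \<open>The planes as holomorphic coordinates of the open surface\<close>

definition plane_set :: "(nat \<Rightarrow> complex) \<Rightarrow> nat option \<Rightarrow> stilde_point set" where
  "plane_set \<alpha> i = range (\<lambda>z. Some (plane_pt \<alpha> i z))"

definition plane_coord :: "(nat \<Rightarrow> complex) \<Rightarrow> nat option \<Rightarrow> stilde_point \<Rightarrow> c2" where
  "plane_coord \<alpha> i x = plane_sign i (snd (plane_chart \<alpha> i) (the x))"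

lemma plane_coord_pt: "i \<in> plane_index \<Longrightarrow> plane_coord \<alpha> i (Some (plane_pt \<alpha> i z)) = z"
  unfolding plane_coord_def option.sel by (simp only: plane_chart_pt plane_sign_involution)

text \<open>Covers both kinds of charts of the blow-down: away from the contracted curve, \<open>k\<close> is a chart of
  \<open>X2 \<alpha>\<close>; around the new point, it is holomorphic coordinates on a punctured neighbourhood.\<close>
lemma space_atlasE:
  assumes A: "A \<in> atlas (space_of_initial_conditions \<alpha>)"
  obtains k where "inj_on (snd k) (fst k)"
    and "fst A = Some ` {y \<in> fst k. y \<notin> D_section_strict \<alpha> \<and> Some y \<notin> anticanonical_red \<alpha>}"
    and "\<forall>y. snd A (Some y) = snd k y"
    and "\<forall>c\<in>atlas (X2 \<alpha>). \<forall>y\<in>fst c \<inter> fst k. germ c k y \<and> germ k c y"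
proof -
  let ?E = "D_section_strict \<alpha>" and ?C = "anticanonical_red \<alpha>" and ?X = "X2 \<alpha>"
  obtain V \<psi> where V: "A = (V - ?C, \<psi>)" "(V, \<psi>) \<in> atlas (Stilde \<alpha>)"
    using A unfolding space_of_initial_conditions_def surface_diff_def by auto
  consider U \<phi> where "V = Some ` (U - ?E)" "\<psi> = \<phi> \<circ> the" "(U, \<phi>) \<in> atlas ?X"
    | "None \<in> V" "V \<subseteq> contraction ?E ` points ?X" "inj_on \<psi> V"
      "compatible_chart ?X ({x \<in> points ?X. contraction ?E x \<in> V} - ?E, \<psi> \<circ> Some)"
    using V(2) unfolding Stilde_def blow_down_def by auto
  then show ?thesis
  proof cases
    case 1
    note U = complex_surfaceD[OF complex_surface_X2 1(3)]
    show ?thesis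
    proof (rule that[of "(U, \<phi>)"])
      show "inj_on (snd (U, \<phi>)) (fst (U, \<phi>))" by (rule U(2))
      show "fst A = Some ` {y \<in> fst (U, \<phi>). y \<notin> ?E \<and> Some y \<notin> ?C}"
        unfolding V(1) 1(1) fst_conv by blast
      show "\<forall>y. snd A (Some y) = snd (U, \<phi>) y" by (simp add: V(1) 1(2))
      show "\<forall>c\<in>atlas ?X. \<forall>y\<in>fst c \<inter> fst (U, \<phi>). germ c (U, \<phi>) y \<and> germ (U, \<phi>) c y"
        using complex_surfaceD(3)[OF complex_surface_X2] 1(3) by blast
    qed
  next
    case 2
    let ?V = "{x \<in> points ?X. contraction ?E x \<in> V} - ?E"
    have in_V: "y \<in> ?V \<longleftrightarrow> Some y \<in> V" for y
    proof
      assume "Some y \<in> V"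
      then obtain x where "x \<in> points ?X" "Some y = contraction ?E x" using 2(2) by blast
      then show "y \<in> ?V" using \<open>Some y \<in> V\<close> unfolding contraction_def by (auto split: if_splits)
    qed (auto simp: contraction_def)
    show ?thesis
    proof (rule that[of "(?V, \<psi> \<circ> Some)"])
      show "inj_on (snd (?V, \<psi> \<circ> Some)) (fst (?V, \<psi> \<circ> Some))"
        using 2(3) in_V unfolding inj_on_def by auto
      \<comment> \<open>The new point belongs to \<open>?C\<close>, so every remaining point has the
        form \<open>Some y\<close>.\<close>
      have "V - ?C = Some ` {y. Some y \<in> V \<and> Some y \<notin> ?C}"
      proof
        show "V - ?C \<subseteq> Some ` {y. Some y \<in> V \<and> Some y \<notin> ?C}"
        proof
          fix x assume "x \<in> V - ?C"
          then show "x \<in> Some ` {y. Some y \<in> V \<and> Some y \<notin> ?C}"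
            using None_in_anticanonical[of \<alpha>] by (cases x) auto
        qed
      qed blast
      then show "fst A = Some ` {y \<in> fst (?V, \<psi> \<circ> Some). y \<notin> ?E \<and> Some y \<notin> ?C}"
        unfolding V(1) fst_conv using in_V by blast
      show "\<forall>y. snd A (Some y) = snd (?V, \<psi> \<circ> Some) y" by (simp add: V(1))
      show "\<forall>c\<in>atlas ?X. \<forall>y\<in>fst c \<inter> fst (?V, \<psi> \<circ> Some).
          germ c (?V, \<psi> \<circ> Some) y \<and> germ (?V, \<psi> \<circ> Some) c y"
      proof (intro ballI)
        fix c y assume c: "c \<in> atlas ?X" and "y \<in> fst c \<inter> fst (?V, \<psi> \<circ> Some)"
        then have "y \<in> fst c \<inter> ?V" unfolding fst_conv by blast
        then show "germ c (?V, \<psi> \<circ> Some) y \<and> germ (?V, \<psi> \<circ> Some) c y"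
          using compatible_chartD[OF 2(4) c complex_surfaceD(2)[OF complex_surface_X2 c]] by blast
      qed
    qed
  qed
qed

text \<open>By \<open>space_atlasE\<close> every chart of the open surface comes from some
  \<open>k\<close> compatible with all charts of \<open>X2 \<alpha>\<close>, and
  \<open>plane_chart\<close> is one of those. The germs only have to be carried through
  \<open>Some\<close> and the sign.\<close>

lemma compatible_chart_plane:
  assumes i: "i \<in> plane_index"
  shows "compatible_chart (space_of_initial_conditions \<alpha>) (plane_set \<alpha> i, plane_coord \<alpha> i)"
proof (rule compatible_chartI)
  show "plane_set \<alpha> i \<subseteq> points (space_of_initial_conditions \<alpha>)"
    unfolding plane_set_def points_space using i by blast
  show "inj_on (plane_coord \<alpha> i) (plane_set \<alpha> i)"
    unfolding plane_set_def using plane_coord_pt[OF i] by (intro inj_onI) auto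
  have "plane_coord \<alpha> i ` plane_set \<alpha> i = UNIV"
    unfolding plane_set_def image_image plane_coord_pt[OF i] by simp
  then show "open (plane_coord \<alpha> i ` plane_set \<alpha> i)" by simp
  fix A assume A: "A \<in> atlas (space_of_initial_conditions \<alpha>)"
  obtain k where k: "inj_on (snd k) (fst k)"
    "fst A = Some ` {y \<in> fst k. y \<notin> D_section_strict \<alpha> \<and> Some y \<notin> anticanonical_red \<alpha>}"
    "\<forall>y. snd A (Some y) = snd k y"
    and g: "\<forall>c\<in>atlas (X2 \<alpha>). \<forall>y\<in>fst c \<inter> fst k. germ c k y \<and> germ k c y"
    by (rule space_atlasE[OF A])
  have k3: "snd A (Some y) = snd k y" for y using k(3) ..
  show "inj_on (snd A) (fst A)"
    unfolding k(2) using k(1) k3 by (auto simp: inj_on_def)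
  have in_A: "Some (plane_pt \<alpha> i z) \<in> fst A \<longleftrightarrow> plane_pt \<alpha> i z \<in> fst k" for z
    unfolding k(2) using plane_pt_notin_strict(1)[OF i, of \<alpha> z] Some_plane_pt(2)[OF i, of \<alpha> z] by blast
  fix x assume "x \<in> fst A \<inter> plane_set \<alpha> i"
  then obtain z where x: "x = Some (plane_pt \<alpha> i z)" "plane_pt \<alpha> i z \<in> fst k"
    using in_A unfolding plane_set_def by blast
  have *: "germ (plane_chart \<alpha> i) k (plane_pt \<alpha> i z)" "germ k (plane_chart \<alpha> i) (plane_pt \<alpha> i z)"
    using bspec[OF g plane_chart_in_atlas[OF i]] x(2) unfolding plane_chart_range[OF i] by blast+
  have fk: "\<exists>w. y = plane_pt \<alpha> i w" if "y \<in> fst (plane_chart \<alpha> i)" for y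
    using that unfolding plane_chart_range[OF i] by blast
  show "germ A (plane_set \<alpha> i, plane_coord \<alpha> i) x \<and> germ (plane_set \<alpha> i, plane_coord \<alpha> i) A x"
  proof
    obtain N h where N: "open N" "snd k (plane_pt \<alpha> i z) \<in> N" "holo_on h N"
      and h: "\<forall>a\<in>N. \<exists>y\<in>fst k \<inter> fst (plane_chart \<alpha> i). snd k y = a \<and> snd (plane_chart \<alpha> i) y = h a"
      using *(2) unfolding germ_def by blast
    show "germ A (plane_set \<alpha> i, plane_coord \<alpha> i) x"
    proof (rule germI)
      show "open N" by (rule N(1))
      show "snd A x \<in> N" unfolding x(1) k3 by (rule N(2))
      show "holo_on (plane_sign i \<circ> h) N"
        by (rule holo_on_compose[OF N(3) holo_on_plane_sign]) (rule subset_UNIV)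
      fix a assume "a \<in> N"
      then obtain y where y: "y \<in> fst k" "y \<in> fst (plane_chart \<alpha> i)" "snd k y = a" "snd (plane_chart \<alpha> i) y = h a"
        using h by blast
      obtain w where w: "y = plane_pt \<alpha> i w" using fk[OF y(2)] by blast
      have "Some y \<in> fst A" using in_A y(1) unfolding w by blast
      moreover have "Some y \<in> plane_set \<alpha> i" unfolding w plane_set_def by blast
      moreover have "plane_coord \<alpha> i (Some y) = (plane_sign i \<circ> h) a"
        using y(4) by (simp add: plane_coord_def)
      ultimately show "\<exists>y\<in>fst A \<inter> fst (plane_set \<alpha> i, plane_coord \<alpha> i).
          snd A y = a \<and> snd (plane_set \<alpha> i, plane_coord \<alpha> i) y = (plane_sign i \<circ> h) a"
        using k3[of y] y(3) by (intro bexI[of _ "Some y"]) simp_all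
    qed
    obtain M h where M: "open M" "snd (plane_chart \<alpha> i) (plane_pt \<alpha> i z) \<in> M" "holo_on h M"
      and h: "\<forall>a\<in>M. \<exists>y\<in>fst (plane_chart \<alpha> i) \<inter> fst k. snd (plane_chart \<alpha> i) y = a \<and> snd k y = h a"
      using *(1) unfolding germ_def by blast
    show "germ (plane_set \<alpha> i, plane_coord \<alpha> i) A x"
    proof (rule germI)
      show "open (plane_sign i -` M)" using M(1) by (rule open_vimage_plane_sign)
      show "snd (plane_set \<alpha> i, plane_coord \<alpha> i) x \<in> plane_sign i -` M"
        using M(2) by (simp add: x(1) plane_coord_def)
      show "holo_on (h \<circ> plane_sign i) (plane_sign i -` M)"
        by (rule holo_on_compose[OF holo_on_plane_sign M(3)]) blast
      fix a assume "a \<in> plane_sign i -` M"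
      then obtain y where y: "y \<in> fst (plane_chart \<alpha> i)" "y \<in> fst k"
        "snd (plane_chart \<alpha> i) y = plane_sign i a" "snd k y = h (plane_sign i a)"
        using h by blast
      obtain w where w: "y = plane_pt \<alpha> i w" using fk[OF y(1)] by blast
      have "Some y \<in> fst A" using in_A y(2) unfolding w by blast
      moreover have "Some y \<in> plane_set \<alpha> i" unfolding w plane_set_def by blast
      moreover have "plane_coord \<alpha> i (Some y) = a"
        using y(3) by (simp add: plane_coord_def)
      ultimately show "\<exists>y\<in>fst (plane_set \<alpha> i, plane_coord \<alpha> i) \<inter> fst A.
          snd (plane_set \<alpha> i, plane_coord \<alpha> i) y = a \<and> snd A y = (h \<circ> plane_sign i) a"
        using k3[of y] y(4) by (intro bexI[of _ "Some y"]) simp_all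
    qed
  qed
qed

lemma glued_from_planes_space:
  "glued_from_planes (space_of_initial_conditions \<alpha>) plane_index (plane_coords \<alpha>) (plane_set \<alpha>) (plane_coord \<alpha>)"
proof -
  have surj: "plane_coord \<alpha> i ` plane_set \<alpha> i = UNIV" if i: "i \<in> plane_index" for i
    unfolding plane_set_def image_image plane_coord_pt[OF i] by simp
  have eq: "x = y \<longleftrightarrow> glue_rel (plane_coords \<alpha>) i (plane_coord \<alpha> i x) j (plane_coord \<alpha> j y)"
    if ij: "i \<in> plane_index" "j \<in> plane_index" and xy: "x \<in> plane_set \<alpha> i" "y \<in> plane_set \<alpha> j" for i j x y
  proof -
    obtain z w where zw: "x = Some (plane_pt \<alpha> i z)" "y = Some (plane_pt \<alpha> j w)"
      using xy unfolding plane_set_def by blast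
    show ?thesis unfolding zw plane_coord_pt[OF ij(1)] plane_coord_pt[OF ij(2)]
      using planes.glue_rel_iff[OF ij] by simp
  qed
  show ?thesis
    unfolding glued_from_planes_def
    using compatible_chart_plane surj eq points_space[of \<alpha>] unfolding plane_set_def[symmetric] by blast
qed

section \<open>Birational and symplectic maps\<close>

lemma poly2_simps:
  "poly2 (P + Q) z = poly2 P z + poly2 Q z" "poly2 (P - Q) z = poly2 P z - poly2 Q z"
  "poly2 (P * Q) z = poly2 P z * poly2 Q z" "poly2 (- P) z = - poly2 P z"
  "poly2 [:[:c:]:] z = c" "poly2 1 z = 1" "poly2 [:[:0, 1:]:] z = fst z" "poly2 [:0, 1:] z = snd z"
  by (simp_all add: poly2_def case_prod_beta)

lemma rational_map_flip: "rational_map (flip a)"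
  unfolding rational_map_def
proof (intro exI conjI allI impI)
  let ?X = "[:[:0, 1:]:] :: complex poly poly" and ?Y = "[:0, 1:] :: complex poly poly"
  show "?X \<noteq> 0" by simp
  fix z assume "poly2 ?X z \<noteq> 0"
  \<comment> \<open>The common denominator is \<open>q\<close>, so the polynomial second component
    appears with an additional factor \<open>q\<close> in the numerator.\<close>
  then show "flip a z = (poly2 1 z / poly2 ?X z, poly2 (- (?X * ?Y + [:[:a:]:]) * ?X * ?X) z / poly2 ?X z)"
    unfolding poly2_simps by (simp add: flip_def)
qed

lemma rational_map_unblow_map: "rational_map (unblow_map c \<beta>)"
  unfolding rational_map_def
proof (intro exI conjI allI impI)
  let ?X = "[:[:0, 1:]:] :: complex poly poly" and ?Y = "[:0, 1:] :: complex poly poly"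
  show "?Y \<noteq> 0" by simp
  fix z assume "poly2 ?Y z \<noteq> 0"
  then show "unblow_map c \<beta> z =
      (poly2 (- ((?X - [:[:c:]:]) * ?Y - [:[:\<beta>:]:]) * ?Y * ?Y) z / poly2 ?Y z, poly2 1 z / poly2 ?Y z)"
    unfolding poly2_simps by (simp add: unblow_map_def)
qed

lemma rational_map_recip_blow_map: "rational_map (recip \<circ> blow_map c \<beta>)"
  unfolding rational_map_def
proof (intro exI conjI allI impI)
  let ?X = "[:[:0, 1:]:] :: complex poly poly" and ?Y = "[:0, 1:] :: complex poly poly"
  show "?Y \<noteq> 0" by simp
  fix z assume "poly2 ?Y z \<noteq> 0"
  then show "(recip \<circ> blow_map c \<beta>) z =
      (poly2 (([:[:c:]:] + ([:[:\<beta>:]:] - ?X * ?Y) * ?Y) * ?Y) z / poly2 ?Y z, poly2 1 z / poly2 ?Y z)"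
    unfolding poly2_simps by (simp add: blow_map_def recip_def)
qed

lemma birational_flip: "birational (flip a)"
  unfolding birational_def
proof (intro conjI exI)
  show "[:[:0, 1:]:] \<noteq> (0 :: complex poly poly)" by simp
  show "\<forall>z. poly2 [:[:0, 1:]:] z \<noteq> 0 \<longrightarrow> flip a (flip a z) = z \<and> flip a (flip a z) = z"
    unfolding poly2_simps by simp
qed (rule rational_map_flip)+

lemma unblow_map_recip_blow_map:
  "snd z \<noteq> 0 \<Longrightarrow> unblow_map c \<beta> (recip (blow_map c \<beta> z)) = z"
  by (simp add: unblow_map_def blow_map_def prod_eq_iff)

lemma birational_unblow_map: "birational (unblow_map c \<beta>)"
  unfolding birational_def
proof (intro conjI exI)
  show "[:0, 1:] \<noteq> (0 :: complex poly poly)" by simp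
  show "\<forall>z. poly2 [:0, 1:] z \<noteq> 0 \<longrightarrow> (recip \<circ> blow_map c \<beta>) (unblow_map c \<beta> z) = z \<and>
      unblow_map c \<beta> ((recip \<circ> blow_map c \<beta>) z) = z"
    unfolding poly2_simps by (simp add: blow_map_unblow_map unblow_map_recip_blow_map)
qed (rule rational_map_unblow_map rational_map_recip_blow_map)+

definition symplectic_derivative :: "(c2 \<Rightarrow> c2) \<Rightarrow> (c2 \<Rightarrow> c2) \<Rightarrow> c2 \<Rightarrow> bool" where
  "symplectic_derivative f L z \<longleftrightarrow> (f has_derivative L) (at z) \<and> complex_linear L \<and>
     (\<forall>u v. area_form (L u) (L v) = area_form u v)"

lemma symplectic_derivative_compose:
  assumes "symplectic_derivative f L z" "symplectic_derivative g M (f z)"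
  shows "symplectic_derivative (g \<circ> f) (M \<circ> L) z"
  using assms unfolding symplectic_derivative_def
  by (simp add: diff_chain_at complex_linear_compose del: split_paired_All)

lemma symplectic_derivative_id: "\<exists>L. symplectic_derivative (\<lambda>z. z) L z"
  using complex_linear_Pair[of 1 0 0 1] unfolding symplectic_derivative_def
  by (intro exI[of _ "\<lambda>u. u"]) simp

lemma symplectic_derivative_flip:
  assumes "fst z \<noteq> 0" shows "\<exists>L. symplectic_derivative (flip a) L z"
proof -
  let ?L = "\<lambda>u. ((- 1 / (fst z * fst z)) * fst u + 0 * snd u,
      (- (2 * fst z * snd z + a)) * fst u + (- (fst z * fst z)) * snd u)"
  have "(flip a has_derivative ?L) (at z)"
    unfolding flip_def[abs_def] using assms
    by (auto intro!: derivative_eq_intros simp: fun_eq_iff algebra_simps divide_simps)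
  moreover have "area_form (?L u) (?L v) = area_form u v" for u v
    using assms by (simp add: area_form_def field_simps)
  ultimately show ?thesis unfolding symplectic_derivative_def using complex_linear_Pair by blast
qed

lemma symplectic_derivative_unblow_map:
  assumes "snd z \<noteq> 0" shows "\<exists>L. symplectic_derivative (unblow_map c \<beta>) L z"
proof -
  let ?L = "\<lambda>u. ((- (snd z * snd z)) * fst u + (\<beta> - 2 * (fst z - c) * snd z) * snd u,
      0 * fst u + (- 1 / (snd z * snd z)) * snd u)"
  have "(unblow_map c \<beta> has_derivative ?L) (at z)"
    unfolding unblow_map_def[abs_def] using assms
    by (auto intro!: derivative_eq_intros simp: fun_eq_iff algebra_simps divide_simps)
  moreover have "area_form (?L u) (?L v) = area_form u v" for u v
    using assms by (simp add: area_form_def field_simps)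
  ultimately show ?thesis unfolding symplectic_derivative_def using complex_linear_Pair by blast
qed

lemma symplecticI:
  assumes "open G" "closure G = UNIV" "\<And>z. z \<in> G \<Longrightarrow> \<exists>L. symplectic_derivative f L z"
  shows "symplectic f"
  using assms unfolding symplectic_def symplectic_derivative_def by blast

lemma symplectic_flip: "symplectic (flip a)"
proof (rule symplecticI[OF open_generic dense_generic])
  \<comment> \<open>With parameter 0 the set is the complement of the coordinate axes, where
    \<open>flip a\<close> is regular for every \<open>a\<close>.\<close>
  fix z assume "z \<in> generic 0"
  then show "\<exists>L. symplectic_derivative (flip a) L z"
    by (intro symplectic_derivative_flip) (simp add: generic_def)
qed

lemma symplectic_unblow_map: "symplectic (unblow_map c \<beta>)"
proof (rule symplecticI[OF open_generic dense_generic])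
  fix z assume "z \<in> generic 0"
  then show "\<exists>L. symplectic_derivative (unblow_map c \<beta>) L z"
    by (intro symplectic_derivative_unblow_map) (simp add: generic_def)
qed

lemma r_map_simps:
  "r_map \<alpha> 0 = flip (\<alpha> 0)"
  "j \<in> {1..6} \<Longrightarrow> r_map \<alpha> j =
     unblow_map (centre_coord (fst (plane_centre \<alpha> j))) (snd (plane_centre \<alpha> j))"
proof -
  show "r_map \<alpha> 0 = flip (\<alpha> 0)" by (simp add: r_map_def flip_def fun_eq_iff)
  assume "j \<in> {1..6}"
  then have "j = 1 \<or> j = 2 \<or> j = 3 \<or> j = 4 \<or> j = 5 \<or> j = 6" by auto
  then show "r_map \<alpha> j = unblow_map (centre_coord (fst (plane_centre \<alpha> j))) (snd (plane_centre \<alpha> j))"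
    by (elim disjE) (simp_all add: fun_eq_iff r_map_def plane_centre_def
      centre_coord_def unblow_map_def mult.commute)
qed

lemma r_map_birational_symplectic:
  assumes "j \<in> {0..6}" shows "birational (r_map \<alpha> j) \<and> symplectic (r_map \<alpha> j)"
proof (cases "j = 0")
  case True
  then show ?thesis by (simp add: r_map_simps(1) birational_flip symplectic_flip)
next
  case False
  then have "j \<in> {1..6}" using assms by auto
  then show ?thesis by (simp only: r_map_simps(2) birational_unblow_map symplectic_unblow_map simp_thms)
qed


section \<open>Hamiltonian vector fields\<close>

text \<open>An inductive class instead of polynomials with coefficients: its rules follow the shape
  of the formulas, and an induction shows that partial derivatives stay in the class. Hamiltonian
  fields of its members are thus holomorphic on the whole plane.\<close>

inductive polyfun :: "(c2 \<Rightarrow> complex) \<Rightarrow> bool" where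
  const: "polyfun (\<lambda>z. c)"
| fst: "polyfun fst"
| snd: "polyfun snd"
| add: "polyfun F \<Longrightarrow> polyfun G \<Longrightarrow> polyfun (\<lambda>z. F z + G z)"
| mult: "polyfun F \<Longrightarrow> polyfun G \<Longrightarrow> polyfun (\<lambda>z. F z * G z)"

lemma polyfun_minus: "polyfun F \<Longrightarrow> polyfun (\<lambda>z. - F z)"
  using polyfun.mult[OF polyfun.const[of "- 1"]] by simp

lemma polyfun_diff: "polyfun F \<Longrightarrow> polyfun G \<Longrightarrow> polyfun (\<lambda>z. F z - G z)"
  using polyfun.add[OF _ polyfun_minus, of F G] by simp

lemma polyfun_poly: "polyfun F \<Longrightarrow> polyfun (\<lambda>z. poly P (F z))"
  by (induction P) (auto intro: polyfun.intros)

lemmas polyfun_intros = polyfun.intros polyfun_minus polyfun_diff polyfun_poly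

lemma polyfun_derivative:
  assumes "polyfun F"
  shows "\<exists>A B. polyfun A \<and> polyfun B \<and> (\<forall>z. (F has_derivative (\<lambda>u. A z * fst u + B z * snd u)) (at z))"
  using assms
proof induction
  case (const c)
  show ?case
    by (rule exI[of _ "\<lambda>z. 0"], rule exI[of _ "\<lambda>z. 0"]) (auto intro: polyfun.const)
next
  case fst
  show ?case
    by (rule exI[of _ "\<lambda>z. 1"], rule exI[of _ "\<lambda>z. 0"]) (auto intro!: polyfun.const derivative_eq_intros)
next
  case snd
  show ?case
    by (rule exI[of _ "\<lambda>z. 0"], rule exI[of _ "\<lambda>z. 1"]) (auto intro!: polyfun.const derivative_eq_intros)
next
  case (add F G)
  then obtain A B A' B' where *: "polyfun A" "polyfun B" "polyfun A'" "polyfun B'"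
    "\<And>z. (F has_derivative (\<lambda>u. A z * fst u + B z * snd u)) (at z)"
    "\<And>z. (G has_derivative (\<lambda>u. A' z * fst u + B' z * snd u)) (at z)"
    by blast
  have "((\<lambda>z. F z + G z) has_derivative (\<lambda>u. (A z + A' z) * fst u + (B z + B' z) * snd u)) (at z)" for z
    using *(5,6)[of z] by (auto intro!: derivative_eq_intros simp: algebra_simps)
  then show ?case using *(1-4) by (intro exI[of _ "\<lambda>z. A z + A' z"] exI[of _ "\<lambda>z. B z + B' z"])
    (auto intro: polyfun.add)
next
  case (mult F G)
  then obtain A B A' B' where *: "polyfun A" "polyfun B" "polyfun A'" "polyfun B'"
    "\<And>z. (F has_derivative (\<lambda>u. A z * fst u + B z * snd u)) (at z)"
    "\<And>z. (G has_derivative (\<lambda>u. A' z * fst u + B' z * snd u)) (at z)"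
    by blast
  have "((\<lambda>z. F z * G z) has_derivative
      (\<lambda>u. (A z * G z + F z * A' z) * fst u + (B z * G z + F z * B' z) * snd u)) (at z)" for z
    using *(5,6)[of z] by (auto intro!: derivative_eq_intros simp: algebra_simps)
  then show ?case using *(1-4) mult.hyps
    by (intro exI[of _ "\<lambda>z. A z * G z + F z * A' z"] exI[of _ "\<lambda>z. B z * G z + F z * B' z"])
      (auto intro: polyfun.add polyfun.mult)
qed

lemma polyfun_cdiff: "polyfun F \<Longrightarrow> cdiff F z"
  using polyfun_derivative[of F] unfolding cdiff_def by blast

lemma hamiltonian_field_eq:
  assumes "(F has_derivative (\<lambda>u. A * fst u + B * snd u)) (at z)"
  shows "hamiltonian_field (\<lambda>q p. F (q, p)) z = (B, - A)"
proof -
  have F: "(F has_derivative (\<lambda>u. A * fst u + B * snd u)) (at (fst z, snd z))" using assms by simp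
  have 1: "((\<lambda>p. (fst z, p)) has_derivative (\<lambda>t. (0, t))) (at (snd z))"
    and 2: "((\<lambda>q. (q, snd z)) has_derivative (\<lambda>t. (t, 0))) (at (fst z))"
    by (auto intro!: derivative_eq_intros)
  have "((\<lambda>p. F (fst z, p)) has_derivative (\<lambda>t. B * t)) (at (snd z))"
    using has_derivative_compose[OF 1, of F "\<lambda>u. A * fst u + B * snd u"] F by simp
  then have "deriv (\<lambda>p. F (fst z, p)) (snd z) = B"
    by (intro DERIV_imp_deriv) (simp add: has_field_derivative_def)
  moreover have "((\<lambda>q. F (q, snd z)) has_derivative (\<lambda>t. A * t)) (at (fst z))"
    using has_derivative_compose[OF 2, of F "\<lambda>u. A * fst u + B * snd u"] F by simp
  then have "deriv (\<lambda>q. F (q, snd z)) (fst z) = A"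
    by (intro DERIV_imp_deriv) (simp add: has_field_derivative_def)
  ultimately show ?thesis by (simp add: hamiltonian_field_def case_prod_beta)
qed

text \<open>The chain rule writes \<open>P\<close> and \<open>Q\<close> as combinations of
  \<open>A\<close> and \<open>B\<close> with the entries of \<open>L\<close> as coefficients. In
  dimension two, preserving the area form means determinant 1, and this turns
  \<open>L (Q, - P)\<close> back into \<open>(B, - A)\<close>.\<close>

lemma symplectic_derivative_hamiltonian:
  assumes L: "symplectic_derivative f L z" and N: "open N" "z \<in> N"
    and eq: "\<And>w. w \<in> N \<Longrightarrow> K (f w) = F w"
    and K: "(K has_derivative (\<lambda>u. A * fst u + B * snd u)) (at (f z))"
    and F: "(F has_derivative (\<lambda>u. P * fst u + Q * snd u)) (at z)"
  shows "L (Q, - P) = (B, - A)"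
proof -
  have "((\<lambda>w. K (f w)) has_derivative (\<lambda>u. A * fst (L u) + B * snd (L u))) (at z)"
    using L K has_derivative_compose[of f L z UNIV K] unfolding symplectic_derivative_def by blast
  then have "(F has_derivative (\<lambda>u. A * fst (L u) + B * snd (L u))) (at z)"
    by (rule has_derivative_transform_within_open[OF _ N]) (rule eq)
  then have dF: "A * fst (L u) + B * snd (L u) = P * fst u + Q * snd u" for u
    using has_derivative_unique[OF _ F] by metis
  have lin: "linear L" "\<And>c a b. L (c * a, c * b) = (c * fst (L (a, b)), c * snd (L (a, b)))"
    using L unfolding symplectic_derivative_def complex_linear_def by blast+
  obtain a b where ab: "L (1, 0) = (a, b)" by fastforce
  obtain c d where cd: "L (0, 1) = (c, d)" by fastforce
  have "area_form (L (1, 0)) (L (0, 1)) = area_form (1, 0) (0, 1)"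
    using L unfolding symplectic_derivative_def by blast
  then have det: "a * d - b * c = 1" by (simp add: ab cd area_form_def)
  have P: "P = A * a + B * b" and Q: "Q = A * c + B * d"
    using dF[of "(1, 0)"] dF[of "(0, 1)"] by (simp_all add: ab cd)
  have "L (Q, - P) = L (Q, 0) + L (0, - P)"
    using linear_add[OF lin(1), of "(Q, 0)" "(0, - P)"] by simp
  also have "\<dots> = (Q * a - P * c, Q * b - P * d)"
    using lin(2)[of Q 1 0] lin(2)[of "- P" 0 1] by (simp add: ab cd)
  also have "\<dots> = (B, - A)"
    using det unfolding P Q by (simp add: prod_eq_iff) algebra
  finally show ?thesis .
qed

text \<open>The form of the Hamiltonian in coordinates \<open>(r, p)\<close> such that two of the centres
  of the second blow-up lie on \<open>r = 0\<close>, \<open>p = \<infinity>\<close>, namely at \<open>r p = b\<close> and \<open>r p = b'\<close>.\<close>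
definition normal_form ::
    "complex \<Rightarrow> complex \<Rightarrow> complex \<Rightarrow> complex poly \<Rightarrow> complex poly \<Rightarrow> complex \<Rightarrow> c2 \<Rightarrow> complex" where
  "normal_form c b b' A B r0 z = c * snd z * ((fst z - r0) * snd z - b) * ((fst z - r0) * snd z - b')
     + poly A ((fst z - r0) * snd z) + (fst z - r0) * poly B ((fst z - r0) * snd z)"

lemma polyfun_normal_form: "polyfun (normal_form c b b' A B r0)"
  unfolding normal_form_def[abs_def] by (intro polyfun_intros)

lemma normal_form_commute: "normal_form c b b' A B r0 = normal_form c b' b A B r0"
  unfolding normal_form_def by (simp add: algebra_simps)

text \<open>Put \<open>m = r p = b - x y\<close>. The pole of \<open>p = 1 / y\<close> meets the
  factor \<open>m - b = - x y\<close> and leaves \<open>- x\<close>, while \<open>r = m y\<close>.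
  The result is polynomial for all \<open>A\<close> and \<open>B\<close>.\<close>

lemma normal_form_unblow_map:
  "\<exists>K. polyfun K \<and> (\<forall>z. snd z \<noteq> 0 \<longrightarrow> K (unblow_map r0 b z) = normal_form c b b' A B r0 z)"
proof (intro exI conjI allI impI)
  let ?m = "\<lambda>z. b - fst z * snd z"
  let ?K = "\<lambda>z. - c * fst z * (?m z - b') + poly A (?m z) + ?m z * snd z * poly B (?m z)"
  show "polyfun ?K" by (intro polyfun_intros)
  fix z :: c2 assume z: "snd z \<noteq> 0"
  have m: "?m (unblow_map r0 b z) = (fst z - r0) * snd z" using z by (simp add: unblow_map_def)
  have f: "fst (unblow_map r0 b z) = - ((fst z - r0) * snd z - b) * snd z"
    "snd (unblow_map r0 b z) = 1 / snd z"
    by (simp_all add: unblow_map_def)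
  show "?K (unblow_map r0 b z) = normal_form c b b' A B r0 z"
    unfolding m f normal_form_def using z by simp algebra
qed

text \<open>\<open>ham_c\<close>, \<open>ham_d\<close> and \<open>ham_k\<close> are the coefficients of \<open>q\<^sup>2 p\<close>, \<open>q p\<close> and \<open>q\<close> in the
  Hamiltonian.\<close>
definition ham_sum :: "(nat \<Rightarrow> complex) \<Rightarrow> complex" where
  "ham_sum \<alpha> = \<alpha> 1 + 2 * \<alpha> 2 + \<alpha> 3 + 2 * \<alpha> 4"

definition ham_c :: "(nat \<Rightarrow> complex) \<Rightarrow> complex" where
  "ham_c \<alpha> = - 3 * (\<alpha> 0)^2 - 2 * \<alpha> 0 * ham_sum \<alpha> - 3 * \<alpha> 0 * \<alpha> 5 - \<alpha> 5 * (ham_sum \<alpha> + \<alpha> 5)"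

definition ham_d :: "(nat \<Rightarrow> complex) \<Rightarrow> complex" where
  "ham_d \<alpha> = 3 * (\<alpha> 0)^2 - (\<alpha> 2)^2 + 2 * \<alpha> 0 * ham_sum \<alpha> + 3 * \<alpha> 0 * \<alpha> 5
     + 2 * \<alpha> 2 * \<alpha> 5 + \<alpha> 1 * (\<alpha> 5 - \<alpha> 2) + (\<alpha> 4 + \<alpha> 5) * (\<alpha> 3 + \<alpha> 4 + \<alpha> 5)"

definition ham_k :: "(nat \<Rightarrow> complex) \<Rightarrow> complex" where
  "ham_k \<alpha> = \<alpha> 0 * (\<alpha> 0 + \<alpha> 5) * (\<alpha> 0 + \<alpha> 5 + \<alpha> 6)"

lemma ham_I_eq:
  "ham_I \<alpha> q p = (q - 1)^2 * q^2 * p^3 - q * (q - 1) * (ham_sum \<alpha> * q - \<alpha> 1 - 2 * \<alpha> 2) * p^2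
     + (ham_c \<alpha> * q^2 + ham_d \<alpha> * q + \<alpha> 2 * (\<alpha> 1 + \<alpha> 2)) * p + ham_k \<alpha> * q"
  unfolding ham_I_def ham_c_def ham_d_def ham_k_def ham_sum_def by (simp add: algebra_simps)

text \<open>Sort the monomials \<open>q^i p^j\<close> of the Hamiltonian by the weight
  \<open>i - j\<close>, which is -1, 0 or 1. Weight 0 gives \<open>ham_A\<close> evaluated at
  \<open>q p\<close>, weight 1 gives \<open>q\<close> times \<open>ham_B\<close> at
  \<open>q p\<close>, and weight -1 gives
  \<open>p (q p - \<alpha> 2) (q p - (\<alpha> 1 + \<alpha> 2))\<close>.\<close>

definition ham_A :: "(nat \<Rightarrow> complex) \<Rightarrow> complex poly" where
  "ham_A \<alpha> = [:0, ham_d \<alpha>, ham_sum \<alpha> + \<alpha> 1 + 2 * \<alpha> 2, - 2:]"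

definition ham_B :: "(nat \<Rightarrow> complex) \<Rightarrow> complex poly" where
  "ham_B \<alpha> = [:ham_k \<alpha>, ham_c \<alpha>, - ham_sum \<alpha>, 1:]"

lemma ham_I_at_0: "ham_I \<alpha> (fst z) (snd z) = normal_form 1 (\<alpha> 1 + \<alpha> 2) (\<alpha> 2) (ham_A \<alpha>) (ham_B \<alpha>) 0 z"
  unfolding ham_I_eq normal_form_def ham_A_def ham_B_def poly_pCons poly_0 by algebra

text \<open>Expanding in \<open>r = q - 1\<close> keeps the part of weight 1 and yields the
  displayed polynomial in weight 0. In weight -1 the quadratic factor has to have the roots
  \<open>\<alpha> 4\<close> and \<open>\<alpha> 3 + \<alpha> 4\<close>: identity 1 gives their
  product and identity 2 their sum.\<close>

lemma ham_I_at_1: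
  "ham_I \<alpha> (fst z) (snd z) = normal_form 1 (\<alpha> 3 + \<alpha> 4) (\<alpha> 4)
     [:ham_k \<alpha>, 2 * ham_c \<alpha> + ham_d \<alpha>, \<alpha> 1 + 2 * \<alpha> 2 - 2 * ham_sum \<alpha>, 2:] (ham_B \<alpha>) 1 z"
proof -
  have 1: "ham_c \<alpha> + ham_d \<alpha> + \<alpha> 2 * (\<alpha> 1 + \<alpha> 2) = \<alpha> 4 * (\<alpha> 3 + \<alpha> 4)"
    unfolding ham_c_def ham_d_def ham_sum_def by algebra
  have 2: "ham_sum \<alpha> - (\<alpha> 1 + 2 * \<alpha> 2) = \<alpha> 3 + 2 * \<alpha> 4"
    unfolding ham_sum_def by algebra
  show ?thesis
    unfolding ham_I_eq normal_form_def ham_B_def poly_pCons poly_0 using 1 2 by algebra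
qed

text \<open>The relation between the parameters fixes \<open>ham_sum\<close> and thereby the sum of
  the roots. As \<open>x y = - (q p + \<alpha> 0)\<close> at infinity, the root
  \<open>- \<alpha> 0\<close> corresponds to \<open>x y = 0\<close>, and the other two to the
  centres \<open>x y = \<alpha> 5\<close> and \<open>x y = \<alpha> 5 + \<alpha> 6\<close>.\<close>

lemma ham_B_factor:
  assumes "3 * \<alpha> 0 + \<alpha> 1 + 2 * \<alpha> 2 + \<alpha> 3 + 2 * \<alpha> 4 + 2 * \<alpha> 5 + \<alpha> 6 = 0"
  shows "poly (ham_B \<alpha>) m = (m + \<alpha> 0) * (m + \<alpha> 0 + \<alpha> 5) * (m + \<alpha> 0 + \<alpha> 5 + \<alpha> 6)"
proof -
  have "ham_sum \<alpha> = - (3 * \<alpha> 0 + 2 * \<alpha> 5 + \<alpha> 6)"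
    using assms unfolding ham_sum_def by algebra
  then show ?thesis unfolding ham_B_def ham_c_def ham_k_def poly_pCons poly_0 by algebra
qed

text \<open>With \<open>(x, y)\<close> the coordinates at infinity, \<open>q p = - (x y + \<alpha>\<^sub>0)\<close>; the factor
  \<open>q p + \<alpha>\<^sub>0\<close> of \<open>ham_B\<close> cancels the pole of \<open>q\<close>.\<close>
lemma ham_I_at_infinity:
  assumes "3 * \<alpha> 0 + \<alpha> 1 + 2 * \<alpha> 2 + \<alpha> 3 + 2 * \<alpha> 4 + 2 * \<alpha> 5 + \<alpha> 6 = 0" and z: "fst z \<noteq> 0"
  shows "ham_I \<alpha> (fst z) (snd z) = normal_form (- 1) (\<alpha> 5) (\<alpha> 5 + \<alpha> 6)
    (pcompose (ham_A \<alpha>) [:- \<alpha> 0, - 1:])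
    (pcompose ([:0, 1:] * [:- \<alpha> 2, 1:] * [:- (\<alpha> 1 + \<alpha> 2), 1:]) [:- \<alpha> 0, - 1:]) 0 (flip (\<alpha> 0) z)"
proof -
  define q p where qp: "q = fst z" "p = snd z"
  define x y where xy: "x = fst (flip (\<alpha> 0) z)" "y = snd (flip (\<alpha> 0) z)"
  have u: "x * y = - (q * p + \<alpha> 0)" using z by (simp add: xy qp flip_def)
  then have m: "- \<alpha> 0 - x * y = q * p" by simp
  have y: "y = - (q * p + \<alpha> 0) * q" by (simp add: xy qp flip_def)
  have x: "q * x = 1" using z by (simp add: xy qp)
  have "normal_form (- 1) (\<alpha> 5) (\<alpha> 5 + \<alpha> 6)
      (pcompose (ham_A \<alpha>) [:- \<alpha> 0, - 1:])
      (pcompose ([:0, 1:] * [:- \<alpha> 2, 1:] * [:- (\<alpha> 1 + \<alpha> 2), 1:]) [:- \<alpha> 0, - 1:]) 0 (flip (\<alpha> 0) z) =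
    - y * (x * y - \<alpha> 5) * (x * y - (\<alpha> 5 + \<alpha> 6)) + poly (ham_A \<alpha>) (- \<alpha> 0 - x * y)
      + x * ((- \<alpha> 0 - x * y) * (- \<alpha> 0 - x * y - \<alpha> 2) * (- \<alpha> 0 - x * y - (\<alpha> 1 + \<alpha> 2)))"
    unfolding normal_form_def xy[symmetric] poly_pcompose by (simp add: algebra_simps)
  also have "\<dots> = - y * (x * y - \<alpha> 5) * (x * y - (\<alpha> 5 + \<alpha> 6)) + poly (ham_A \<alpha>) (q * p)
      + x * (q * p * (q * p - \<alpha> 2) * (q * p - (\<alpha> 1 + \<alpha> 2)))"
    unfolding m ..
  \<comment> \<open>Passing to \<open>x = 1 / q\<close> exchanges the weights -1 and 1, so the part
    that is singular at \<open>q = 0\<close>, \<open>p = \<infinity>\<close> supplies the regular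
    term at infinity.\<close>
  also have "x * (q * p * (q * p - \<alpha> 2) * (q * p - (\<alpha> 1 + \<alpha> 2))) = p * (q * p - \<alpha> 2) * (q * p - (\<alpha> 1 + \<alpha> 2))"
    using x by algebra
  \<comment> \<open>The leading constant -1 arises from \<open>q (q p + \<alpha> 0) = - y\<close>;
    the signs of the two other factors cancel.\<close>
  also have "- y * (x * y - \<alpha> 5) * (x * y - (\<alpha> 5 + \<alpha> 6)) = q * poly (ham_B \<alpha>) (q * p)"
    unfolding ham_B_factor[OF assms(1)] u using y by algebra
  finally have nf: "normal_form (- 1) (\<alpha> 5) (\<alpha> 5 + \<alpha> 6)
      (pcompose (ham_A \<alpha>) [:- \<alpha> 0, - 1:])
      (pcompose ([:0, 1:] * [:- \<alpha> 2, 1:] * [:- (\<alpha> 1 + \<alpha> 2), 1:]) [:- \<alpha> 0, - 1:]) 0 (flip (\<alpha> 0) z) =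
    q * poly (ham_B \<alpha>) (q * p) + poly (ham_A \<alpha>) (q * p) + p * (q * p - \<alpha> 2) * (q * p - (\<alpha> 1 + \<alpha> 2))" .
  have "normal_form 1 (\<alpha> 1 + \<alpha> 2) (\<alpha> 2) (ham_A \<alpha>) (ham_B \<alpha>) 0 z =
    q * poly (ham_B \<alpha>) (q * p) + poly (ham_A \<alpha>) (q * p) + p * (q * p - \<alpha> 2) * (q * p - (\<alpha> 1 + \<alpha> 2))"
    unfolding normal_form_def qp[symmetric] by simp
  then show ?thesis unfolding nf ham_I_at_0 .
qed

lemma polyfun_ham_I: "polyfun (\<lambda>z. ham_I \<alpha> (fst z) (snd z))"
  unfolding ham_I_at_0 by (rule polyfun_normal_form)

section \<open>Extension of the vector field to the planes\<close>

text \<open>The part of the \<open>(q, p)\<close> plane that lies in plane \<open>i\<close>. As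
  \<open>field_extends\<close> demands a derivative at every such point, a dense subset would not
  do. \<open>Some 0\<close> stands for any finite centre, since \<open>base_map\<close> ignores the
  value.\<close>

definition plane_domain :: "(nat \<Rightarrow> complex) \<Rightarrow> nat option \<Rightarrow> c2 set" where
  "plane_domain \<alpha> i = (let k = fst (plane_hirz \<alpha> i) in
     {z. (k \<in> {1, 3} \<longrightarrow> fst z \<noteq> 0) \<and> (k \<ge> 2 \<longrightarrow> snd (base_map (\<alpha> 0) (if k = 3 then None else Some 0) z) \<noteq> 0)})"

lemma hirz_model_0_range:
  assumes "k \<in> {0..3}" "hirz_model a k w = hirz_model a 0 z"
  shows "(k \<in> {1, 3} \<longrightarrow> fst z \<noteq> 0) \<and> (k \<ge> 2 \<longrightarrow> snd (base_map a (if k = 3 then None else Some 0) z) \<noteq> 0)"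
  using assms(1)
proof (cases rule: le_3_cases)
  case 1
  then show ?thesis by simp
next
  case 2
  then show ?thesis using assms(2) by (auto simp: hirz_model_simps split: if_splits)
next
  case 3
  then show ?thesis using hirz_model_2_0[of a w z] assms(2) by (auto simp: base_map_def)
next
  case 4
  have *: "snd w \<noteq> 0" "fst w \<noteq> 0" "flip a (recip w) = z"
    using hirz_model_3_0[of a w z] assms(2) 4 by simp_all
  then have "flip a z = recip w" "fst z \<noteq> 0" by auto
  then show ?thesis using * 4 by (simp add: base_map_def)
qed

text \<open>Ensures that the formulas of \<open>plane_coords\<close> are differentiated only where
  no denominator vanishes; \<open>plane_coord_qp\<close> is the converse.\<close>

lemma plane_pt_eq_base:
  assumes i: "i \<in> plane_index" and eq: "plane_pt \<alpha> i w = base_pt (\<alpha> 0) 0 z"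
  shows "z \<in> plane_domain \<alpha> i"
proof -
  let ?k = "fst (plane_hirz \<alpha> i)" and ?h = "snd (plane_hirz \<alpha> i)"
  have k: "?k \<in> {0..3}" by (rule plane_hirz(1)[OF i])
  have "?k < 2 \<or> snd (?h w) \<noteq> 0"
    using i
  proof (cases rule: plane_index_cases)
    case (3 j)
    then show ?thesis using eq
      by (auto simp: plane_pt_def case_prod_beta exc_pt_def plane_hirz_def blow_map_def base_pt_def split: if_splits)
  qed (simp_all add: plane_hirz_def)
  then have "hirz_pt (\<alpha> 0) ?k (?h w) = hirz_pt (\<alpha> 0) 0 z"
    using eq plane_pt_hirz[OF i] by (simp add: base_pt_def)
  then have "hirz_model (\<alpha> 0) ?k (?h w) = hirz_model (\<alpha> 0) 0 z"
    using k by (simp add: hirz_pt_eq_iff)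
  then show ?thesis unfolding plane_domain_def Let_def mem_Collect_eq by (rule hirz_model_0_range[OF k])
qed

lemma plane_domain_simps:
  "plane_domain \<alpha> None = UNIV"
  "plane_domain \<alpha> (Some 0) = {z. fst z \<noteq> 0}"
  "j \<in> {1..6} \<Longrightarrow> plane_domain \<alpha> (Some j) =
     {z. (fst (plane_centre \<alpha> j) = None \<longrightarrow> fst z \<noteq> 0) \<and>
       snd (base_map (\<alpha> 0) (fst (plane_centre \<alpha> j)) z) \<noteq> 0}"
  by (auto simp: plane_domain_def plane_hirz_def centre_plane_def base_map_def split: option.split)

lemma base_map_model:
  assumes "\<nu> = None \<longrightarrow> fst z \<noteq> 0" "snd (base_map a \<nu> z) \<noteq> 0"
  shows "hirz_pt a (centre_plane \<nu>) (recip (base_map a \<nu> z)) = hirz_pt a 0 z"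
  using assms hirz_pt_recip[of "recip (base_map a \<nu> z)" a] hirz_pt_flip[of "flip a z" a]
  by (cases \<nu>) (simp_all add: centre_plane_def base_map_def)

lemma plane_coord_qp:
  assumes i: "i \<in> plane_index" and z: "z \<in> plane_domain \<alpha> i"
  shows "plane_pt \<alpha> i (plane_coords \<alpha> i z) = base_pt (\<alpha> 0) 0 z"
  using i
proof (cases rule: plane_index_cases)
  case 1
  then show ?thesis by (simp add: plane_pt_def plane_coords_simps hirz_coords_simps)
next
  case 2
  then have "fst z \<noteq> 0" using z by (simp add: plane_domain_simps)
  then show ?thesis using 2 hirz_pt_flip[of "flip (\<alpha> 0) z" "\<alpha> 0"]
    by (simp add: plane_pt_def plane_coords_simps hirz_coords_simps base_pt_def)
next
  case (3 j)
  let ?\<nu> = "fst (plane_centre \<alpha> j)"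
  have b: "?\<nu> = None \<longrightarrow> fst z \<noteq> 0" "snd (base_map (\<alpha> 0) ?\<nu> z) \<noteq> 0"
    using z 3 by (simp_all add: plane_domain_simps)
  have "snd (plane_coords \<alpha> i z) \<noteq> 0"
    using b(2) 3 by (simp add: plane_coords_simps(3) unblow_map_def)
  moreover have "blow_map (centre_coord ?\<nu>) (snd (plane_centre \<alpha> j)) (plane_coords \<alpha> i z) = recip (base_map (\<alpha> 0) ?\<nu> z)"
    using b(2) 3 by (simp add: plane_coords_simps(3) blow_map_unblow_map)
  ultimately show ?thesis
    using 3 base_map_model[OF b] by (simp add: plane_pt_def case_prod_beta exc_pt_def base_pt_def)
qed

lemma open_plane_domain:
  assumes "i \<in> plane_index" shows "open (plane_domain \<alpha> i)"
  using assms
proof (cases rule: plane_index_cases)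
  case 1
  then show ?thesis by (simp add: plane_domain_simps)
next
  case 2
  then show ?thesis by (simp add: plane_domain_simps open_Collect_neq continuous_intros)
next
  case (3 j)
  show ?thesis
  proof (cases "fst (plane_centre \<alpha> j)")
    case None
    have "{z. fst z \<noteq> 0 \<and> snd (flip (\<alpha> 0) z) \<noteq> 0} = {z. fst z \<noteq> 0} \<inter> {z. - (fst z * snd z + \<alpha> 0) * fst z \<noteq> 0}"
      by (auto simp: flip_def)
    also have "open \<dots>" by (intro open_Int open_Collect_neq continuous_intros)
    finally show ?thesis using 3 None by (simp add: plane_domain_simps base_map_def)
  next
    case (Some c)
    have "open {z :: c2. snd z \<noteq> 0}" by (intro open_Collect_neq continuous_intros)
    then show ?thesis using 3 Some by (simp add: plane_domain_simps base_map_def)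
  qed
qed

lemma symplectic_derivative_plane_coords:
  assumes i: "i \<in> plane_index" and z: "z \<in> plane_domain \<alpha> i"
  shows "\<exists>L. symplectic_derivative (plane_coords \<alpha> i) L z"
  using i
proof (cases rule: plane_index_cases)
  case 1
  then show ?thesis by (simp add: plane_coords_simps hirz_coords_simps symplectic_derivative_id)
next
  case 2
  then show ?thesis using z symplectic_derivative_flip
    by (simp add: plane_coords_simps hirz_coords_simps plane_domain_simps)
next
  case (3 j)
  let ?b = "base_map (\<alpha> 0) (fst (plane_centre \<alpha> j))"
  have b: "fst (plane_centre \<alpha> j) = None \<longrightarrow> fst z \<noteq> 0" "snd (?b z) \<noteq> 0"
    using z 3 by (simp_all add: plane_domain_simps)
  have "\<exists>L. symplectic_derivative ?b L z"
    using b(1) by (cases "fst (plane_centre \<alpha> j)")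
      (simp_all add: base_map_def symplectic_derivative_id symplectic_derivative_flip)
  moreover have "\<exists>L. symplectic_derivative (unblow_map (centre_coord (fst (plane_centre \<alpha> j))) (snd (plane_centre \<alpha> j))) L (?b z)"
    using b(2) by (rule symplectic_derivative_unblow_map)
  ultimately show ?thesis
    using 3 symplectic_derivative_compose unfolding 3(2) plane_coords_simps(3)[OF 3(1)] by blast
qed

text \<open>One normal form serves both centres on an exceptional curve, since it is symmetric in
  them by \<open>normal_form_commute\<close>.\<close>

lemma ham_I_plane:
  assumes hyp: "3 * \<alpha> 0 + \<alpha> 1 + 2 * \<alpha> 2 + \<alpha> 3 + 2 * \<alpha> 4 + 2 * \<alpha> 5 + \<alpha> 6 = 0"
    and i: "i \<in> plane_index"
  shows "\<exists>K. polyfun K \<and> (\<forall>z\<in>plane_domain \<alpha> i. K (plane_coords \<alpha> i z) = ham_I \<alpha> (fst z) (snd z))"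
  using i
proof (cases rule: plane_index_cases)
  case 1
  then show ?thesis using polyfun_ham_I[of \<alpha>] by (auto simp: plane_coords_simps hirz_coords_simps)
next
  case 2
  show ?thesis unfolding 2 plane_coords_simps hirz_coords_simps plane_domain_simps
    by (intro exI conjI ballI, rule polyfun_normal_form, rule ham_I_at_infinity[OF hyp, symmetric])
      (erule CollectD)
next
  case (3 j)
  obtain \<nu> \<beta> where \<nu>: "plane_centre \<alpha> j = (\<nu>, \<beta>)" by fastforce
  have "\<exists>c \<beta>' A B. \<forall>z. (\<nu> = None \<longrightarrow> fst z \<noteq> 0) \<longrightarrow>
      ham_I \<alpha> (fst z) (snd z) = normal_form c \<beta> \<beta>' A B (centre_coord \<nu>) (base_map (\<alpha> 0) \<nu> z)"
  proof -
    have "j = 1 \<or> j = 2 \<or> j = 3 \<or> j = 4 \<or> j = 5 \<or> j = 6" using 3(1) by auto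
    then consider "\<nu> = Some 0" "\<beta> = \<alpha> 1 + \<alpha> 2" | "\<nu> = Some 0" "\<beta> = \<alpha> 2"
      | "\<nu> = Some 1" "\<beta> = \<alpha> 3 + \<alpha> 4" | "\<nu> = Some 1" "\<beta> = \<alpha> 4"
      | "\<nu> = None" "\<beta> = \<alpha> 5" | "\<nu> = None" "\<beta> = \<alpha> 5 + \<alpha> 6"
      using \<nu> by (elim disjE) (simp_all add: plane_centre_def)
    then show ?thesis
    proof cases
      case 1
      then show ?thesis unfolding 1 centre_coord_def base_map_def option.case using ham_I_at_0 by blast
    next
      case 2
      then show ?thesis unfolding 2 centre_coord_def base_map_def option.case
        using ham_I_at_0 normal_form_commute by metis
    next
      case 3
      then show ?thesis unfolding 3 centre_coord_def base_map_def option.case using ham_I_at_1 by blast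
    next
      case 4
      then show ?thesis unfolding 4 centre_coord_def base_map_def option.case
        using ham_I_at_1 normal_form_commute by metis
    next
      case 5
      then show ?thesis unfolding 5 centre_coord_def base_map_def option.case
        using ham_I_at_infinity[OF hyp] by blast
    next
      case 6
      then show ?thesis unfolding 6 centre_coord_def base_map_def option.case
        using ham_I_at_infinity[OF hyp] normal_form_commute by metis
    qed
  qed
  then obtain c \<beta>' A B where nf: "\<And>z. (\<nu> = None \<longrightarrow> fst z \<noteq> 0) \<Longrightarrow>
      ham_I \<alpha> (fst z) (snd z) = normal_form c \<beta> \<beta>' A B (centre_coord \<nu>) (base_map (\<alpha> 0) \<nu> z)"
    by blast
  obtain K where K: "polyfun K" "\<And>z. snd z \<noteq> 0 \<Longrightarrow>
      K (unblow_map (centre_coord \<nu>) \<beta> z) = normal_form c \<beta> \<beta>' A B (centre_coord \<nu>) z"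
    using normal_form_unblow_map by blast
  have "K (plane_coords \<alpha> i z) = ham_I \<alpha> (fst z) (snd z)" if "z \<in> plane_domain \<alpha> i" for z
  proof -
    have b: "\<nu> = None \<longrightarrow> fst z \<noteq> 0" "snd (base_map (\<alpha> 0) \<nu> z) \<noteq> 0"
      using that 3 \<nu> by (simp_all add: plane_domain_simps)
    show ?thesis using K(2)[OF b(2)] nf[OF b(1)] 3 \<nu> by (simp add: plane_coords_simps(3))
  qed
  then show ?thesis using K(1) by blast
qed

text \<open>The extension is the Hamiltonian field of the polynomial \<open>K\<close> that expresses
  the Hamiltonian in the coordinates of plane \<open>i\<close>; its components are polynomial, hence
  holomorphic on the whole plane.\<close>

lemma field_extends_plane:
  assumes hyp: "3 * \<alpha> 0 + \<alpha> 1 + 2 * \<alpha> 2 + \<alpha> 3 + 2 * \<alpha> 4 + 2 * \<alpha> 5 + \<alpha> 6 = 0"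
    and i: "i \<in> plane_index"
  shows "field_extends (hamiltonian_field (ham_I \<alpha>)) (qp_pt \<alpha>) (plane_set \<alpha> i) (plane_coord \<alpha> i)"
proof -
  obtain K where K: "polyfun K" "\<forall>z\<in>plane_domain \<alpha> i. K (plane_coords \<alpha> i z) = ham_I \<alpha> (fst z) (snd z)"
    using ham_I_plane[OF hyp i] by blast
  obtain A B where AB: "polyfun A" "polyfun B"
    "\<forall>z. (K has_derivative (\<lambda>u. A z * fst u + B z * snd u)) (at z)"
    using polyfun_derivative[OF K(1)] by blast
  have coord: "plane_coord \<alpha> i (qp_pt \<alpha> z) = plane_coords \<alpha> i z" if "z \<in> plane_domain \<alpha> i" for z
    using plane_coord_pt[OF i, of \<alpha> "plane_coords \<alpha> i z"] plane_coord_qp[OF i that] by (simp add: qp_pt_eq)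
  show ?thesis
    unfolding field_extends_def
  proof (rule exI[of _ "\<lambda>z. (B z, - A z)"], intro conjI allI impI)
    show "holo_on (\<lambda>z. (B z, - A z)) (plane_coord \<alpha> i ` plane_set \<alpha> i)"
      using AB(1,2) by (intro holo_on_PairI polyfun_cdiff polyfun_minus)
    fix a assume "qp_pt \<alpha> a \<in> plane_set \<alpha> i"
    then obtain w where "Some (base_pt (\<alpha> 0) 0 a) = Some (plane_pt \<alpha> i w)"
      unfolding plane_set_def qp_pt_eq by blast
    then have "plane_pt \<alpha> i w = base_pt (\<alpha> 0) 0 a" by simp
    then have a: "a \<in> plane_domain \<alpha> i" by (rule plane_pt_eq_base[OF i])
    obtain L where L: "symplectic_derivative (plane_coords \<alpha> i) L a"
      using symplectic_derivative_plane_coords[OF i a] by blast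
    obtain P Q where PQ: "\<forall>z. ((\<lambda>z. ham_I \<alpha> (fst z) (snd z)) has_derivative (\<lambda>u. P z * fst u + Q z * snd u)) (at z)"
      using polyfun_derivative[OF polyfun_ham_I] by blast
    have v: "hamiltonian_field (ham_I \<alpha>) a = (Q a, - P a)"
      using hamiltonian_field_eq[OF spec[OF PQ, of a]] by simp
    have "L (Q a, - P a) = (B (plane_coords \<alpha> i a), - A (plane_coords \<alpha> i a))"
      by (rule symplectic_derivative_hamiltonian[OF L open_plane_domain[OF i] a
            bspec[OF K(2)] spec[OF AB(3)] spec[OF PQ]])
    moreover have "((\<lambda>z. plane_coord \<alpha> i (qp_pt \<alpha> z)) has_derivative L) (at a)"
    proof (rule has_derivative_transform_within_open[OF _ open_plane_domain[OF i] a])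
      show "(plane_coords \<alpha> i has_derivative L) (at a)"
        using L unfolding symplectic_derivative_def by blast
    qed (use coord in simp)
    ultimately show "\<exists>L. ((\<lambda>z. plane_coord \<alpha> i (qp_pt \<alpha> z)) has_derivative L) (at a) \<and>
        L (hamiltonian_field (ham_I \<alpha>) a) = (B (plane_coord \<alpha> i (qp_pt \<alpha> a)), - A (plane_coord \<alpha> i (qp_pt \<alpha> a)))"
      unfolding v coord[OF a] by (intro exI conjI)
  qed
qed

theorem theorem4p2:
  fixes \<alpha> :: "nat \<Rightarrow> complex"
  assumes "3 * \<alpha> 0 + \<alpha> 1 + 2 * \<alpha> 2 + \<alpha> 3 + 2 * \<alpha> 4 + 2 * \<alpha> 5 + \<alpha> 6 = 0"
  shows "(\<forall>j\<in>{0..6}. birational (r_map \<alpha> j) \<and> symplectic (r_map \<alpha> j)) \<and>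
    (\<exists>(U :: nat option \<Rightarrow> stilde_point set) (\<phi> :: nat option \<Rightarrow> stilde_point \<Rightarrow> c2).
       glued_from_planes (space_of_initial_conditions \<alpha>) plane_index (plane_coords \<alpha>) U \<phi> \<and>
       U None = range (qp_pt \<alpha>) \<and> (\<forall>a. \<phi> None (qp_pt \<alpha> a) = a) \<and>
       (\<forall>i\<in>plane_index.
          field_extends (hamiltonian_field (ham_I \<alpha>)) (qp_pt \<alpha>) (U i) (\<phi> i)))"
proof (rule conjI)
  show "\<forall>j\<in>{0..6}. birational (r_map \<alpha> j) \<and> symplectic (r_map \<alpha> j)"
    using r_map_birational_symplectic by blast
  have qp: "qp_pt \<alpha> = (\<lambda>z. Some (plane_pt \<alpha> None z))" by (simp add: qp_pt_eq plane_pt_def)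
  have "plane_set \<alpha> None = range (qp_pt \<alpha>)" unfolding plane_set_def qp ..
  moreover have "\<forall>a. plane_coord \<alpha> None (qp_pt \<alpha> a) = a"
    unfolding qp by (intro allI plane_coord_pt) (simp add: plane_index_def)
  moreover have "\<forall>i\<in>plane_index. field_extends (hamiltonian_field (ham_I \<alpha>)) (qp_pt \<alpha>) (plane_set \<alpha> i) (plane_coord \<alpha> i)"
    using field_extends_plane[OF assms] by blast
  ultimately show "\<exists>U \<phi>.
       glued_from_planes (space_of_initial_conditions \<alpha>) plane_index (plane_coords \<alpha>) U \<phi> \<and>
       U None = range (qp_pt \<alpha>) \<and> (\<forall>a. \<phi> None (qp_pt \<alpha> a) = a) \<and>
       (\<forall>i\<in>plane_index. field_extends (hamiltonian_field (ham_I \<alpha>)) (qp_pt \<alpha>) (U i) (\<phi> i))"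
    using glued_from_planes_space[of \<alpha>] by (intro exI conjI)
qed

end
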